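(* Let $G$ be a connected well-covered bipartite graph on $n$ vertices, with vertex set $\{1,\dots,n\}$, $n\ge 2$. Let $R=k[x_1,\dots,x_n]$ be a polynomial ring over a field $k$, and let $I=I(G)\subset R$ be the edge ideal of $G$. Then $$\operatorname{dstab}(I)\le n/2.$$ Equality holds if and only if $G$ is a tree with $n/2$ leaves.
   Context: All graphs are finite and simple. The edge ideal $I(G)$ is generated by the monomials $x_ix_j$ with $\{i,j\}$ an edge of $G$. For a homogeneous ideal $I$, $\operatorname{dstab}(I)$ is the smallest integer $s\ge 1$ such that $\operatorname{depth} R/I^t=\operatorname{depth} R/I^s$ for all $t\ge s$. A graph is well-covered if all its (inclusion-)minimal vertex covers have the same size. A leaf is a vertex of degree 1. The order $n$ of a connected well-covered bipartite graph (with at least two vertices) is even.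
   Formalization: For n = 2 the stated equality criterion fails (the single edge has dstab(I) = 1 = n/2 but two leaves), so the criterion proved is: equality holds if and only if G is a tree and either G has n/2 leaves or n = 2; for n > 2 it is unchanged. *)

theory Defs
  imports
    Complex_Main
    "HOL-Library.Poly_Mapping"
    "HOL-Library.Extended_Nat"
    "HOL-Algebra.Module"
    "HOL-Algebra.QuotRing"
    "HOL-Algebra.Ideal_Product"
    "Graph_Theory.Digraph_Component"
begin

section \<open>Graphs\<close>

text \<open>
  A finite simple graph is a \<^locale>\<open>pair_graph\<close>: a finite, loop-free, symmetric digraph
  without parallel arcs. The edge between \<open>i\<close> and \<open>j\<close> is present as both arcs
  \<open>(i, j)\<close> and \<open>(j, i)\<close>.
\<close>

definition bipartite :: "'a pair_pre_digraph \<Rightarrow> bool" where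
  "bipartite G \<longleftrightarrow>
     (\<exists>A B. A \<union> B = pverts G \<and> A \<inter> B = {} \<and> parcs G \<subseteq> A \<times> B \<union> B \<times> A)"

definition vertex_cover :: "'a pair_pre_digraph \<Rightarrow> 'a set \<Rightarrow> bool" where
  "vertex_cover G C \<longleftrightarrow> C \<subseteq> pverts G \<and> (\<forall>(u, v) \<in> parcs G. u \<in> C \<or> v \<in> C)"

definition minimal_vertex_cover :: "'a pair_pre_digraph \<Rightarrow> 'a set \<Rightarrow> bool" where
  "minimal_vertex_cover G C \<longleftrightarrow>
     vertex_cover G C \<and> (\<forall>D. D \<subset> C \<longrightarrow> \<not> vertex_cover G D)"

definition well_covered :: "'a pair_pre_digraph \<Rightarrow> bool" where
  "well_covered G \<longleftrightarrow>
     (\<forall>C D. minimal_vertex_cover G C \<longrightarrow> minimal_vertex_cover G D \<longrightarrow> card C = card D)"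

text \<open>
  In a symmetric digraph the out-degree of a vertex is its number of neighbours.
  Both vertices of the complete graph on two vertices are leaves. It is thus the one
  well-covered tree on \<open>n\<close> vertices, \<open>n \<ge> 2\<close>, whose number of leaves is not \<open>n/2\<close>; this
  is why the equality criterion treats \<open>n = 2\<close> separately.
\<close>

definition leaves :: "'a pair_pre_digraph \<Rightarrow> 'a set" where
  "leaves G = {v \<in> pverts G. out_degree (with_proj G) v = 1}"

text \<open>
  The library predicate \<^const>\<open>tree\<close> is meant for digraphs: it counts the closed walk
  \<open>a, b, a\<close> as a cycle, so no symmetric digraph with an edge satisfies it. The cycles of
  the underlying undirected graph are the directed cycles of length at least 3.
\<close>

definition undirected_tree :: "'a pair_pre_digraph \<Rightarrow> bool" where
  "undirected_tree G \<longleftrightarrow>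
     connected (with_proj G) \<and>
     \<not> (\<exists>p. pre_digraph.cycle (with_proj G) p \<and> length p \<ge> 3)"

section \<open>Depth of modules\<close>

text \<open>The submodule \<open>(f\<^sub>1, \<dots>, f\<^sub>r)M\<close> of \<open>M\<close>; it is zero for the empty sequence.\<close>

definition seq_submodule :: "('a, 'b, 'c) module_scheme \<Rightarrow> 'a list \<Rightarrow> 'b set" where
  "seq_submodule M fs =
     {(\<Oplus>\<^bsub>M\<^esub>j\<in>{..<length fs}. (fs ! j) \<odot>\<^bsub>M\<^esub> u j) | u. u \<in> {..<length fs} \<rightarrow> carrier M}"

text \<open>
  Each \<open>f\<^sub>i\<close> is a non-zero-divisor on \<open>M/(f\<^sub>1, \<dots>, f\<^sub>i\<^sub>-\<^sub>1)M\<close>, and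
  \<open>M \<noteq> (f\<^sub>1, \<dots>, f\<^sub>r)M\<close>.
\<close>

definition regular_sequence ::
    "('a, 'm) ring_scheme \<Rightarrow> ('a, 'b, 'c) module_scheme \<Rightarrow> 'a list \<Rightarrow> bool" where
  "regular_sequence R M fs \<longleftrightarrow>
     set fs \<subseteq> carrier R \<and>
     (\<forall>i<length fs. \<forall>u\<in>carrier M.
        (fs ! i) \<odot>\<^bsub>M\<^esub> u \<in> seq_submodule M (take i fs) \<longrightarrow> u \<in> seq_submodule M (take i fs)) \<and>
     seq_submodule M fs \<noteq> carrier M"

text \<open>
  The supremum of the lengths of the \<open>M\<close>-regular sequences in the ideal \<open>m\<close>. It is taken in
  \<^typ>\<open>enat\<close>, so that no value is invented for an unbounded set of lengths.
\<close>

definition depth ::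
    "('a, 'm) ring_scheme \<Rightarrow> 'a set \<Rightarrow> ('a, 'b, 'c) module_scheme \<Rightarrow> enat" where
  "depth R m M = (SUP fs \<in> {fs. set fs \<subseteq> m \<and> regular_sequence R M fs}. enat (length fs))"

definition quotient_module :: "('a, 'm) ring_scheme \<Rightarrow> 'a set \<Rightarrow> ('a, 'a set) module" where
  "quotient_module R J =
     \<lparr>carrier = carrier (R Quot J), monoid.mult = monoid.mult (R Quot J), one = one (R Quot J),
      zero = zero (R Quot J), add = add (R Quot J),
      smult = (\<lambda>r X. (J +>\<^bsub>R\<^esub> r) \<otimes>\<^bsub>R Quot J\<^esub> X)\<rparr>"

section \<open>Polynomial rings and edge ideals\<close>

text \<open>A polynomial maps exponent vectors to coefficients; the variables are indexed by \<^typ>\<open>nat\<close>.\<close>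

type_synonym 'k mpoly = "(nat \<Rightarrow>\<^sub>0 nat) \<Rightarrow>\<^sub>0 'k"

text \<open>The ring \<open>k[x\<^sub>1, \<dots>, x\<^sub>n]\<close>.\<close>

definition mpoly_ring :: "nat \<Rightarrow> ('k::field) mpoly ring" where
  "mpoly_ring n =
     \<lparr>carrier = {p. \<forall>e \<in> Poly_Mapping.keys p. Poly_Mapping.keys e \<subseteq> {1..n}},
      monoid.mult = (*), one = 1, zero = 0, add = (+)\<rparr>"

definition var :: "nat \<Rightarrow> ('k::field) mpoly" where
  "var i = Poly_Mapping.single (Poly_Mapping.single i 1) 1"

definition irrelevant_ideal :: "nat \<Rightarrow> ('k::field) mpoly set" where
  "irrelevant_ideal n = genideal (mpoly_ring n) (var ` {1..n})"

definition edge_ideal :: "nat \<Rightarrow> nat pair_pre_digraph \<Rightarrow> ('k::field) mpoly set" where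
  "edge_ideal n G = genideal (mpoly_ring n) {var i * var j | i j. (i, j) \<in> parcs G}"

text \<open>\<open>depth R/I\<^sup>t\<close> for \<open>R = k[x\<^sub>1, \<dots>, x\<^sub>n]\<close>, with respect to \<open>(x\<^sub>1, \<dots>, x\<^sub>n)\<close>;
  the power is taken in the multiplicative monoid of ideals of \<open>R\<close>.\<close>

definition depth_quotient_power :: "nat \<Rightarrow> ('k::field) mpoly set \<Rightarrow> nat \<Rightarrow> enat" where
  "depth_quotient_power n I t =
     depth (mpoly_ring n) (irrelevant_ideal n)
       (quotient_module (mpoly_ring n) (I [^]\<^bsub>ideals_set (mpoly_ring n)\<^esub> t))"

text \<open>
  The index exists for every homogeneous ideal by a theorem of Brodmann; without it, the
  value of \<^const>\<open>Least\<close> would be unspecified.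
\<close>

definition dstab :: "nat \<Rightarrow> ('k::field) mpoly set \<Rightarrow> nat" where
  "dstab n I =
     (LEAST s. s \<ge> 1 \<and> (\<forall>t\<ge>s. depth_quotient_power n I t = depth_quotient_power n I s))"

end

theory Submission
  imports Defs
begin

text \<open>
  Membership in the powers of \<open>I\<close> is combinatorial: a monomial lies in \<open>I\<^sup>t\<close> iff its
  exponent packs \<open>t\<close> edges, and by Koenig's theorem iff every (minimal) vertex cover has weight
  at least \<open>t\<close>. Koenig's theorem also yields a perfect matching \<open>\<mu>\<close> of the two sides, and in a
  well-covered graph each minimal cover contains exactly one end of each matching edge. Hence the
  difference \<open>x - y\<close> of the two ends is regular on every \<open>R/I\<^sup>t\<close>, so the depth is at least 1.

  The depth is at most 1 as soon as there is a monomial \<open>u\<close> of bidegree \<open>(t - 1, t - 1)\<close> such that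
  \<open>u a b\<close> lies in \<open>I\<^sup>t\<close> for all \<open>a\<close>, \<open>b\<close> on the two sides. Identifying the matching edges with the
  elements of a set \<open>A\<close>, ordered by \<open>i \<le> j\<close> iff \<open>i\<close> is adjacent to \<open>\<mu> j\<close>, such a \<open>u\<close> amounts to
  an integer weight on \<open>A\<close> with total 0 that is positive on every proper nonempty up-closed set.
  Growing a spanning tree gives such a weight for \<open>t = n/2\<close>, and one edge can be saved if the
  order has a chain of three elements, two equivalent elements, or a cycle. Otherwise \<open>G\<close> is a
  tree with a pendant vertex in each matching edge.

  For such a tree, \<open>R/I\<^sup>t\<close> modulo \<open>x - y\<close> is the monomial quotient in which \<open>x\<close> and \<open>y\<close> are
  identified. A socle monomial of it forces \<open>t \<ge> n/2\<close>, by peeling off the leaves of the tree of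
  non-pendant vertices one at a time. So for \<open>t < n/2\<close> the sum of the variables is regular on it
  and the depth is at least 2.
\<close>

section \<open>Edge packings and covers\<close>

text \<open>A minimal cover has \<open>n/2\<close> vertices, as many as the perfect matching has
  edges, so it meets each matching edge exactly once. The Koenig criterion presents the
  \<open>t\<close>-th power as the intersection of the \<open>t\<close>-th powers of the minimal
  primes, each of which contains exactly one of \<open>x\<close> and \<open>y\<close>; this is why
  \<open>x - y\<close> is regular. The constant \<open>n/2\<close> is the size of \<open>A\<close>:
  a spanning tree on \<open>A\<close> has \<open>n/2 - 1\<close> edges, each of them raises the
  degree of the weight by at most 1, and a weight of degree \<open>c\<close> serves for every
  \<open>t > c\<close>. The three exceptional configurations are those where some \<open>X\<close>
  can be separated with degree at most \<open>card X - 2\<close>.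

  The depth is squeezed to the value 1 from index \<open>n/2\<close> on. In the tree case every
  smaller index has depth at least 2, so no earlier index can be stable; depths of consecutive
  powers are never compared. Identifying the ends of a matching edge leaves a loop, so the merged
  vertex is the one vertex of the peeled tree with a loop in place of a pendant neighbour, and it
  has to be the root.\<close>

definition incidences :: "('a \<times> 'a) list \<Rightarrow> 'a \<Rightarrow> nat" where
  "incidences es v = (\<Sum>e\<leftarrow>es. of_bool (fst e = v) + of_bool (snd e = v))"

text \<open>\<open>incidences es\<close> is the exponent of the product of the edges in
  \<open>es\<close>, so this is divisibility of a monomial by a product of \<open>t\<close> edges.
  Lists allow an edge to be repeated, and a loop counts twice at its vertex.\<close>

definition packs :: "('a \<times> 'a) set \<Rightarrow> nat \<Rightarrow> ('a \<Rightarrow> nat) \<Rightarrow> bool" where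
  "packs E t u \<longleftrightarrow> (\<exists>es. length es = t \<and> set es \<subseteq> E \<and> incidences es \<le> u)"

definition covers :: "('a \<times> 'a) set \<Rightarrow> 'a set \<Rightarrow> bool" where
  "covers E C \<longleftrightarrow> (\<forall>(a, b) \<in> E. a \<in> C \<or> b \<in> C)"

abbreviation unit :: "'a \<Rightarrow> 'a \<Rightarrow> nat" where
  "unit a v \<equiv> of_bool (v = a)"

lemma incidences_simps [simp]:
  "incidences [] v = 0"
  "incidences (e # es) v = of_bool (fst e = v) + of_bool (snd e = v) + incidences es v"
  "incidences (es @ fs) v = incidences es v + incidences fs v"
  by (simp_all add: incidences_def)

lemma incidences_remove1:
  assumes "e \<in> set es"
  shows "incidences es v = of_bool (fst e = v) + of_bool (snd e = v) + incidences (remove1 e es) v"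
  using assms by (induction es) auto

lemma incidences_pos_iff: "incidences es v > 0 \<longleftrightarrow> (\<exists>e \<in> set es. fst e = v \<or> snd e = v)"
  by (induction es) auto

lemma packs_0 [simp]: "packs E 0 u"
  by (auto simp: packs_def le_fun_def)

lemma packs_mono: "packs E t u \<Longrightarrow> u \<le> v \<Longrightarrow> packs E t v"
  unfolding packs_def using order_trans by blast

lemma packs_le:
  assumes "packs E t u" "s \<le> t"
  shows "packs E s u"
proof -
  obtain es where es: "length es = t" "set es \<subseteq> E" "incidences es \<le> u"
    using assms(1) by (auto simp: packs_def)
  have "incidences (take s es) v \<le> incidences es v" for v
    by (metis append_take_drop_id incidences_simps(3) le_add1)
  then have "incidences (take s es) \<le> u"
    by (rule order_trans[OF le_funI es(3)])
  then show ?thesis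
    using es(1,2) assms(2) set_take_subset[of s es] unfolding packs_def
    by (intro exI[of _ "take s es"]) auto
qed

lemma packs_add:
  assumes "packs E s u" "packs E t v"
  shows "packs E (s + t) (\<lambda>x. u x + v x)"
proof -
  obtain es fs where "length es = s" "set es \<subseteq> E" "incidences es \<le> u"
    "length fs = t" "set fs \<subseteq> E" "incidences fs \<le> v"
    using assms by (auto simp: packs_def)
  moreover from this have "incidences (es @ fs) \<le> (\<lambda>x. u x + v x)"
    by (simp add: le_fun_def add_mono)
  ultimately show ?thesis
    unfolding packs_def by (intro exI[of _ "es @ fs"]) auto
qed

lemma packs_edge: "(a, b) \<in> E \<Longrightarrow> packs E 1 (\<lambda>v. unit a v + unit b v)"
  unfolding packs_def by (rule exI[of _ "[(a, b)]"]) (auto simp: le_fun_def)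

lemma packs_Suc_iff:
  "packs E (Suc t) u \<longleftrightarrow>
    (\<exists>(a, b) \<in> E. \<exists>u'. packs E t u' \<and> (\<forall>v. u' v + unit a v + unit b v \<le> u v))"
proof
  assume "packs E (Suc t) u"
  then obtain es where es: "length es = Suc t" "set es \<subseteq> E" "incidences es \<le> u"
    by (auto simp: packs_def)
  then obtain e es' where e: "es = e # es'" by (cases es) auto
  have "packs E t (incidences es')" using es e by (auto simp: packs_def)
  moreover have "\<forall>v. incidences es' v + unit (fst e) v + unit (snd e) v \<le> u v"
  proof
    fix v show "incidences es' v + unit (fst e) v + unit (snd e) v \<le> u v"
      using es(3) e by (auto simp: le_fun_def of_bool_def split: if_splits dest!: spec[of _ v])
  qed
  moreover have "(fst e, snd e) \<in> E" using es e by auto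
  ultimately show "\<exists>(a, b) \<in> E. \<exists>u'. packs E t u' \<and> (\<forall>v. u' v + unit a v + unit b v \<le> u v)"
    by blast
next
  assume "\<exists>(a, b) \<in> E. \<exists>u'. packs E t u' \<and> (\<forall>v. u' v + unit a v + unit b v \<le> u v)"
  then obtain a b u' where "(a, b) \<in> E" "packs E t u'" "\<And>v. u' v + unit a v + unit b v \<le> u v"
    by blast
  then show "packs E (Suc t) u"
    using packs_mono[OF packs_add[OF packs_edge[of a b E] \<open>packs E t u'\<close>], of u]
    by (simp add: le_fun_def algebra_simps)
qed

lemma packs_add_edge:
  assumes "(a, b) \<in> E" "packs E t u" "\<And>v. u v + unit a v + unit b v \<le> w v"
  shows "packs E (Suc t) w"
  using assms packs_Suc_iff by blast

text \<open>The easy half of the duality: every packed edge spends a unit of weight at some vertex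
  of \<open>C\<close>.\<close>

lemma cover_weight_ge:
  assumes "packs E t u" "covers E C" "finite C"
  shows "t \<le> sum u C"
proof -
  obtain es where es: "length es = t" "set es \<subseteq> E" "incidences es \<le> u"
    using assms(1) by (auto simp: packs_def)
  have "length es \<le> sum (incidences es) C" using es(2)
  proof (induction es)
    case (Cons e es)
    have "sum (incidences (e # es)) C =
        (\<Sum>v\<in>C. of_bool (fst e = v)) + (\<Sum>v\<in>C. of_bool (snd e = v)) + sum (incidences es) C"
      by (simp add: sum.distrib)
    moreover have "(\<Sum>v\<in>C. of_bool (x = v)) = (of_bool (x \<in> C) :: nat)" for x
      using assms(3) by (simp add: of_bool_def)
    moreover have "fst e \<in> C \<or> snd e \<in> C"
      using Cons.prems assms(2) by (cases e) (auto simp: covers_def)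
    ultimately show ?case using Cons by auto
  qed simp
  also have "\<dots> \<le> sum u C" using es(3) by (intro sum_mono) (auto simp: le_fun_def)
  finally show ?thesis using es(1) by simp
qed

text \<open>
  A weighted Koenig theorem. Either a cover of weight \<open>t\<close> splits the vertices into
  two smaller instances, or no such cover contains both ends of an edge of positive weight,
  and any such edge can be removed.
\<close>

lemma packs_if_covers_ge:
  assumes "finite A" "finite B" "A \<inter> B = {}" "E \<subseteq> A \<times> B"
    and "\<And>C. C \<subseteq> A \<union> B \<Longrightarrow> covers E C \<Longrightarrow> t \<le> sum u C"
  shows "packs E t u"
  using assms(5)
proof (induction "sum u (A \<union> B)" arbitrary: u t rule: less_induct)
  case less
  have fin: "finite C" if "C \<subseteq> A \<union> B" for C
    using that assms(1,2) finite_subset by blast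
  show ?case
  proof (cases "t = 0")
    case False
    show ?thesis
    proof (cases "\<exists>C\<subseteq>A \<union> B. covers E C \<and> sum u C = t \<and> sum u ((C \<inter> A) \<union> (B - C)) > 0
        \<and> sum u ((A - C) \<union> (B \<inter> C)) > 0")
      case True
      then obtain C where C: "C \<subseteq> A \<union> B" "covers E C" "sum u C = t"
        "sum u ((C \<inter> A) \<union> (B - C)) > 0" "sum u ((A - C) \<union> (B \<inter> C)) > 0" by blast
      \<comment> \<open>An edge not covered from \<open>B\<close> runs inside \<open>X\<close>, and
        one not covered from \<open>A\<close> inside \<open>Y\<close>. Each part has the weight of
        its share of \<open>C\<close> as target, and is a smaller instance because the other part
        has positive weight.\<close>
      define X where "X = (C \<inter> A) \<union> (B - C)"
      define Y where "Y = (A - C) \<union> (B \<inter> C)"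
      define r where "r Z v = (if v \<in> Z then u v else 0)" for Z v
      have sum_r: "sum (r Z) D = sum u (D \<inter> Z)" if "finite D" for Z D
        using that by (simp add: r_def sum.inter_restrict)
      have XY: "X \<union> Y = A \<union> B" "X \<inter> Y = {}" using C(1) assms(3) by (auto simp: X_def Y_def)
      have finXY: "finite X" "finite Y" using XY(1) assms(1,2) by (metis fin Un_upper1 Un_upper2)+
      have tot: "sum u (A \<union> B) = sum u X + sum u Y"
        using XY sum.union_disjoint[of X Y u] assms(1,2) by (metis fin Un_upper1 Un_upper2)
      have Ct: "t = sum u (C \<inter> A) + sum u (C \<inter> B)"
      proof -
        have "C = (C \<inter> A) \<union> (C \<inter> B)" "(C \<inter> A) \<inter> (C \<inter> B) = {}" using C(1) assms(3) by auto
        then show ?thesis using C(3) sum.union_disjoint[of "C \<inter> A" "C \<inter> B" u] assms(1,2) by auto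
      qed
      have "packs E (sum u (C \<inter> A)) (r X)"
      proof (rule less.hyps)
        show "sum (r X) (A \<union> B) < sum u (A \<union> B)"
        proof -
          have "sum (r X) (A \<union> B) = sum u X"
            using XY(1) sum_r[of "A \<union> B" X] assms(1,2) finXY by (simp add: Int_absorb1 flip: XY(1))
          then show ?thesis using tot C(5)[folded Y_def] by simp
        qed
      next
        fix D assume D: "D \<subseteq> A \<union> B" "covers E D"
        \<comment> \<open>An edge ending in \<open>C \<inter> B\<close> is covered by that end; any
          other edge lies in \<open>X\<close>, where \<open>D'\<close> follows \<open>D\<close>.
          Subtracting the weight of \<open>C \<inter> B\<close> from the bound for \<open>D'\<close>
          leaves the bound for \<open>D\<close> on \<open>X\<close>.\<close>
        define D' where "D' = (D \<inter> C \<inter> A) \<union> (C \<inter> B) \<union> (D \<inter> (B - C))"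
        have "covers E D'" using D(2) C(2) assms(4) by (fastforce simp: covers_def D'_def)
        moreover have "D' \<subseteq> A \<union> B" by (auto simp: D'_def)
        ultimately have "t \<le> sum u D'" by (intro less.prems)
        also have "sum u D' = sum u (D \<inter> C \<inter> A) + sum u (C \<inter> B) + sum u (D \<inter> (B - C))"
          unfolding D'_def using assms(1-3) by (subst sum.union_disjoint; (subst sum.union_disjoint)?) auto
        also have "\<dots> = sum u (D \<inter> X) + sum u (C \<inter> B)"
        proof -
          have "D \<inter> X = (D \<inter> C \<inter> A) \<union> (D \<inter> (B - C))" by (auto simp: X_def)
          moreover have "sum u ((D \<inter> C \<inter> A) \<union> (D \<inter> (B - C))) = sum u (D \<inter> C \<inter> A) + sum u (D \<inter> (B - C))"
            using assms(1-3) by (subst sum.union_disjoint) auto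
          ultimately show ?thesis by simp
        qed
        finally show "sum u (C \<inter> A) \<le> sum (r X) D" using Ct sum_r[OF fin[OF D(1)]] by simp
      qed
      moreover have "packs E (sum u (C \<inter> B)) (r Y)"
      proof (rule less.hyps)
        show "sum (r Y) (A \<union> B) < sum u (A \<union> B)"
        proof -
          have "sum (r Y) (A \<union> B) = sum u Y"
            using XY(1) sum_r[of "A \<union> B" Y] assms(1,2) finXY by (simp add: Int_absorb1 flip: XY(1))
          then show ?thesis using tot C(4)[folded X_def] by simp
        qed
      next
        fix D assume D: "D \<subseteq> A \<union> B" "covers E D"
        define D' where "D' = (D \<inter> C \<inter> B) \<union> (C \<inter> A) \<union> (D \<inter> (A - C))"
        have "covers E D'" using D(2) C(2) assms(4) by (fastforce simp: covers_def D'_def)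
        moreover have "D' \<subseteq> A \<union> B" by (auto simp: D'_def)
        ultimately have "t \<le> sum u D'" by (intro less.prems)
        also have "sum u D' = sum u (D \<inter> C \<inter> B) + sum u (C \<inter> A) + sum u (D \<inter> (A - C))"
          unfolding D'_def using assms(1-3) by (subst sum.union_disjoint; (subst sum.union_disjoint)?) auto
        also have "\<dots> = sum u (D \<inter> Y) + sum u (C \<inter> A)"
        proof -
          have "D \<inter> Y = (D \<inter> C \<inter> B) \<union> (D \<inter> (A - C))" by (auto simp: Y_def)
          moreover have "sum u ((D \<inter> C \<inter> B) \<union> (D \<inter> (A - C))) = sum u (D \<inter> C \<inter> B) + sum u (D \<inter> (A - C))"
            using assms(1-3) by (subst sum.union_disjoint) auto
          ultimately show ?thesis by simp
        qed
        finally show "sum u (C \<inter> B) \<le> sum (r Y) D" using Ct sum_r[OF fin[OF D(1)]] by simp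
      qed
      ultimately have "packs E t (\<lambda>v. r X v + r Y v)" using packs_add Ct by fastforce
      moreover have "(\<lambda>v. r X v + r Y v) \<le> u" using XY by (auto simp: r_def le_fun_def)
      ultimately show ?thesis by (rule packs_mono)
    next
      case nosplit: False
      have "\<exists>(a, b) \<in> E. u a > 0 \<and> u b > 0"
      proof (rule ccontr)
        assume *: "\<not> ?thesis"
        \<comment> \<open>If every edge had an end of weight 0, these ends would lie in a cover of
          weight 0, which is less than \<open>t\<close>.\<close>
        have "covers E {v \<in> A \<union> B. u v = 0}" using * assms(4) by (auto simp: covers_def)
        then have "t \<le> sum u {v \<in> A \<union> B. u v = 0}" by (intro less.prems) auto
        then show False using False by simp
      qed
      then obtain a b where ab: "(a, b) \<in> E" "u a > 0" "u b > 0" by blast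
      have abAB: "a \<in> A" "b \<in> B" "a \<noteq> b" using ab(1) assms(3,4) by auto
      define u' where "u' v = u v - unit a v - unit b v" for v
      have u': "u' v + unit a v + unit b v = u v" for v using ab abAB by (auto simp: u'_def)
      have su: "sum u D = sum u' D + of_bool (a \<in> D) + of_bool (b \<in> D)" if "finite D" for D
      proof -
        have "sum u D = (\<Sum>v\<in>D. u' v + unit a v + unit b v)" by (simp add: u')
        also have "\<dots> = sum u' D + of_bool (a \<in> D) + of_bool (b \<in> D)"
          using that by (simp add: sum.distrib of_bool_def)
        finally show ?thesis .
      qed
      have "packs E (t - 1) u'"
      proof (rule less.hyps)
        show "sum u' (A \<union> B) < sum u (A \<union> B)" using su[of "A \<union> B"] abAB assms(1,2) by simp
      next
        fix D assume D: "D \<subseteq> A \<union> B" "covers E D"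
        have t: "t \<le> sum u D" using less.prems D by blast
        show "t - 1 \<le> sum u' D"
        \<comment> \<open>Removing the edge lowers the weight of \<open>D\<close> by at most 2,
          which is too much only if \<open>D\<close> has weight exactly \<open>t\<close> and
          contains both ends. Such a \<open>D\<close> would be a splitting cover, since
          \<open>a\<close> and \<open>b\<close> give its two parts positive weight.\<close>
        proof (cases "sum u D = t \<and> a \<in> D \<and> b \<in> D")
          case True
          have "sum u ((D \<inter> A) \<union> (B - D)) \<ge> u a" "sum u ((A - D) \<union> (B \<inter> D)) \<ge> u b"
            using True abAB assms(1,2) by (intro member_le_sum; simp)+
          then show ?thesis using nosplit D True ab by force
        next
          case no: False
          show ?thesis using su[OF fin[OF D(1)]] t no by (auto split: if_splits simp: of_bool_def)
        qed
      qed
      from packs_add_edge[OF ab(1) this, of u] u' False show ?thesis by simp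
    qed
  qed simp
qed

section \<open>Monomial ideals and powers of edge ideals\<close>

abbreviation lookup :: "('a \<Rightarrow>\<^sub>0 'b::zero) \<Rightarrow> 'a \<Rightarrow> 'b" where
  "lookup \<equiv> Poly_Mapping.lookup"

abbreviation keys :: "('a \<Rightarrow>\<^sub>0 'b::zero) \<Rightarrow> 'a set" where
  "keys \<equiv> Poly_Mapping.keys"

abbreviation single :: "'a \<Rightarrow> 'b \<Rightarrow> 'a \<Rightarrow>\<^sub>0 'b::zero" where
  "single \<equiv> Poly_Mapping.single"

lemma lookup_single_mult_add [simp]:
  fixes p :: "'a::cancel_comm_monoid_add \<Rightarrow>\<^sub>0 'b::semiring_0"
  shows "lookup (single d c * p) (d + e) = c * lookup p e"
  by (simp add: lookup_mult lookup_single when_mult)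

lemma lookup_single_mult_eq_0:
  fixes p :: "'a::cancel_comm_monoid_add \<Rightarrow>\<^sub>0 'b::semiring_0"
  assumes "\<nexists>r. e = d + r"
  shows "lookup (single d c * p) e = 0"
  using assms by (auto simp: lookup_mult lookup_single when_mult)

lemma keys_single_mult:
  fixes p :: "'a::cancel_comm_monoid_add \<Rightarrow>\<^sub>0 'b::semiring_no_zero_divisors"
  assumes "c \<noteq> 0"
  shows "keys (single d c * p) = (+) d ` keys p"
proof (intro Set.set_eqI iffI)
  fix e assume e: "e \<in> keys (single d c * p)"
  then obtain r where "e = d + r"
    using lookup_single_mult_eq_0[of e d c p] by (auto simp: in_keys_iff)
  with e assms show "e \<in> (+) d ` keys p" by (auto simp: in_keys_iff)
qed (use assms in \<open>auto simp: in_keys_iff\<close>)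

lemma sum_monomials: "(\<Sum>e\<in>keys p. single e (lookup p e)) = p"
proof (rule poly_mapping_eqI)
  fix e
  have "lookup (\<Sum>e\<in>keys p. single e (lookup p e)) e = (\<Sum>d\<in>keys p. if d = e then lookup p d else 0)"
    by (auto simp: lookup_sum lookup_single when_def intro!: sum.cong)
  also have "\<dots> = lookup p e" by (auto simp: in_keys_iff)
  finally show "lookup (\<Sum>e\<in>keys p. single e (lookup p e)) e = lookup p e" .
qed

definition exponents :: "nat \<Rightarrow> (nat \<Rightarrow>\<^sub>0 nat) set" where
  "exponents n = {e. keys e \<subseteq> {1..n}}"

lemma exponents_add [simp]: "d + e \<in> exponents n \<longleftrightarrow> d \<in> exponents n \<and> e \<in> exponents n"
  by (auto simp: exponents_def in_keys_iff lookup_add subset_iff)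

lemma zero_in_exponents [simp]: "0 \<in> exponents n"
  by (simp add: exponents_def)

lemma single_in_exponents [simp]: "i \<in> {1..n} \<Longrightarrow> single i c \<in> exponents n"
  by (simp add: exponents_def)

lemma mpoly_ring_simps [simp]:
  "carrier (mpoly_ring n) = {p. keys p \<subseteq> exponents n}"
  "p \<otimes>\<^bsub>mpoly_ring n\<^esub> q = p * q" "\<one>\<^bsub>mpoly_ring n\<^esub> = 1"
  "p \<oplus>\<^bsub>mpoly_ring n\<^esub> q = p + q" "\<zero>\<^bsub>mpoly_ring n\<^esub> = 0"
  by (auto simp: mpoly_ring_def exponents_def)

lemma keys_mult_subset:
  assumes "\<And>d e. d \<in> keys p \<Longrightarrow> e \<in> keys q \<Longrightarrow> d + e \<in> U"
  shows "keys (p * q) \<subseteq> U"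
  using assms keys_mult[of p q] by blast

lemma keys_minus_subset: "keys (p - q) \<subseteq> keys p \<union> keys (q :: 'a \<Rightarrow>\<^sub>0 'b::ab_group_add)"
  by (auto simp: in_keys_iff lookup_minus)

lemma keys_sum_subset:
  assumes "\<And>i. i \<in> S \<Longrightarrow> keys (f i) \<subseteq> U"
  shows "keys (sum f S) \<subseteq> U"
  using assms
proof (induction S rule: infinite_finite_induct)
  case (insert x F)
  then show ?case using keys_add[of "f x" "sum f F"] by force
qed auto

lemma mpoly_ring_cring: "cring (mpoly_ring n :: 'k::field mpoly ring)"
proof (rule cringI)
  show "abelian_group (mpoly_ring n :: 'k mpoly ring)"
  proof (rule abelian_groupI)
    fix x :: "'k mpoly" assume "x \<in> carrier (mpoly_ring n)"
    then show "\<exists>y\<in>carrier (mpoly_ring n). y \<oplus>\<^bsub>mpoly_ring n\<^esub> x = \<zero>\<^bsub>mpoly_ring n\<^esub>"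
      by (intro bexI[of _ "- x"]) (auto simp: in_keys_iff subset_iff)
  qed (use keys_add in \<open>fastforce simp: algebra_simps\<close>)+
  show "Group.comm_monoid (mpoly_ring n :: 'k mpoly ring)"
    by (rule comm_monoidI) (auto simp: algebra_simps dest: in_mono intro!: keys_mult_subset)
qed (simp add: algebra_simps)

text \<open>Given by its exponents rather than by generators, so that membership is a condition on
  \<open>keys\<close> alone. It is an ideal when \<open>U\<close> is
  \<open>up_closed\<close>.\<close>

definition mon_ideal :: "nat \<Rightarrow> (nat \<Rightarrow>\<^sub>0 nat) set \<Rightarrow> ('k::field) mpoly set" where
  "mon_ideal n U = {p. keys p \<subseteq> exponents n \<inter> U}"

definition up_closed :: "(nat \<Rightarrow>\<^sub>0 nat) set \<Rightarrow> bool" where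
  "up_closed U \<longleftrightarrow> (\<forall>e\<in>U. \<forall>d. d + e \<in> U)"

lemma mon_ideal_0 [simp]: "0 \<in> mon_ideal n U"
  by (simp add: mon_ideal_def)

lemma mon_ideal_add: "p \<in> mon_ideal n U \<Longrightarrow> q \<in> mon_ideal n U \<Longrightarrow> p + q \<in> mon_ideal n U"
  using keys_add[of p q] by (auto simp: mon_ideal_def)

lemma mon_ideal_uminus [simp]: "- p \<in> mon_ideal n U \<longleftrightarrow> p \<in> mon_ideal n U"
  by (auto simp: mon_ideal_def in_keys_iff subset_iff)

lemma mon_ideal_diff: "p \<in> mon_ideal n U \<Longrightarrow> q \<in> mon_ideal n U \<Longrightarrow> p - q \<in> mon_ideal n U"
  using mon_ideal_add[of p n U "- q"] by simp

lemma mon_ideal_mult: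
  assumes "up_closed U" "p \<in> mon_ideal n U" "keys q \<subseteq> exponents n"
  shows "q * p \<in> mon_ideal n U"
  unfolding mon_ideal_def
  using assms by (auto simp: mon_ideal_def up_closed_def subset_iff dest!: keys_mult[THEN subsetD])

lemma mon_ideal_ideal:
  assumes "up_closed U"
  shows "ideal (mon_ideal n U :: 'k::field mpoly set) (mpoly_ring n)"
proof -
  interpret cring "mpoly_ring n :: 'k mpoly ring" by (rule mpoly_ring_cring)
  show ?thesis
  proof (rule idealI)
    show "subgroup (mon_ideal n U) (add_monoid (mpoly_ring n :: 'k mpoly ring))"
    proof (rule add.subgroupI)
      fix a :: "'k mpoly" assume a: "a \<in> mon_ideal n U"
      have "\<ominus>\<^bsub>mpoly_ring n\<^esub> a = - a"
      proof (rule minus_equality[simplified])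
        show "keys a \<subseteq> exponents n" "keys (- a) \<subseteq> exponents n"
          using a by (auto simp: mon_ideal_def in_keys_iff subset_iff)
      qed simp
      then show "\<ominus>\<^bsub>mpoly_ring n\<^esub> a \<in> mon_ideal n U"
        using a by simp
    next
      show "mon_ideal n U \<subseteq> carrier (mpoly_ring n :: 'k mpoly ring)"
        by (auto simp: mon_ideal_def)
      show "mon_ideal n U \<noteq> ({} :: 'k mpoly set)" using mon_ideal_0 by blast
    qed (simp add: mon_ideal_add)
  next
    fix a x :: "'k mpoly" assume "a \<in> mon_ideal n U" "x \<in> carrier (mpoly_ring n)"
    then show "x \<otimes>\<^bsub>mpoly_ring n\<^esub> a \<in> mon_ideal n U" "a \<otimes>\<^bsub>mpoly_ring n\<^esub> x \<in> mon_ideal n U"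
      using mon_ideal_mult[OF assms, of a n x] by (auto simp: mult.commute)
  qed (rule ring_axioms)
qed

lemma mon_ideal_subset:
  assumes "ideal J (mpoly_ring n)" and "\<And>e c. e \<in> U \<Longrightarrow> e \<in> exponents n \<Longrightarrow> single e c \<in> J"
  shows "mon_ideal n U \<subseteq> (J :: 'k::field mpoly set)"
proof
  interpret J: ideal J "mpoly_ring n" by (rule assms(1))
  fix p :: "'k mpoly" assume p: "p \<in> mon_ideal n U"
  have "(\<Sum>e\<in>K. single e (lookup p e)) \<in> J" if "finite K" "K \<subseteq> keys p" for K
    using that
  proof (induction K)
    case empty
    then show ?case using additive_subgroup.zero_closed[OF ideal.axioms(1)[OF assms(1)]] by simp
  next
    case (insert e K)
    then have "e \<in> U" "e \<in> exponents n" using p by (auto simp: mon_ideal_def)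
    then have "single e (lookup p e) \<in> J" by (rule assms(2))
    with insert have "single e (lookup p e) \<oplus>\<^bsub>mpoly_ring n\<^esub> (\<Sum>e\<in>K. single e (lookup p e)) \<in> J"
      using additive_subgroup.a_closed[OF ideal.axioms(1)[OF assms(1)]] by blast
    with insert(1,2) show ?case by simp
  qed
  from this[of "keys p"] show "p \<in> J" by (simp add: sum_monomials)
qed

lemma ideal_prod_mon_ideal:
  assumes "up_closed U" "up_closed V" "up_closed W"
    and "\<And>u v. u \<in> U \<Longrightarrow> v \<in> V \<Longrightarrow> u + v \<in> W"
    and "\<And>w. w \<in> W \<Longrightarrow> \<exists>u\<in>U. \<exists>v\<in>V. w = u + v"
  shows "ideal_prod (mpoly_ring n) (mon_ideal n U) (mon_ideal n V) = (mon_ideal n W :: 'k::field mpoly set)"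
    (is "?P = _")
proof
  interpret cring "mpoly_ring n :: 'k mpoly ring" by (rule mpoly_ring_cring)
  have I: "ideal ?P (mpoly_ring n)"
    by (intro ideal_prod_is_ideal mon_ideal_ideal assms)
  show "?P \<subseteq> mon_ideal n W"
  proof
    fix p assume "p \<in> ?P"
    then show "p \<in> mon_ideal n W"
    proof induction
      case (prod i j)
      then show ?case
        using assms(4) by (auto simp: mon_ideal_def subset_iff dest!: keys_mult[THEN subsetD])
    qed (simp add: mon_ideal_add)
  qed
  show "mon_ideal n W \<subseteq> ?P"
  proof (rule mon_ideal_subset[OF I])
    fix e and c :: 'k assume e: "e \<in> W" "e \<in> exponents n"
    then obtain u v where uv: "u \<in> U" "v \<in> V" "e = u + v" using assms(5) by blast
    have "single u c \<in> mon_ideal n U" "single v 1 \<in> mon_ideal n V"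
      using e uv by (auto simp: mon_ideal_def)
    from ideal_prod.prod[OF this, of "mpoly_ring n"] show "single e c \<in> ?P"
      by (simp add: mult_single uv)
  qed
qed

definition packing_exponents :: "(nat \<times> nat) set \<Rightarrow> nat \<Rightarrow> (nat \<Rightarrow>\<^sub>0 nat) set" where
  "packing_exponents E t = {e. packs E t (lookup e)}"

lemma up_closed_packing_exponents: "up_closed (packing_exponents E t)"
  unfolding up_closed_def packing_exponents_def
proof safe
  fix e d assume "packs E t (lookup e)"
  then show "packs E t (lookup (d + e))"
    by (rule packs_mono) (simp add: le_fun_def lookup_add)
qed

lemma packing_exponents_0 [simp]: "packing_exponents E 0 = UNIV"
  by (auto simp: packing_exponents_def)

lemma lookup_two_singles [simp]:
  "lookup (single a 1 + single b 1) v = unit a v + unit b v"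
  by (auto simp: lookup_add lookup_single when_def)

lemma packing_exponents_Suc_iff:
  "e \<in> packing_exponents E (Suc t) \<longleftrightarrow>
    (\<exists>(a, b)\<in>E. \<exists>d\<in>packing_exponents E t. e = d + (single a 1 + single b 1))"
proof
  assume "e \<in> packing_exponents E (Suc t)"
  then obtain a b u where u: "(a, b) \<in> E" "packs E t u" "\<And>v. u v + unit a v + unit b v \<le> lookup e v"
    unfolding packing_exponents_def mem_Collect_eq packs_Suc_iff by blast
  have le: "unit a v + unit b v \<le> lookup e v" for v using u(3)[of v] by linarith
  have "e = e - (single a 1 + single b 1) + (single a 1 + single b 1)"
    by (rule poly_mapping_eqI, subst lookup_add)
      (use le in \<open>simp only: lookup_minus lookup_two_singles le_add_diff_inverse2\<close>)
  moreover have "u \<le> lookup (e - (single a 1 + single b 1))"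
  proof (rule le_funI)
    fix v show "u v \<le> lookup (e - (single a 1 + single b 1)) v"
      using u(3)[of v] by (simp only: lookup_minus lookup_two_singles)
  qed
  then have "e - (single a 1 + single b 1) \<in> packing_exponents E t"
    unfolding packing_exponents_def mem_Collect_eq by (rule packs_mono[OF u(2)])
  ultimately show "\<exists>(a, b)\<in>E. \<exists>d\<in>packing_exponents E t. e = d + (single a 1 + single b 1)"
    using u(1) by blast
next
  assume "\<exists>(a, b)\<in>E. \<exists>d\<in>packing_exponents E t. e = d + (single a 1 + single b 1)"
  then obtain a b d where d: "(a, b) \<in> E" "packs E t (lookup d)" "e = d + (single a 1 + single b 1)"
    by (auto simp: packing_exponents_def)
  have "packs E (Suc t) (lookup e)"
    by (rule packs_add_edge[OF d(1,2)]) (simp only: d(3) lookup_add[of d] lookup_two_singles add.assoc order_refl)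
  then show "e \<in> packing_exponents E (Suc t)" by (simp add: packing_exponents_def)
qed

lemma var_mult_var: "var i * var j = (single (single i 1 + single j 1) 1 :: 'k::field mpoly)"
  by (simp add: var_def mult_single)

lemma edge_ideal_eq:
  assumes "parcs G \<subseteq> {1..n} \<times> {1..n}"
  shows "edge_ideal n G = (mon_ideal n (packing_exponents (parcs G) 1) :: 'k::field mpoly set)"
proof -
  interpret cring "mpoly_ring n :: 'k mpoly ring" by (rule mpoly_ring_cring)
  let ?S = "{var i * var j | i j. (i, j) \<in> parcs G} :: 'k mpoly set"
  have S: "?S \<subseteq> carrier (mpoly_ring n)"
    using assms by (auto simp: var_mult_var simp del: single_one)
  have "?S \<subseteq> mon_ideal n (packing_exponents (parcs G) 1)"
    using assms by (force simp: var_mult_var mon_ideal_def One_nat_def packing_exponents_Suc_iff)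
  then have "edge_ideal n G \<subseteq> (mon_ideal n (packing_exponents (parcs G) 1) :: 'k mpoly set)"
    unfolding edge_ideal_def by (intro genideal_minimal mon_ideal_ideal up_closed_packing_exponents)
  moreover have "mon_ideal n (packing_exponents (parcs G) 1) \<subseteq> (edge_ideal n G :: 'k mpoly set)"
  proof (rule mon_ideal_subset)
    show I: "ideal (edge_ideal n G :: 'k mpoly set) (mpoly_ring n)"
      unfolding edge_ideal_def by (rule genideal_ideal[OF S])
    fix e and c :: 'k assume e: "e \<in> packing_exponents (parcs G) 1" "e \<in> exponents n"
    then obtain a b d where d: "(a, b) \<in> parcs G" "e = d + (single a 1 + single b 1)"
      unfolding One_nat_def packing_exponents_Suc_iff by blast
    have "var a * var b \<in> (edge_ideal n G :: 'k mpoly set)"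
      unfolding edge_ideal_def using d(1) genideal_self[OF S] by blast
    moreover have "single d c \<in> carrier (mpoly_ring n)" using d(2) e(2) by auto
    ultimately have "single d c * (var a * var b) \<in> (edge_ideal n G :: 'k mpoly set)"
      using ideal.I_l_closed[OF I] by fastforce
    then show "single e c \<in> (edge_ideal n G :: 'k mpoly set)"
      by (simp add: var_mult_var mult_single d(2))
  qed
  ultimately show ?thesis by blast
qed

lemma edge_ideal_power:
  assumes "parcs G \<subseteq> {1..n} \<times> {1..n}"
  shows "edge_ideal n G [^]\<^bsub>ideals_set (mpoly_ring n)\<^esub> t
    = (mon_ideal n (packing_exponents (parcs G) t) :: 'k::field mpoly set)"
proof (induction t)
  case 0
  show ?case by (auto simp: nat_pow_def ideals_set_def mon_ideal_def)
next
  case (Suc t)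
  have "edge_ideal n G [^]\<^bsub>ideals_set (mpoly_ring n)\<^esub> Suc t = ideal_prod (mpoly_ring n)
      (edge_ideal n G [^]\<^bsub>ideals_set (mpoly_ring n)\<^esub> t) (edge_ideal n G :: 'k mpoly set)"
    by (simp add: nat_pow_def ideals_set_def)
  also have "\<dots> = ideal_prod (mpoly_ring n) (mon_ideal n (packing_exponents (parcs G) t))
      (mon_ideal n (packing_exponents (parcs G) 1))"
    by (simp only: Suc) (simp only: edge_ideal_eq[OF assms])
  also have "\<dots> = (mon_ideal n (packing_exponents (parcs G) (Suc t)) :: 'k mpoly set)"
  proof (rule ideal_prod_mon_ideal[OF up_closed_packing_exponents up_closed_packing_exponents
        up_closed_packing_exponents])
    fix u v assume "u \<in> packing_exponents (parcs G) t" "v \<in> packing_exponents (parcs G) 1"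
    then show "u + v \<in> packing_exponents (parcs G) (Suc t)"
      using packs_add[of "parcs G" t "lookup u" 1 "lookup v"]
      by (simp add: packing_exponents_def plus_poly_mapping.rep_eq)
  next
    fix w assume "w \<in> packing_exponents (parcs G) (Suc t)"
    then obtain a b d where "(a, b) \<in> parcs G" "d \<in> packing_exponents (parcs G) t"
      "w = d + (single a 1 + single b 1)" unfolding packing_exponents_Suc_iff by blast
    moreover from this have "single a 1 + single b 1 \<in> packing_exponents (parcs G) 1"
      unfolding One_nat_def packing_exponents_Suc_iff by (force intro!: bexI[of _ "(a, b)"] bexI[of _ 0])
    ultimately show "\<exists>u\<in>packing_exponents (parcs G) t. \<exists>v\<in>packing_exponents (parcs G) 1. w = u + v"
      by blast
  qed
  finally show ?case .
qed

section \<open>Depth of monomial quotients\<close>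

lemma lookup_mult_0:
  fixes p q :: "(nat \<Rightarrow>\<^sub>0 nat) \<Rightarrow>\<^sub>0 'k::field"
  assumes "lookup p 0 = 0"
  shows "lookup (p * q) 0 = 0"
proof (rule ccontr)
  assume "lookup (p * q) 0 \<noteq> 0"
  then have "0 \<in> {d + e | d e. d \<in> keys p \<and> e \<in> keys q}"
    using keys_mult[of p q] by (blast intro: lookup_not_eq_zero_eq_in_keys[THEN iffD1])
  then obtain d e where "d \<in> keys p" "0 = d + e" by blast
  moreover from this have "d = 0"
    by (intro poly_mapping_eqI) (metis add_is_0 lookup_add lookup_zero)
  ultimately show False using assms by (simp add: in_keys_iff)
qed

lemma split_off_var:
  fixes e :: "'a \<Rightarrow>\<^sub>0 nat"
  assumes "lookup e i > 0"
  shows "\<exists>d. e = single i 1 + d"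
proof
  show "e = single i 1 + (e - single i 1)"
    using assms by (intro poly_mapping_eqI) (auto simp: lookup_add lookup_minus lookup_single when_def)
qed

lemma single_Suc_0_neq_0 [simp]: "single i (Suc 0) \<noteq> 0"
  by (metis keys_single keys_zero insert_not_empty nat.distinct(1))

lemma irrelevant_ideal_eq: "irrelevant_ideal n = (mon_ideal n {e. e \<noteq> 0} :: 'k::field mpoly set)"
proof -
  interpret cring "mpoly_ring n :: 'k mpoly ring" by (rule mpoly_ring_cring)
  have up: "up_closed {e. e \<noteq> 0}"
    unfolding up_closed_def
  proof safe
    fix d e :: "nat \<Rightarrow>\<^sub>0 nat" assume "e \<noteq> 0" "d + e = 0"
    then show False by (metis add_is_0 lookup_add lookup_zero poly_mapping_eqI)
  qed
  have S: "var ` {1..n} \<subseteq> carrier (mpoly_ring n :: 'k mpoly ring)"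
    by (auto simp: var_def)
  have "var ` {1..n} \<subseteq> (mon_ideal n {e. e \<noteq> 0} :: 'k mpoly set)"
    by (auto simp: var_def mon_ideal_def)
  then have "irrelevant_ideal n \<subseteq> (mon_ideal n {e. e \<noteq> 0} :: 'k mpoly set)"
    unfolding irrelevant_ideal_def by (intro genideal_minimal mon_ideal_ideal up)
  moreover have "mon_ideal n {e. e \<noteq> 0} \<subseteq> (irrelevant_ideal n :: 'k mpoly set)"
  proof (rule mon_ideal_subset)
    show I: "ideal (irrelevant_ideal n :: 'k mpoly set) (mpoly_ring n)"
      unfolding irrelevant_ideal_def by (rule genideal_ideal[OF S])
    fix e :: "nat \<Rightarrow>\<^sub>0 nat" and c :: 'k assume e: "e \<in> {e. e \<noteq> 0}" "e \<in> exponents n"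
    then obtain i where i: "i \<in> keys e" using keys_eq_empty[of e] by blast
    then obtain d where d: "e = single i 1 + d" using split_off_var[of e i] by (auto simp: in_keys_iff)
    have "var i \<in> (irrelevant_ideal n :: 'k mpoly set)"
      unfolding irrelevant_ideal_def using i e(2) genideal_self[OF S] by (auto simp: exponents_def)
    moreover have "single d c \<in> carrier (mpoly_ring n)" using d e(2) by auto
    ultimately have "single d c * var i \<in> (irrelevant_ideal n :: 'k mpoly set)"
      using ideal.I_l_closed[OF I] by fastforce
    then show "single e c \<in> (irrelevant_ideal n :: 'k mpoly set)"
      by (simp add: var_def mult_single d add.commute)
  qed
  ultimately show ?thesis by blast
qed

section \<open>Residue classes and short regular sequences in a monomial quotient\<close>

abbreviation residue :: "nat \<Rightarrow> (nat \<Rightarrow>\<^sub>0 nat) set \<Rightarrow> ('k::field) mpoly \<Rightarrow> 'k mpoly set" where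
  "residue n U p \<equiv> mon_ideal n U +>\<^bsub>mpoly_ring n\<^esub> p"

abbreviation mon_quotient :: "nat \<Rightarrow> (nat \<Rightarrow>\<^sub>0 nat) set \<Rightarrow> ('k::field mpoly, 'k mpoly set) module" where
  "mon_quotient n U \<equiv> quotient_module (mpoly_ring n) (mon_ideal n U)"

lemma mem_residue_iff: "p \<in> residue n U q \<longleftrightarrow> p - q \<in> mon_ideal n U"
  by (auto simp: a_r_coset_def' intro: bexI[of _ "p - q"])

lemma residue_eq_iff: "residue n U p = residue n U q \<longleftrightarrow> p - q \<in> mon_ideal n U"
proof
  show "p - q \<in> mon_ideal n U" if "residue n U p = residue n U q"
  proof -
    have "p \<in> residue n U p" by (simp add: mem_residue_iff)
    then show ?thesis by (simp add: that mem_residue_iff)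
  qed
  show "residue n U p = residue n U q" if "p - q \<in> mon_ideal n U"
  proof (rule Set.set_eqI)
    fix x
    have "x - q = (x - p) + (p - q)" "x - p = (x - q) - (p - q)" by simp_all
    then show "x \<in> residue n U p \<longleftrightarrow> x \<in> residue n U q"
      unfolding mem_residue_iff using that mon_ideal_add mon_ideal_diff by metis
  qed
qed

lemma residue_0: "residue n U 0 = mon_ideal n U"
  by (auto simp: mem_residue_iff)

lemma residue_add: "residue n U p <+>\<^bsub>mpoly_ring n\<^esub> residue n U q = residue n U (p + q)"
proof (rule Set.set_eqI)
  fix x
  show "x \<in> residue n U p <+>\<^bsub>mpoly_ring n\<^esub> residue n U q \<longleftrightarrow> x \<in> residue n U (p + q)"
  proof
    assume "x \<in> residue n U p <+>\<^bsub>mpoly_ring n\<^esub> residue n U q"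
    then obtain a b where ab: "a - p \<in> mon_ideal n U" "b - q \<in> mon_ideal n U" "x = a + b"
      unfolding set_add_def' by (auto simp: mem_residue_iff)
    have "x - (p + q) = (a - p) + (b - q)" using ab(3) by simp
    then show "x \<in> residue n U (p + q)" using ab mon_ideal_add by (metis mem_residue_iff)
  next
    assume "x \<in> residue n U (p + q)"
    then have "x - q \<in> residue n U p" by (simp add: mem_residue_iff algebra_simps)
    moreover have "q \<in> residue n U q" by (simp add: mem_residue_iff)
    moreover have "x = (x - q) + q" by simp
    ultimately show "x \<in> residue n U p <+>\<^bsub>mpoly_ring n\<^esub> residue n U q"
      unfolding set_add_def' mpoly_ring_simps by blast
  qed
qed

lemma mon_quotient_carrier: "carrier (mon_quotient n U) = residue n U ` {p. keys p \<subseteq> exponents n}"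
  by (auto simp: quotient_module_def FactRing_def A_RCOSETS_def')

lemma mon_quotient_add: "residue n U p \<oplus>\<^bsub>mon_quotient n U\<^esub> residue n U q = residue n U (p + q)"
  by (simp add: quotient_module_def FactRing_def residue_add)

lemma mon_quotient_zero: "\<zero>\<^bsub>mon_quotient n U\<^esub> = residue n U 0"
  by (simp add: quotient_module_def FactRing_def residue_0)

lemma mon_quotient_smult:
  assumes "up_closed U" "keys p \<subseteq> exponents n" "keys q \<subseteq> exponents n"
  shows "p \<odot>\<^bsub>mon_quotient n U\<^esub> residue n U q = residue n U (p * q)"
  using ideal.rcoset_mult_add[OF mon_ideal_ideal[OF assms(1)], of p n q] assms(2,3)
  by (simp add: quotient_module_def FactRing_def)

lemma keys_add_exponents [simp]:
  "keys p \<subseteq> exponents n \<Longrightarrow> keys q \<subseteq> exponents n \<Longrightarrow> keys (p + q) \<subseteq> exponents n"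
  using keys_add[of p q] by blast

lemma keys_mult_exponents [simp]:
  "keys p \<subseteq> exponents n \<Longrightarrow> keys q \<subseteq> exponents n \<Longrightarrow> keys (p * q) \<subseteq> exponents n"
  by (rule keys_mult_subset) auto

lemma mon_quotient_abelian_monoid: "abelian_monoid (mon_quotient n U :: ('k::field mpoly, _) module)"
  by (rule abelian_monoidI)
    (auto simp: mon_quotient_carrier mon_quotient_add mon_quotient_zero algebra_simps)

text \<open>Lengths up to two suffice, since only depth 1 has to be told apart from depth at least
  2.\<close>

lemma mon_quotient_seq_submodule:
  fixes f g :: "'k::field mpoly"
  assumes U: "up_closed U" and f: "keys f \<subseteq> exponents n"
  shows "seq_submodule (mon_quotient n U) [] = {residue n U (0 :: 'k mpoly)}"
    and "seq_submodule (mon_quotient n U) [f] = {residue n U (f * v) | v. keys v \<subseteq> exponents n}"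
    and "keys g \<subseteq> exponents n \<Longrightarrow> seq_submodule (mon_quotient n U) [f, g]
      = {residue n U (f * v + g * w) | v w. keys v \<subseteq> exponents n \<and> keys w \<subseteq> exponents n}"
proof -
  let ?M = "mon_quotient n U :: ('k mpoly, 'k mpoly set) module"
  interpret abelian_monoid ?M by (rule mon_quotient_abelian_monoid)
  show "seq_submodule ?M [] = {residue n U (0 :: 'k mpoly)}"
    by (auto simp: seq_submodule_def mon_quotient_zero)
  have sm: "p \<odot>\<^bsub>?M\<^esub> X \<in> carrier ?M" if "keys p \<subseteq> exponents n" "X \<in> carrier ?M" for p X
    using that by (auto simp: mon_quotient_carrier mon_quotient_smult[OF U])
  have "seq_submodule ?M [f] = {f \<odot>\<^bsub>?M\<^esub> X | X. X \<in> carrier ?M}"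
  proof (intro equalityI subsetI)
    fix Y assume "Y \<in> seq_submodule ?M [f]"
    then obtain u where u: "u \<in> {..<Suc 0} \<rightarrow> carrier ?M"
      "Y = (\<Oplus>\<^bsub>?M\<^esub>j\<in>{..<Suc 0}. ([f] ! j) \<odot>\<^bsub>?M\<^esub> u j)" unfolding seq_submodule_def by auto
    then have "u 0 \<in> carrier ?M" by auto
    then have "Y = f \<odot>\<^bsub>?M\<^esub> u 0" using u(2) sm[OF f] by (simp add: lessThan_Suc)
    then show "Y \<in> {f \<odot>\<^bsub>?M\<^esub> X | X. X \<in> carrier ?M}" using \<open>u 0 \<in> carrier ?M\<close> by blast
  next
    fix Y assume "Y \<in> {f \<odot>\<^bsub>?M\<^esub> X | X. X \<in> carrier ?M}"
    then obtain X where X: "X \<in> carrier ?M" "Y = f \<odot>\<^bsub>?M\<^esub> X" by blast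
    then have "Y = (\<Oplus>\<^bsub>?M\<^esub>j\<in>{..<length [f]}. ([f] ! j) \<odot>\<^bsub>?M\<^esub> (\<lambda>_. X) j)"
      using sm[OF f] by (simp add: lessThan_Suc)
    then show "Y \<in> seq_submodule ?M [f]" unfolding seq_submodule_def using X(1)
      by (intro CollectI exI[of _ "\<lambda>_. X"]) auto
  qed
  also have "\<dots> = {residue n U (f * v) | v. keys v \<subseteq> exponents n}"
    unfolding mon_quotient_carrier using mon_quotient_smult[OF U f] by force
  finally show "seq_submodule ?M [f] = {residue n U (f * v) | v. keys v \<subseteq> exponents n}" .
  show "seq_submodule ?M [f, g]
      = {residue n U (f * v + g * w) | v w. keys v \<subseteq> exponents n \<and> keys w \<subseteq> exponents n}"
    if g: "keys g \<subseteq> exponents n"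
  proof -
    have two: "{..<2::nat} = {0, 1}" by auto
    have "seq_submodule ?M [f, g]
      = {f \<odot>\<^bsub>?M\<^esub> X \<oplus>\<^bsub>?M\<^esub> g \<odot>\<^bsub>?M\<^esub> Y | X Y. X \<in> carrier ?M \<and> Y \<in> carrier ?M}"
    proof (intro equalityI subsetI)
      fix Z assume "Z \<in> seq_submodule ?M [f, g]"
      then obtain u where u: "u \<in> {..<2} \<rightarrow> carrier ?M"
        "Z = (\<Oplus>\<^bsub>?M\<^esub>j\<in>{..<2}. ([f, g] ! j) \<odot>\<^bsub>?M\<^esub> u j)"
        unfolding seq_submodule_def by (auto simp: numeral_2_eq_2)
      then have c: "u 0 \<in> carrier ?M" "u 1 \<in> carrier ?M" by auto
      then have "Z = f \<odot>\<^bsub>?M\<^esub> u 0 \<oplus>\<^bsub>?M\<^esub> g \<odot>\<^bsub>?M\<^esub> u 1"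
        using u(2) sm[OF f] sm[OF g] by (simp add: two)
      then show "Z \<in> {f \<odot>\<^bsub>?M\<^esub> X \<oplus>\<^bsub>?M\<^esub> g \<odot>\<^bsub>?M\<^esub> Y | X Y. X \<in> carrier ?M \<and> Y \<in> carrier ?M}"
        using c by blast
    next
      fix Z assume "Z \<in> {f \<odot>\<^bsub>?M\<^esub> X \<oplus>\<^bsub>?M\<^esub> g \<odot>\<^bsub>?M\<^esub> Y | X Y. X \<in> carrier ?M \<and> Y \<in> carrier ?M}"
      then obtain X Y where XY: "X \<in> carrier ?M" "Y \<in> carrier ?M"
        "Z = f \<odot>\<^bsub>?M\<^esub> X \<oplus>\<^bsub>?M\<^esub> g \<odot>\<^bsub>?M\<^esub> Y" by blast
      then have "Z = (\<Oplus>\<^bsub>?M\<^esub>j\<in>{..<2}. ([f, g] ! j) \<odot>\<^bsub>?M\<^esub> (\<lambda>j. if j = 0 then X else Y) j)"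
        using sm[OF f] sm[OF g] by (simp add: two)
      then show "Z \<in> seq_submodule ?M [f, g]"
        unfolding seq_submodule_def using XY(1,2)
        by (intro CollectI exI[of _ "\<lambda>j. if j = 0 then X else Y"]) (auto simp: numeral_2_eq_2)
    qed
    also have "\<dots> = {residue n U (f * v + g * w) | v w. keys v \<subseteq> exponents n \<and> keys w \<subseteq> exponents n}"
    proof -
      have comb: "f \<odot>\<^bsub>?M\<^esub> residue n U v \<oplus>\<^bsub>?M\<^esub> g \<odot>\<^bsub>?M\<^esub> residue n U w = residue n U (f * v + g * w)"
        if "keys v \<subseteq> exponents n" "keys w \<subseteq> exponents n" for v w
        using that by (simp add: mon_quotient_smult[OF U] f g mon_quotient_add)
      show ?thesis
      proof (intro equalityI subsetI)
        fix Z assume "Z \<in> {f \<odot>\<^bsub>?M\<^esub> X \<oplus>\<^bsub>?M\<^esub> g \<odot>\<^bsub>?M\<^esub> Y | X Y. X \<in> carrier ?M \<and> Y \<in> carrier ?M}"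
        then show "Z \<in> {residue n U (f * v + g * w) | v w. keys v \<subseteq> exponents n \<and> keys w \<subseteq> exponents n}"
          unfolding mon_quotient_carrier using comb by blast
      next
        fix Z assume "Z \<in> {residue n U (f * v + g * w) | v w. keys v \<subseteq> exponents n \<and> keys w \<subseteq> exponents n}"
        then obtain v w where vw: "keys v \<subseteq> exponents n" "keys w \<subseteq> exponents n"
          "Z = f \<odot>\<^bsub>?M\<^esub> residue n U v \<oplus>\<^bsub>?M\<^esub> g \<odot>\<^bsub>?M\<^esub> residue n U w" using comb by auto
        then show "Z \<in> {f \<odot>\<^bsub>?M\<^esub> X \<oplus>\<^bsub>?M\<^esub> g \<odot>\<^bsub>?M\<^esub> Y | X Y. X \<in> carrier ?M \<and> Y \<in> carrier ?M}"
          unfolding mon_quotient_carrier by blast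
      qed
    qed
    finally show ?thesis .
  qed
qed

definition nonzerodivisor_mod :: "nat \<Rightarrow> ('k::field) mpoly set \<Rightarrow> 'k mpoly \<Rightarrow> bool" where
  "nonzerodivisor_mod n J f \<longleftrightarrow> (\<forall>h. keys h \<subseteq> exponents n \<longrightarrow> f * h \<in> J \<longrightarrow> h \<in> J)"

text \<open>For an ideal \<open>J\<close> this says that \<open>g\<close> is a nonzerodivisor modulo
  \<open>J + (f)\<close>, with the multiples of \<open>f\<close> written out.\<close>

definition nonzerodivisor_mod2 :: "nat \<Rightarrow> ('k::field) mpoly set \<Rightarrow> 'k mpoly \<Rightarrow> 'k mpoly \<Rightarrow> bool" where
  "nonzerodivisor_mod2 n J f g \<longleftrightarrow>
    (\<forall>h v. keys h \<subseteq> exponents n \<longrightarrow> keys v \<subseteq> exponents n \<longrightarrow> g * h - f * v \<in> J \<longrightarrow>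
      (\<exists>w. keys w \<subseteq> exponents n \<and> h - f * w \<in> J))"

lemma mem_seq_submodule:
  fixes f h :: "'k::field mpoly"
  assumes "up_closed U"
  shows "residue n U h \<in> seq_submodule (mon_quotient n U) [] \<longleftrightarrow> h \<in> mon_ideal n U"
    and "keys f \<subseteq> exponents n \<Longrightarrow> residue n U h \<in> seq_submodule (mon_quotient n U) [f] \<longleftrightarrow>
      (\<exists>v. keys v \<subseteq> exponents n \<and> h - f * v \<in> mon_ideal n U)"
  using mon_quotient_seq_submodule(1)[OF assms, of "0 :: 'k mpoly" n] mon_quotient_seq_submodule(2)[OF assms, of f n]
  by (auto simp: residue_eq_iff)

text \<open>Properness comes from constant terms: \<open>f\<close> and \<open>g\<close> have none
  and \<open>0 \<notin> U\<close>, so 1 lies outside the ideal that \<open>f\<close> and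
  \<open>g\<close> generate together with \<open>mon_ideal n U\<close>.\<close>

lemma regular_sequence_mon_quotientI:
  fixes f g :: "'k::field mpoly"
  assumes U: "up_closed U" "0 \<notin> U"
    and f: "f \<in> irrelevant_ideal n" "nonzerodivisor_mod n (mon_ideal n U) f"
  shows "regular_sequence (mpoly_ring n) (mon_quotient n U) [f]"
    and "g \<in> irrelevant_ideal n \<Longrightarrow> nonzerodivisor_mod2 n (mon_ideal n U) f g \<Longrightarrow>
      regular_sequence (mpoly_ring n) (mon_quotient n U) [f, g]"
proof -
  have irr: "keys p \<subseteq> exponents n \<and> lookup p 0 = 0" if "p \<in> irrelevant_ideal n" for p :: "'k mpoly"
    using that by (auto simp: irrelevant_ideal_eq mon_ideal_def in_keys_iff)
  note ff = irr[OF f(1)]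
  have one: "keys (1 :: 'k mpoly) \<subseteq> exponents n" by simp
  have no: "1 - p \<notin> mon_ideal n U" if "lookup p 0 = 0" for p :: "'k mpoly"
  proof
    assume "1 - p \<in> mon_ideal n U"
    moreover have "0 \<in> keys (1 - p)" using that by (simp add: in_keys_iff lookup_minus)
    ultimately show False using U(2) by (auto simp: mon_ideal_def)
  qed
  have r0: "X \<in> seq_submodule (mon_quotient n U) []"
    if X: "X \<in> carrier (mon_quotient n U)"
      and "f \<odot>\<^bsub>mon_quotient n U\<^esub> X \<in> seq_submodule (mon_quotient n U) []" for X
  proof -
    obtain h where h: "X = residue n U h" "keys h \<subseteq> exponents n"
      using X by (auto simp: mon_quotient_carrier)
    then show ?thesis
      using that(2) f(2) ff by (simp add: mon_quotient_smult[OF U(1)] mem_seq_submodule[OF U(1)] nonzerodivisor_mod_def)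
  qed
  have "residue n U 1 \<notin> seq_submodule (mon_quotient n U) [f]"
    using no lookup_mult_0 ff by (auto simp: mem_seq_submodule[OF U(1)])
  then have ne: "seq_submodule (mon_quotient n U) [f] \<noteq> carrier (mon_quotient n U)"
    using one unfolding mon_quotient_carrier by blast
  show "regular_sequence (mpoly_ring n) (mon_quotient n U) [f]"
    unfolding regular_sequence_def using ff r0 ne by auto
  show "regular_sequence (mpoly_ring n) (mon_quotient n U) [f, g]"
    if g: "g \<in> irrelevant_ideal n" "nonzerodivisor_mod2 n (mon_ideal n U) f g"
  proof -
    note gg = irr[OF g(1)]
    have r1: "X \<in> seq_submodule (mon_quotient n U) [f]"
      if X: "X \<in> carrier (mon_quotient n U)"
        and "g \<odot>\<^bsub>mon_quotient n U\<^esub> X \<in> seq_submodule (mon_quotient n U) [f]" for X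
    proof -
      obtain h where h: "X = residue n U h" "keys h \<subseteq> exponents n"
        using X by (auto simp: mon_quotient_carrier)
      then show ?thesis
        using that(2) g(2) ff gg
        by (auto simp: mon_quotient_smult[OF U(1)] mem_seq_submodule[OF U(1)] nonzerodivisor_mod2_def)
    qed
    have "residue n U 1 \<notin> seq_submodule (mon_quotient n U) [f, g]"
    proof
      assume "residue n U 1 \<in> seq_submodule (mon_quotient n U) [f, g]"
      then obtain v w where "1 - (f * v + g * w) \<in> mon_ideal n U"
        using mon_quotient_seq_submodule(3)[OF U(1), of f n g] ff gg by (auto simp: residue_eq_iff)
      moreover have "lookup (f * v + g * w) 0 = 0"
        using ff gg by (simp add: lookup_add lookup_mult_0)
      ultimately show False using no by blast
    qed
    then have ne2: "seq_submodule (mon_quotient n U) [f, g] \<noteq> carrier (mon_quotient n U)"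
      using one unfolding mon_quotient_carrier by blast
    show ?thesis
      unfolding regular_sequence_def using ff gg r0 r1 ne2 by (auto simp: less_Suc_eq)
  qed
qed

lemma depth_ge:
  assumes "regular_sequence R M fs" "set fs \<subseteq> m"
  shows "enat (length fs) \<le> depth R m M"
  unfolding depth_def using assms by (intro SUP_upper) auto

text \<open>
  In cohomological terms, \<open>u\<close> represents a nonzero socle element of the first local cohomology:
  the section that is \<open>u\<close> where a variable from \<open>A\<close> is invertible and \<open>0\<close> where a variable
  from \<open>B\<close> is.
\<close>

lemma depth_le_1:
  assumes U: "up_closed U" and AB: "A \<union> B = {1..n}"
    and ab: "\<And>a b. a \<in> A \<Longrightarrow> b \<in> B \<Longrightarrow> single a 1 + (single b 1 + u) \<in> U"
    and a0: "a0 \<in> A" "single a0 1 + u \<notin> U" and b0: "b0 \<in> B" "single b0 1 + u \<notin> U"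
    and u: "u \<in> exponents n"
  shows "depth (mpoly_ring n) (irrelevant_ideal n) (mon_quotient n U :: ('k::field mpoly, _) module) \<le> 1"
proof -
  let ?J = "mon_ideal n U :: 'k mpoly set"
  have "length fs \<le> 1"
    if fs: "set fs \<subseteq> irrelevant_ideal n" "regular_sequence (mpoly_ring n) (mon_quotient n U) fs"
    for fs :: "'k mpoly list"
  proof (rule ccontr)
    assume "\<not> length fs \<le> 1"
    then obtain f g fs' where fs': "fs = f # g # fs'"
      by (cases fs; cases "tl fs") auto
    \<comment> \<open>Splits an element of the irrelevant ideal by sides: the terms of
      \<open>part p\<close> involve variables of \<open>A\<close> only, hence at least one, and
      every other term is divisible by a variable of \<open>B\<close>. By \<open>ab\<close>, a
      product across the two sides annihilates \<open>u\<close> modulo \<open>?J\<close>.\<close>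
    define part where "part p = (\<Sum>e\<in>{e\<in>keys p. keys e \<subseteq> A}. single e (lookup p e))" for p :: "'k mpoly"
    have look_part: "lookup (part p) e = (if keys e \<subseteq> A then lookup p e else 0)" for p e
    proof -
      have "lookup (part p) e = (\<Sum>d\<in>{e\<in>keys p. keys e \<subseteq> A}. if d = e then lookup p e else 0)"
        unfolding part_def by (auto simp: lookup_sum lookup_single when_def intro!: sum.cong)
      then show ?thesis by (auto simp: in_keys_iff)
    qed
    have keys_part: "keys (part p) = {e\<in>keys p. keys e \<subseteq> A}" for p
      by (auto simp: in_keys_iff[of _ "part p"] in_keys_iff[of _ p] look_part split: if_splits)
    have irr: "keys p \<subseteq> exponents n \<and> (\<forall>e\<in>keys p. e \<noteq> 0)" if "p \<in> irrelevant_ideal n" for p :: "'k mpoly"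
      using that by (auto simp: irrelevant_ideal_eq mon_ideal_def)
    have f: "f \<in> irrelevant_ideal n" and g: "g \<in> irrelevant_ideal n" using fs(1) fs' by auto
    have keysA: "\<exists>a\<in>A. \<exists>d. e = single a 1 + d" if "p \<in> irrelevant_ideal n" "e \<in> keys (part p)" for p e
    proof -
      have "e \<noteq> 0" "keys e \<subseteq> A" using that irr keys_part by auto
      then obtain a where "a \<in> keys e" "a \<in> A" using keys_eq_empty[of e] by blast
      then show ?thesis using split_off_var[of e a] by (auto simp: in_keys_iff)
    qed
    have keysB: "\<exists>b\<in>B. \<exists>d. e = single b 1 + d" if p: "p \<in> irrelevant_ideal n" and "e \<in> keys (p - part p)" for p e
    proof -
      have "e \<in> keys p" "\<not> keys e \<subseteq> A"
        using that(2) in_keys_iff[of e p] in_keys_iff[of e "p - part p"]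
        by (auto simp: lookup_minus look_part split: if_splits)
      then obtain b where "b \<in> keys e" "b \<in> B"
        using irr[OF p] AB by (auto simp: exponents_def)
      then show ?thesis using split_off_var[of e b] by (auto simp: in_keys_iff)
    qed
    define X :: "'k mpoly" where "X = single u 1"
    have X: "keys X = {u}" by (simp add: X_def)
    have cross: "(p - part p) * (part q * X) \<in> ?J"
      if p: "p \<in> irrelevant_ideal n" and q: "q \<in> irrelevant_ideal n" for p q
      unfolding mon_ideal_def mem_Collect_eq
    proof (rule keys_mult_subset)
      fix d e assume d: "d \<in> keys (p - part p)" and "e \<in> keys (part q * X)"
      then obtain e' where e': "e' \<in> keys (part q)" "e = e' + u"
        using keys_mult[of "part q" X] X by auto
      obtain b d' where b: "b \<in> B" "d = single b 1 + d'" using keysB[OF p d] by blast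
      obtain a e'' where a: "a \<in> A" "e' = single a 1 + e''" using keysA[OF q e'(1)] by blast
      have "d + e = (d' + e'') + (single a 1 + (single b 1 + u))"
        by (simp add: a b e' ac_simps)
      then have "d + e \<in> U" using ab[OF a(1) b(1)] U unfolding up_closed_def by metis
      moreover have "d \<in> exponents n" "e' \<in> exponents n"
        using d e'(1) irr[OF p] irr[OF q] keys_part keys_minus_subset[of p "part p"] by auto
      ultimately show "d + e \<in> exponents n \<inter> U" using u e'(2) by simp
    qed
    have kf: "keys f \<subseteq> exponents n" and kg: "keys g \<subseteq> exponents n" using f g irr by auto
    have kpart: "keys (part p) \<subseteq> exponents n" if "keys p \<subseteq> exponents n" for p
      using that keys_part by auto
    have kX: "keys X \<subseteq> exponents n" using u X by simp
    have regf: "h \<in> ?J" if h: "keys h \<subseteq> exponents n" "f * h \<in> ?J" for h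
    proof -
      have "residue n U h \<in> carrier (mon_quotient n U)" using h by (auto simp: mon_quotient_carrier)
      then show ?thesis
        using fs(2) h unfolding regular_sequence_def fs'
        by (auto dest!: spec[of _ 0] simp: mon_quotient_smult[OF U kf] mem_seq_submodule[OF U])
    qed
    \<comment> \<open>The products of two \<open>A\<close>-parts cancel, so \<open>g\<close> carries
      \<open>part f * X\<close> into \<open>?J + (f)\<close>. Regularity of \<open>g\<close> then
      provides \<open>w\<close> with \<open>part f * X - f * w\<close> in \<open>?J\<close>.\<close>
    have "g * (part f * X) - f * (part g * X) = (g - part g) * (part f * X) - (f - part f) * (part g * X)"
      by (simp add: algebra_simps)
    then have "g * (part f * X) - f * (part g * X) \<in> ?J"
      using mon_ideal_diff cross f g by metis
    then have "residue n U (g * (part f * X)) \<in> seq_submodule (mon_quotient n U) [f]"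
      using mem_seq_submodule(2)[OF U kf] keys_mult_exponents[OF kpart[OF kg] kX] by blast
    moreover have "residue n U (part f * X) \<in> carrier (mon_quotient n U)"
      using keys_mult_exponents[OF kpart[OF kf] kX] by (auto simp: mon_quotient_carrier)
    moreover have "\<forall>Y\<in>carrier (mon_quotient n U). g \<odot>\<^bsub>mon_quotient n U\<^esub> Y \<in> seq_submodule (mon_quotient n U) [f]
        \<longrightarrow> Y \<in> seq_submodule (mon_quotient n U) [f]"
    proof -
      have "1 < length fs" "fs ! 1 = g" "take 1 fs = [f]" by (simp_all add: fs')
      then show ?thesis using fs(2) unfolding regular_sequence_def by metis
    qed
    ultimately have "residue n U (part f * X) \<in> seq_submodule (mon_quotient n U) [f]"
      using keys_mult_exponents[OF kpart[OF kf] kX] by (auto simp: mon_quotient_smult[OF U kg])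
    then obtain w where w: "keys w \<subseteq> exponents n" "part f * X - f * w \<in> ?J"
      using mem_seq_submodule(2)[OF U kf] by blast
    have b0n: "b0 \<in> {1..n}" and a0n: "a0 \<in> {1..n}" using AB a0 b0 by auto
    have var: "keys (var i :: 'k mpoly) \<subseteq> exponents n" if "i \<in> {1..n}" for i
      using that by (simp add: var_def)
    \<comment> \<open>Regularity of \<open>f\<close> will put both \<open>var b0 * w\<close> and
      \<open>var a0 * (X - w)\<close> into \<open>?J\<close>. Neither \<open>b0\<close> nor
      \<open>a0\<close> carries \<open>u\<close> into \<open>U\<close>, so the coefficient of
      \<open>w\<close> at \<open>u\<close> is 0 by the first and 1 by the second.\<close>
    have "var b0 * (part f * X) \<in> ?J"
      unfolding mon_ideal_def mem_Collect_eq
    proof (rule keys_mult_subset)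
      fix d e assume "d \<in> keys (var b0 :: 'k mpoly)" and "e \<in> keys (part f * X)"
      then obtain e' where e': "e' \<in> keys (part f)" "e = e' + u" "d = single b0 1"
        using keys_mult[of "part f" X] X by (auto simp: var_def)
      obtain a e'' where a: "a \<in> A" "e' = single a 1 + e''" using keysA[OF f e'(1)] by blast
      have "d + e = e'' + (single a 1 + (single b0 1 + u))" by (simp add: a e' ac_simps)
      then have "d + e \<in> U" using ab[OF a(1) b0(1)] U unfolding up_closed_def by metis
      then show "d + e \<in> exponents n \<inter> U" using u e' b0n kpart[OF kf] by auto
    qed
    moreover have "f * (var b0 * w) = var b0 * (part f * X) - var b0 * (part f * X - f * w)"
      by (simp add: algebra_simps)
    ultimately have "f * (var b0 * w) \<in> ?J"
      using mon_ideal_diff mon_ideal_mult[OF U w(2) var[OF b0n]] by metis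
    then have "var b0 * w \<in> ?J" by (rule regf[rotated]) (intro keys_mult_exponents var w b0n)
    then have w0: "lookup w u = 0"
      using b0(2) by (auto simp: mon_ideal_def in_keys_iff var_def keys_single_mult image_subset_iff)
    have "(f - part f) * (var a0 * X) \<in> ?J"
      unfolding mon_ideal_def mem_Collect_eq
    proof (rule keys_mult_subset)
      fix d e assume d: "d \<in> keys (f - part f)" and "e \<in> keys (var a0 * X)"
      then have e: "e = single a0 1 + u" by (simp add: var_def X_def mult_single)
      obtain b d' where b: "b \<in> B" "d = single b 1 + d'" using keysB[OF f d] by blast
      have "d + e = d' + (single a0 1 + (single b 1 + u))" by (simp add: b e ac_simps)
      then have "d + e \<in> U" using ab[OF a0(1) b(1)] U unfolding up_closed_def by metis
      moreover have "d \<in> exponents n" using d kf keys_part keys_minus_subset[of f "part f"] by auto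
      ultimately show "d + e \<in> exponents n \<inter> U" using u e a0n by simp
    qed
    moreover have "f * (var a0 * (X - w)) = (f - part f) * (var a0 * X) + var a0 * (part f * X - f * w)"
      by (simp add: algebra_simps)
    ultimately have "f * (var a0 * (X - w)) \<in> ?J"
      using mon_ideal_add mon_ideal_mult[OF U w(2) var[OF a0n]] by metis
    moreover have "keys (X - w) \<subseteq> exponents n" using keys_minus_subset[of X w] kX w(1) by blast
    then have "keys (var a0 * (X - w)) \<subseteq> exponents n" by (intro keys_mult_exponents var a0n)
    ultimately have "var a0 * (X - w) \<in> ?J" using regf by blast
    then have "lookup (X - w) u = 0"
      using a0(2) by (auto simp: mon_ideal_def in_keys_iff var_def keys_single_mult image_subset_iff)
    with w0 show False by (simp add: lookup_minus X_def)
  qed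
  then show ?thesis unfolding depth_def by (intro SUP_least) (auto simp: one_enat_def)
qed

section \<open>Binomials and sums of variables as nonzerodivisors\<close>

lemma lookup_var_mult_add: "lookup (var i * p) (single i 1 + e) = lookup (p :: 'k::field mpoly) e"
  by (simp add: var_def del: One_nat_def)

lemma lookup_var_mult_nonzero:
  assumes "lookup (var i * (p :: 'k::field mpoly)) d \<noteq> 0"
  shows "\<exists>e\<in>keys p. d = single i 1 + e"
proof -
  have "d \<in> (+) (single i 1) ` keys p"
    using assms keys_single_mult[of "1::'k" "single i 1" p] by (simp add: in_keys_iff[symmetric] var_def)
  then show ?thesis by auto
qed

lemma keys_minus_exponents [simp]:
  "keys p \<subseteq> exponents n \<Longrightarrow> keys q \<subseteq> exponents n \<Longrightarrow> keys (p - q :: 'k::field mpoly) \<subseteq> exponents n"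
  using keys_minus_subset[of p q] by blast

lemma sum_lookup_single_add:
  "finite C \<Longrightarrow> sum (lookup (single i 1 + e)) C = of_bool (i \<in> C) + sum (lookup e) C"
  by (simp add: lookup_add sum.distrib lookup_single when_def of_bool_def)

text \<open>
  The exponents bounded below here span the \<open>t\<close>-th power of the monomial prime of \<open>C\<close>. A term
  outside it with the largest \<open>x\<close>-exponent survives the multiplication by \<open>x - y\<close>.
\<close>

lemma binomial_nonzerodivisor_mod_prime_power:
  fixes h :: "'k::field mpoly"
  assumes C: "finite C" "x \<notin> C" "y \<in> C"
    and h: "keys ((var x - var y) * h) \<subseteq> {e. t \<le> sum (lookup e) C}"
  shows "keys h \<subseteq> {e. t \<le> sum (lookup e) C}"
proof (rule ccontr)
  define S where "S = {e\<in>keys h. sum (lookup e) C < t}"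
  assume "\<not> ?thesis"
  then have "S \<noteq> {}" by (auto simp: S_def not_le)
  have fin: "finite S" by (simp add: S_def)
  obtain e where e: "e \<in> S" "\<And>d. d \<in> S \<Longrightarrow> lookup d x \<le> lookup e x"
  proof -
    have "Max ((\<lambda>e. lookup e x) ` S) \<in> (\<lambda>e. lookup e x) ` S"
      using fin \<open>S \<noteq> {}\<close> by (intro Max_in) auto
    then obtain e where "e \<in> S" "lookup e x = Max ((\<lambda>e. lookup e x) ` S)" by auto
    then show ?thesis using that fin by (metis Max_ge finite_imageI imageI)
  qed
  \<comment> \<open>A cancelling term \<open>d\<close> would arise from \<open>e\<close> by trading
    one \<open>y\<close> for an \<open>x\<close>: it has smaller weight on \<open>C\<close> and a
    larger \<open>x\<close>-exponent, against the choice of \<open>e\<close>.\<close>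
  have "lookup (var y * h) (single x 1 + e) = 0"
  proof (rule ccontr)
    assume "lookup (var y * h) (single x 1 + e) \<noteq> 0"
    then obtain d where d: "d \<in> keys h" "single x 1 + e = single y 1 + d"
      using lookup_var_mult_nonzero by blast
    have "of_bool (x \<in> C) + sum (lookup e) C = of_bool (y \<in> C) + sum (lookup d) C"
      using d(2) sum_lookup_single_add[OF C(1)] by metis
    then have "d \<in> S" using C d(1) e(1) by (simp add: S_def)
    moreover have "lookup d x = Suc (lookup e x)"
    proof -
      have "lookup (single x 1 + e) x = lookup (single y 1 + d) x" using d(2) by simp
      moreover have "x \<noteq> y" using C by auto
      ultimately show ?thesis by (simp add: lookup_add lookup_single_not_eq)
    qed
    ultimately show False using e(2) by fastforce
  qed
  then have "lookup ((var x - var y) * h) (single x 1 + e) = lookup h e"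
    using lookup_var_mult_add[of x h e] by (simp add: left_diff_distrib lookup_minus)
  then have "single x 1 + e \<in> keys ((var x - var y) * h)"
    using e(1) by (simp add: in_keys_iff S_def)
  then have "t \<le> sum (lookup (single x 1 + e)) C" using h by blast
  then show False using e(1) C by (simp add: sum_lookup_single_add S_def del: One_nat_def)
qed

text \<open>The first assumption makes the ideal an intersection of \<open>t\<close>-th powers of
  monomial primes, one for each set in \<open>\<C>\<close>. Each prime contains exactly one of the
  two variables, so the previous lemma applies to it, up to the sign of the binomial.\<close>

lemma binomial_nonzerodivisor:
  assumes U: "\<And>e. e \<in> exponents n \<Longrightarrow> e \<in> U \<longleftrightarrow> (\<forall>C\<in>\<C>. t \<le> sum (lookup e) C)"
    and C: "\<And>C. C \<in> \<C> \<Longrightarrow> finite C \<and> (x \<in> C \<longleftrightarrow> y \<notin> C)"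
  shows "nonzerodivisor_mod n (mon_ideal n U :: 'k::field mpoly set) (var x - var y)"
  unfolding nonzerodivisor_mod_def
proof (intro allI impI)
  fix h :: "'k mpoly" assume h: "keys h \<subseteq> exponents n" "(var x - var y) * h \<in> mon_ideal n U"
  have "keys h \<subseteq> {e. t \<le> sum (lookup e) C}" if "C \<in> \<C>" for C
  proof (cases "x \<in> C")
    case False
    show ?thesis
      by (rule binomial_nonzerodivisor_mod_prime_power) (use C[OF that] False h U that in \<open>auto simp: mon_ideal_def\<close>)
  next
    case True
    have eq: "keys ((var y - var x) * h) = keys ((var x - var y) * h)"
      by (metis keys_minus minus_diff_eq minus_mult_left)
    show ?thesis
      by (rule binomial_nonzerodivisor_mod_prime_power[of C y x])
        (use C[OF that] True h U that in \<open>auto simp: mon_ideal_def eq\<close>)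
  qed
  then have "e \<in> U" if "e \<in> keys h" for e using that U[of e] h(1) by blast
  then show "h \<in> mon_ideal n U" using h(1) by (auto simp: mon_ideal_def)
qed

text \<open>Associated primes of a monomial ideal are generated by variables, so the sum of all
  variables can fail only at the maximal one, which \<open>socle\<close> excludes; finite fields
  make no exception. The direct argument is an induction on the number of terms of \<open>h\<close>
  outside \<open>U\<close>.\<close>

lemma sum_vars_nonzerodivisor:
  fixes h :: "'k::field mpoly"
  assumes V: "finite V"
    and up: "\<And>e v. v \<in> V \<Longrightarrow> e \<in> U \<Longrightarrow> single v 1 + e \<in> U"
    and socle: "\<And>e. keys e \<subseteq> V \<Longrightarrow> (\<And>v. v \<in> V \<Longrightarrow> single v 1 + e \<in> U) \<Longrightarrow> e \<in> U"
    and h: "\<And>e. e \<in> keys h \<Longrightarrow> keys e \<subseteq> V" and gh: "keys ((\<Sum>v\<in>V. var v) * h) \<subseteq> U"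
  shows "keys h \<subseteq> U"
  using h gh
proof (induction "card (keys h - U)" arbitrary: h rule: less_induct)
  case less
  let ?g = "\<Sum>v\<in>V. var v :: 'k mpoly"
  show ?case
  proof (rule ccontr)
    assume "\<not> keys h \<subseteq> U"
    then obtain e0 where e0: "e0 \<in> keys h" "e0 \<notin> U" by blast
    then obtain v where v: "v \<in> V" "single v 1 + e0 \<notin> U" using socle less.prems(1) by blast
    have fin: "finite (keys h - U)" by simp
    obtain e where e: "e \<in> keys h - U" "\<And>d. d \<in> keys h - U \<Longrightarrow> lookup d v \<le> lookup e v"
    proof -
      have "Max ((\<lambda>e. lookup e v) ` (keys h - U)) \<in> (\<lambda>e. lookup e v) ` (keys h - U)"
        using fin e0 by (intro Max_in) auto
      then obtain e where "e \<in> keys h - U" "lookup e v = Max ((\<lambda>e. lookup e v) ` (keys h - U))" by auto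
      then show ?thesis using that fin by (metis Max_ge finite_imageI imageI)
    qed
    \<comment> \<open>Otherwise the product would have a term at \<open>single v 1 + e\<close>: a
      competing term of \<open>h\<close> would also lie outside \<open>U\<close> and have a larger
      \<open>v\<close>-exponent than \<open>e\<close>.\<close>
    have veU: "single v 1 + e \<in> U"
    proof (rule ccontr)
      assume nU: "single v 1 + e \<notin> U"
      have "lookup (var i * h) (single v 1 + e) = 0" if i: "i \<in> V - {v}" for i
      proof (rule ccontr)
        assume "lookup (var i * h) (single v 1 + e) \<noteq> 0"
        then obtain d where d: "d \<in> keys h" "single v 1 + e = single i 1 + d"
          using lookup_var_mult_nonzero by blast
        then have "d \<notin> U" using nU up i by (metis DiffD1)
        moreover have "lookup d v = Suc (lookup e v)"
        proof -
          have "lookup (single v 1 + e) v = lookup (single i 1 + d) v" using d(2) by simp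
          then show ?thesis using i by (simp add: lookup_add lookup_single_not_eq)
        qed
        ultimately show False using e(2) d(1) by fastforce
      qed
      moreover have "?g * h = var v * h + (\<Sum>i\<in>V - {v}. var i * h)"
        unfolding sum_distrib_right by (rule sum.remove[OF V v(1)])
      ultimately have "lookup (?g * h) (single v 1 + e) = lookup (var v * h) (single v 1 + e)"
        by (simp add: lookup_add lookup_sum)
      also have "\<dots> = lookup h e" by (rule lookup_var_mult_add)
      finally have "single v 1 + e \<in> keys (?g * h)" using e(1) by (simp add: in_keys_iff)
      then show False using less.prems(2) nU by blast
    qed
    have kv: "keys (var v * p) = (+) (single v 1) ` keys p" for p :: "'k mpoly"
      by (simp add: var_def keys_single_mult)
    \<comment> \<open>Multiplication by \<open>v\<close> moves \<open>e\<close> into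
      \<open>U\<close> and moves no term out of it, so fewer terms stay outside and the induction
      hypothesis applies. This contradicts the choice of \<open>v\<close> for
      \<open>e0\<close>.\<close>
    have "keys (var v * h) \<subseteq> U"
    proof (rule less.hyps)
      have "keys (var v * h) - U \<subseteq> (+) (single v 1) ` ((keys h - U) - {e})"
        using veU up v(1) unfolding kv by auto
      then have "card (keys (var v * h) - U) \<le> card ((keys h - U) - {e})"
        by (meson card_image_le card_mono fin finite_Diff finite_imageI order_trans)
      also have "\<dots> < card (keys h - U)" using e(1) fin by (intro card_Diff1_less)
      finally show "card (keys (var v * h) - U) < card (keys h - U)" .
    next
      fix d assume "d \<in> keys (var v * h)"
      then show "keys d \<subseteq> V" using less.prems(1) v(1) keys_add[of "single v 1"] unfolding kv by fastforce
    next
      have "?g * (var v * h) = var v * (?g * h)" by (simp add: ac_simps)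
      then have "keys (?g * (var v * h)) = (+) (single v 1) ` keys (?g * h)"
        by (simp only: kv)
      then show "keys (?g * (var v * h)) \<subseteq> U" using less.prems(2) up v(1) by auto
    qed
    then show False using e0(1) v(2) unfolding kv by blast
  qed
qed

section \<open>Substitution of one variable for another\<close>

definition merge :: "nat \<Rightarrow> nat \<Rightarrow> (nat \<Rightarrow>\<^sub>0 nat) \<Rightarrow> (nat \<Rightarrow>\<^sub>0 nat)" where
  "merge x y e = e - single y (lookup e y) + single x (lookup e y)"

lemma lookup_merge:
  "x \<noteq> y \<Longrightarrow> lookup (merge x y e) v =
    (if v = y then 0 else if v = x then lookup e x + lookup e y else lookup e v)"
  by (auto simp: merge_def lookup_add lookup_minus lookup_single when_def)

lemma merge_add: "x \<noteq> y \<Longrightarrow> merge x y (d + e) = merge x y d + merge x y e"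
  by (rule poly_mapping_eqI) (simp add: lookup_merge lookup_add)

lemma merge_single: "x \<noteq> y \<Longrightarrow> merge x y (single v 1) = single (if v = y then x else v) 1"
  by (rule poly_mapping_eqI) (auto simp: lookup_merge lookup_single when_def)

definition merge_poly :: "nat \<Rightarrow> nat \<Rightarrow> ('k::field) mpoly \<Rightarrow> 'k mpoly" where
  "merge_poly x y p = (\<Sum>e\<in>keys p. single (merge x y e) (lookup p e))"

lemma merge_poly_eq:
  assumes "finite K" "keys p \<subseteq> K"
  shows "merge_poly x y p = (\<Sum>e\<in>K. single (merge x y e) (lookup p e))"
  unfolding merge_poly_def using assms by (intro sum.mono_neutral_left) (auto simp: in_keys_iff)

lemma merge_poly_add: "merge_poly x y (p + q) = merge_poly x y p + merge_poly x y q"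
proof -
  have "finite (keys p \<union> keys q)" by simp
  then show ?thesis using keys_add[of p q]
    by (simp add: merge_poly_eq[of "keys p \<union> keys q"] lookup_add single_add sum.distrib)
qed

lemma merge_poly_diff: "merge_poly x y (p - q) = merge_poly x y p - merge_poly x y q"
  using merge_poly_add[of x y "p - q" q] by simp

lemma merge_poly_sum: "merge_poly x y (sum f S) = (\<Sum>i\<in>S. merge_poly x y (f i))"
  by (induction S rule: infinite_finite_induct) (simp_all add: merge_poly_add, simp_all add: merge_poly_def)

lemma merge_poly_var_mult:
  assumes "x \<noteq> y"
  shows "merge_poly x y (var v * p) = var (if v = y then x else v) * merge_poly x y (p :: 'k::field mpoly)"
proof -
  have "merge_poly x y (var v * p)
      = (\<Sum>e\<in>(+) (single v 1) ` keys p. single (merge x y e) (lookup (var v * p) e))"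
    by (rule merge_poly_eq) (simp_all add: var_def keys_single_mult)
  also have "\<dots> = (\<Sum>e\<in>keys p. single (merge x y (single v 1 + e)) (lookup p e))"
    by (subst sum.reindex) (simp_all add: inj_on_def lookup_var_mult_add del: One_nat_def)
  also have "\<dots> = (\<Sum>e\<in>keys p. var (if v = y then x else v) * single (merge x y e) (lookup p e))"
    using assms by (simp add: merge_add merge_single var_def mult_single del: One_nat_def)
  finally show ?thesis by (simp add: merge_poly_def sum_distrib_left)
qed

lemma keys_merge_poly: "keys (merge_poly x y p) \<subseteq> merge x y ` keys p"
  unfolding merge_poly_def by (rule keys_sum_subset) auto

text \<open>The factors \<open>y\<close> are replaced by \<open>x\<close> one at a time, each at the
  cost of a multiple of \<open>x - y\<close>.\<close>

lemma monomial_minus_merge: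
  assumes xy: "x \<noteq> y" "x \<in> {1..n}" "y \<in> {1..n}" and "e \<in> exponents n"
  shows "\<exists>w. keys w \<subseteq> exponents n \<and>
    single e c - single (merge x y e) c = (var x - var y) * (w :: 'k::field mpoly)"
  using assms(4)
proof (induction "lookup e y" arbitrary: e)
  case 0
  then have "merge x y e = e" using xy by (intro poly_mapping_eqI) (simp add: lookup_merge)
  then show ?case by (intro exI[of _ 0]) simp
next
  case (Suc k)
  then obtain d where d: "e = single y 1 + d" using split_off_var[of e y] by auto
  have dn: "d \<in> exponents n" using Suc.prems d by simp
  have "k = lookup (single x 1 + d) y"
    using Suc.hyps(2) xy by (simp add: d lookup_add lookup_single_not_eq)
  moreover have "single x 1 + d \<in> exponents n" using dn xy by simp
  ultimately obtain w where w: "keys w \<subseteq> exponents n"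
    "single (single x 1 + d) c - single (merge x y (single x 1 + d)) c = (var x - var y) * w"
    using Suc.hyps(1) by blast
  have "merge x y e = merge x y (single x 1 + d)"
    unfolding d using xy(1) by (simp add: merge_add merge_single del: One_nat_def)
  moreover have "single e c = var y * single d c" "single (single x 1 + d) c = var x * single d c"
    by (simp_all add: d var_def mult_single)
  ultimately have "single e c - single (merge x y e) c = (var x - var y) * (w - single d c)"
    using w(2) by (simp add: algebra_simps)
  moreover have "keys (w - single d c) \<subseteq> exponents n"
    using w(1) dn by (intro keys_minus_exponents) auto
  ultimately show ?case by blast
qed

text \<open>Modulo \<open>x - y\<close> the quotient is again a monomial one, in which \<open>x\<close> and \<open>y\<close> are identified.\<close>

lemma sum_vars_nonzerodivisor_mod_binomial:
  assumes xy: "x \<noteq> y" "x \<in> {1..n}" "y \<in> {1..n}" and U: "up_closed U"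
    and socle: "\<And>e. keys e \<subseteq> {1..n} - {y} \<Longrightarrow>
      (\<And>v. v \<in> {1..n} - {y} \<Longrightarrow> single v 1 + e \<in> merge x y ` (U \<inter> exponents n)) \<Longrightarrow>
      e \<in> merge x y ` (U \<inter> exponents n)"
  shows "nonzerodivisor_mod2 n (mon_ideal n U :: 'k::field mpoly set) (var x - var y)
    (\<Sum>v\<in>{1..n} - {y}. var v)"
  unfolding nonzerodivisor_mod2_def
proof (intro allI impI)
  let ?f = "var x - var y :: 'k mpoly" and ?g = "\<Sum>v\<in>{1..n} - {y}. var v :: 'k mpoly"
  let ?U' = "merge x y ` (U \<inter> exponents n)"
  fix h v :: "'k mpoly"
  assume h: "keys h \<subseteq> exponents n" and v: "keys v \<subseteq> exponents n"
    and j: "?g * h - ?f * v \<in> mon_ideal n U"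
  \<comment> \<open>\<open>Q\<close> is \<open>mon_ideal n U + (x - y)\<close>. Every polynomial of
    the ring agrees with its merged form modulo \<open>Q\<close>, and the merged form is handled by
    \<open>sum_vars_nonzerodivisor\<close> in the variables other than \<open>y\<close>.\<close>
  define Q where "Q = {p :: 'k mpoly. \<exists>w. keys w \<subseteq> exponents n \<and> p - ?f * w \<in> mon_ideal n U}"
  have Q_add: "p + q \<in> Q" if pq: "p \<in> Q" "q \<in> Q" for p q
  proof -
    obtain w w' where w: "keys w \<subseteq> exponents n" "p - ?f * w \<in> mon_ideal n U"
      "keys w' \<subseteq> exponents n" "q - ?f * w' \<in> mon_ideal n U" using pq unfolding Q_def by blast
    have "p + q - ?f * (w + w') = (p - ?f * w) + (q - ?f * w')" by (simp add: algebra_simps)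
    then have "p + q - ?f * (w + w') \<in> mon_ideal n U" using mon_ideal_add w by metis
    then show ?thesis unfolding Q_def using w(1,3) keys_add_exponents by blast
  qed
  have Q0: "0 \<in> Q" unfolding Q_def by (intro CollectI exI[of _ 0]) simp
  have Q_sum: "sum F S \<in> Q" if "\<And>i. i \<in> S \<Longrightarrow> F i \<in> Q" for F :: "(nat \<Rightarrow>\<^sub>0 nat) \<Rightarrow> 'k mpoly" and S
    using that by (induction S rule: infinite_finite_induct) (auto simp: Q0 intro: Q_add)
  have Q_merge: "single e c - single (merge x y e) c \<in> Q" "single (merge x y e) c - single e c \<in> Q"
    if e: "e \<in> exponents n" for e c
  proof -
    obtain w where w: "keys w \<subseteq> exponents n" "single e c - single (merge x y e) c = ?f * w"
      using monomial_minus_merge[OF xy e] by blast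
    then show "single e c - single (merge x y e) c \<in> Q"
      unfolding Q_def by (intro CollectI exI[of _ w]) simp
    have "single (merge x y e) c - single e c - ?f * (- w) = 0"
      using w(2) by (simp add: algebra_simps)
    then show "single (merge x y e) c - single e c \<in> Q"
      unfolding Q_def using w(1) by (intro CollectI exI[of _ "- w"]) (simp add: Q_def)
  qed
  \<comment> \<open>The substitution kills \<open>x - y\<close> and leaves \<open>?g\<close>, in
    which \<open>y\<close> does not occur, as it is.\<close>
  have "merge_poly x y (?g * h - ?f * v) = ?g * merge_poly x y h"
  proof -
    have "merge_poly x y (?g * h) = (\<Sum>i\<in>{1..n} - {y}. merge_poly x y (var i * h))"
      by (simp add: sum_distrib_right merge_poly_sum)
    also have "\<dots> = (\<Sum>i\<in>{1..n} - {y}. var i * merge_poly x y h)"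
      by (rule sum.cong) (use xy in \<open>auto simp: merge_poly_var_mult\<close>)
    also have "\<dots> = ?g * merge_poly x y h" by (simp add: sum_distrib_right)
    finally have "merge_poly x y (?g * h) = ?g * merge_poly x y h" .
    moreover have "merge_poly x y (?f * v) = 0"
      using xy by (simp add: left_diff_distrib merge_poly_diff merge_poly_var_mult)
    ultimately show ?thesis by (simp add: merge_poly_diff)
  qed
  then have gU: "keys (?g * merge_poly x y h) \<subseteq> ?U'"
    using keys_merge_poly[of x y "?g * h - ?f * v"] j by (force simp: mon_ideal_def)
  have kh: "keys (merge_poly x y h) \<subseteq> ?U'"
  proof (rule sum_vars_nonzerodivisor[OF _ _ socle _ gU])
    fix e i assume i: "i \<in> {1..n} - {y}" and "e \<in> ?U'"
    then obtain d where d: "d \<in> U" "d \<in> exponents n" "e = merge x y d" by blast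
    then have "single i 1 + e = merge x y (single i 1 + d)"
      using i xy by (simp add: merge_add merge_single del: One_nat_def)
    moreover have "single i 1 + d \<in> U" using d(1) U by (simp add: up_closed_def)
    ultimately show "single i 1 + e \<in> ?U'" using d(2) i by auto
  next
    fix e assume "e \<in> keys (merge_poly x y h)"
    then obtain d where d: "d \<in> exponents n" "e = merge x y d"
      using keys_merge_poly[of x y h] h by blast
    show "keys e \<subseteq> {1..n} - {y}"
    proof
      fix i assume "i \<in> keys e"
      then have "i \<noteq> y" "i = x \<or> i \<in> keys d"
        using xy by (auto simp: d lookup_merge in_keys_iff split: if_splits)
      then show "i \<in> {1..n} - {y}" using d(1) xy by (auto simp: exponents_def)
    qed
  qed auto
  have "single e (lookup (merge_poly x y h) e) \<in> Q" if ek: "e \<in> keys (merge_poly x y h)" for e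
  proof -
    define c where "c = lookup (merge_poly x y h) e"
    obtain d where d: "d \<in> U" "d \<in> exponents n" "e = merge x y d" using kh ek by blast
    have "single d c \<in> Q"
      unfolding Q_def using d by (intro CollectI exI[of _ 0]) (simp add: mon_ideal_def)
    moreover have "single e c = (single (merge x y d) c - single d c) + single d c" by (simp add: d)
    ultimately show ?thesis unfolding c_def[symmetric] using Q_add Q_merge(2)[OF d(2)] by metis
  qed
  then have "(\<Sum>e\<in>keys (merge_poly x y h). single e (lookup (merge_poly x y h) e)) \<in> Q" by (rule Q_sum)
  then have "merge_poly x y h \<in> Q" by (simp add: sum_monomials)
  moreover have "h - merge_poly x y h \<in> Q"
  proof -
    have "h - merge_poly x y h = (\<Sum>e\<in>keys h. single e (lookup h e)) - merge_poly x y h"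
      by (simp add: sum_monomials)
    also have "\<dots> = (\<Sum>e\<in>keys h. single e (lookup h e) - single (merge x y e) (lookup h e))"
      by (simp add: merge_poly_def sum_subtractf)
    also have "\<dots> \<in> Q" using h by (intro Q_sum Q_merge(1)) auto
    finally show ?thesis .
  qed
  ultimately have "h \<in> Q" using Q_add by fastforce
  then show "\<exists>w. keys w \<subseteq> exponents n \<and> h - ?f * w \<in> mon_ideal n U" by (simp add: Q_def)
qed

lemma incidences_map_merge:
  assumes "x \<noteq> y"
  defines "r \<equiv> \<lambda>v. if v = y then x else v"
  shows "incidences (map (map_prod r r) es) v =
    (if v = y then 0 else if v = x then incidences es x + incidences es y else incidences es v)"
  using assms(1) by (induction es) (auto simp: r_def)

text \<open>Packings can be relabelled in both directions, so identifying \<open>x\<close> and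
  \<open>y\<close> commutes with taking powers. If \<open>x\<close> and \<open>y\<close> are joined
  by an edge, \<open>x\<close> receives a loop, that is, the generator \<open>x^2\<close>; this is
  why \<open>socle_power_ge\<close> allows a loop at its root.\<close>

lemma merge_packing_exponents:
  assumes xy: "x \<noteq> y" "x \<in> {1..n}" "y \<in> {1..n}" and e: "keys e \<subseteq> {1..n} - {y}"
  defines "r \<equiv> \<lambda>v. if v = y then x else v"
  shows "e \<in> merge x y ` (packing_exponents E t \<inter> exponents n)
    \<longleftrightarrow> packs (map_prod r r ` E) t (lookup e)"
proof
  note inc = incidences_map_merge[OF xy(1), folded r_def]
  assume "e \<in> merge x y ` (packing_exponents E t \<inter> exponents n)"
  then obtain d es where d: "e = merge x y d" "length es = t" "set es \<subseteq> E" "incidences es \<le> lookup d"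
    by (auto simp: packing_exponents_def packs_def)
  have "incidences (map (map_prod r r) es) \<le> lookup e"
    using d(4) xy(1) by (auto simp: le_fun_def inc d(1) lookup_merge intro: add_mono)
  then show "packs (map_prod r r ` E) t (lookup e)"
    unfolding packs_def using d by (intro exI[of _ "map (map_prod r r) es"]) auto
next
  note inc = incidences_map_merge[OF xy(1), folded r_def]
  assume "packs (map_prod r r ` E) t (lookup e)"
  then obtain es' where es': "length es' = t" "set es' \<subseteq> map_prod r r ` E" "incidences es' \<le> lookup e"
    by (auto simp: packs_def)
  obtain es where es: "set es \<subseteq> E" "es' = map (map_prod r r) es"
  proof -
    have "es' \<in> map (map_prod r r) ` lists E"
      using es'(2) unfolding lists_image[symmetric] by (simp add: lists_eq_set)
    then show ?thesis using that by (auto simp: lists_eq_set)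
  qed
  \<comment> \<open>The lifted packing \<open>es\<close> uses \<open>y\<close> exactly
    \<open>k\<close> times, so this much of the exponent of \<open>x\<close> moves back to
    \<open>y\<close>.\<close>
  define k where "k = incidences es y"
  define d where "d = e - single x k + single y k"
  have le: "incidences es x + k \<le> lookup e x"
    using le_funD[OF es'(3), of x] xy(1) by (simp add: es(2) inc k_def)
  have ey: "lookup e y = 0" using e by (auto simp: in_keys_iff)
  have look: "lookup d v = (if v = y then k else if v = x then lookup e x - k else lookup e v)" for v
    using xy(1) ey by (auto simp: d_def lookup_add lookup_minus lookup_single when_def)
  have "e = merge x y d"
    using xy(1) le ey by (intro poly_mapping_eqI) (auto simp: lookup_merge look)
  moreover have "incidences es v \<le> lookup d v" for v
    using le_funD[OF es'(3), of v] le xy(1) by (auto simp: es(2) inc look k_def split: if_splits)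
  then have "d \<in> packing_exponents E t"
    unfolding packing_exponents_def packs_def using es es'(1) by (auto simp: le_fun_def)
  moreover have "d \<in> exponents n"
    using e xy by (auto simp: exponents_def in_keys_iff look subset_iff split: if_splits)
  ultimately show "e \<in> merge x y ` (packing_exponents E t \<inter> exponents n)" by blast
qed

section \<open>Socle exponents of trees with pendant vertices\<close>

definition adjacent :: "('a \<times> 'a) set \<Rightarrow> 'a \<Rightarrow> 'a \<Rightarrow> bool" where
  "adjacent E a b \<longleftrightarrow> (a, b) \<in> E \<or> (b, a) \<in> E"

lemma adjacent_commute: "adjacent E a b \<longleftrightarrow> adjacent E b a"
  by (auto simp: adjacent_def)

text \<open>A leaf relative to the support of \<open>u\<close>. An isolated \<open>j\<close> is
  included, with any other vertex in the role of its neighbour \<open>i\<close>.\<close>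

definition leaf_in :: "('a \<times> 'a) set \<Rightarrow> ('a \<Rightarrow> nat) \<Rightarrow> 'a \<Rightarrow> 'a \<Rightarrow> bool" where
  "leaf_in E u j i \<longleftrightarrow> j \<noteq> i \<and> (\<forall>a. adjacent E j a \<longrightarrow> u a > 0 \<longrightarrow> a = i)"

lemma leaf_in_edge:
  assumes "leaf_in E u j i" "e \<in> set es" "set es \<subseteq> E" "incidences es \<le> u"
  shows "fst e = j \<Longrightarrow> snd e = i" and "snd e = j \<Longrightarrow> fst e = i"
proof -
  have "incidences es (fst e) > 0" "incidences es (snd e) > 0"
    using assms(2) by (auto simp: incidences_pos_iff)
  then have "u (fst e) > 0" "u (snd e) > 0"
    using le_funD[OF assms(4), of "fst e"] le_funD[OF assms(4), of "snd e"] by simp_all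
  moreover have "(fst e, snd e) \<in> E" using assms(2,3) by auto
  ultimately show "fst e = j \<Longrightarrow> snd e = i" "snd e = j \<Longrightarrow> fst e = i"
    using assms(1) by (auto simp: leaf_in_def adjacent_def)
qed

lemma incidences_leaf_le:
  assumes "leaf_in E u j i" "set es \<subseteq> E" "incidences es \<le> u"
  shows "incidences es j \<le> incidences es i"
proof -
  have "\<forall>e\<in>set es. (fst e = j \<longrightarrow> snd e = i) \<and> (snd e = j \<longrightarrow> fst e = i)"
    using leaf_in_edge[OF assms(1) _ assms(2,3)] by blast
  moreover have "j \<noteq> i" using assms(1) by (simp add: leaf_in_def)
  ultimately show ?thesis by (induction es) auto
qed

lemma leaf_in_mono: "leaf_in E u j i \<Longrightarrow> v \<le> u \<Longrightarrow> leaf_in E v j i"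
  by (metis leaf_in_def le_funD gr0I le_zero_eq)

text \<open>A maximum packing may be assumed to match a leaf to its neighbour.\<close>

lemma packs_remove_leaf_edge:
  assumes leaf: "leaf_in E u j i" and pos: "u i > 0" "u j > 0" and "packs E t u"
  shows "packs E (t - 1) (\<lambda>v. u v - (unit i v + unit j v))"
proof -
  obtain es where es: "length es = t" "set es \<subseteq> E" "incidences es \<le> u"
    using assms(4) by (auto simp: packs_def)
  have ij: "j \<noteq> i" using leaf by (simp add: leaf_in_def)
  have rem: ?thesis if e: "e \<in> set es"
    and le: "\<And>v. incidences (remove1 e es) v \<le> u v - (unit i v + unit j v)" for e
    unfolding packs_def
    using e es set_remove1_subset[of e es] le
    by (intro exI[of _ "remove1 e es"]) (auto simp: length_remove1 le_fun_def)
  \<comment> \<open>Give up an edge at \<open>j\<close>, which joins it to \<open>i\<close>; if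
    there is none, an edge at \<open>i\<close>; if there is none either, any edge.\<close>
  consider e where "e \<in> set es" "fst e = j \<or> snd e = j"
    | e where "e \<in> set es" "fst e = i \<or> snd e = i" "incidences es j = 0"
    | "incidences es i = 0" "incidences es j = 0"
    using incidences_pos_iff[of es] by (metis gr0I)
  then show ?thesis
  proof cases
    case 1
    then have "(fst e = j \<and> snd e = i) \<or> (fst e = i \<and> snd e = j)"
      using leaf_in_edge[OF leaf 1(1) es(2,3)] by blast
    then have "incidences (remove1 e es) v \<le> u v - (unit i v + unit j v)" for v
      using incidences_remove1[OF 1(1), of v] le_funD[OF es(3), of v] ij by (auto split: if_splits)
    then show ?thesis by (rule rem[OF 1(1)])
  next
    case 2
    have "incidences (remove1 e es) v \<le> u v - (unit i v + unit j v)" for v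
      using incidences_remove1[OF 2(1), of v] le_funD[OF es(3), of v] 2(2,3) ij
      by (cases "v = i"; cases "v = j") auto
    then show ?thesis by (rule rem[OF 2(1)])
  next
    case 3
    have "incidences es \<le> (\<lambda>v. u v - (unit i v + unit j v))"
      using 3 es(3) ij by (auto simp: le_fun_def)
    then have "packs E t (\<lambda>v. u v - (unit i v + unit j v))" using es by (auto simp: packs_def)
    then show ?thesis by (rule packs_le) simp
  qed
qed

lemma packs_remove_leaf_edges:
  assumes "leaf_in E u j i" "k \<le> u i" "k \<le> u j" "packs E t u"
  shows "packs E (t - k) (\<lambda>v. u v - (k * unit i v + k * unit j v))"
  using assms(2,3)
proof (induction k)
  case (Suc k)
  let ?u = "\<lambda>v. u v - (k * unit i v + k * unit j v)"
  have "j \<noteq> i" using assms(1) by (simp add: leaf_in_def)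
  have "leaf_in E ?u j i" by (rule leaf_in_mono[OF assms(1)]) (simp add: le_fun_def)
  moreover have "?u i > 0" "?u j > 0" using Suc.prems \<open>j \<noteq> i\<close> by auto
  ultimately have "packs E (t - k - 1) (\<lambda>v. ?u v - (unit i v + unit j v))"
    using Suc by (intro packs_remove_leaf_edge) auto
  moreover have "(\<lambda>v. ?u v - (unit i v + unit j v)) = (\<lambda>v. u v - (Suc k * unit i v + Suc k * unit j v))"
    by (auto simp: fun_eq_iff)
  ultimately show ?case by simp
qed (simp add: assms(4))

lemma packs_add_edges:
  assumes "adjacent E i j" "packs E s (\<lambda>v. u v - (k * unit i v + k * unit j v))"
    and "k \<le> u i" "k \<le> u j" "i \<noteq> j"
  shows "packs E (s + k) u"
proof -
  obtain e where e: "e \<in> E" "\<And>v. unit (fst e) v + unit (snd e) v = unit i v + unit j v"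
    using assms(1) by (fastforce simp: adjacent_def)
  have "incidences (replicate k e) v = k * unit i v + k * unit j v" for v
  proof (induction k)
    case (Suc k)
    have "of_bool (fst e = v) + of_bool (snd e = v) = unit i v + unit j v"
      using e(2)[of v] by (simp add: eq_commute)
    with Suc show ?case by simp
  qed simp
  then have "packs E k (\<lambda>v. k * unit i v + k * unit j v)"
    using e(1) unfolding packs_def by (intro exI[of _ "replicate k e"]) (auto simp: le_fun_def)
  from packs_add[OF assms(2) this] show ?thesis
    by (rule packs_mono) (use assms(3-5) in \<open>auto simp: le_fun_def\<close>)
qed

text \<open>A packing that becomes possible by raising \<open>j\<close> must use \<open>j\<close>
  more than \<open>u j\<close> times, and each of these edges also spends a unit of
  \<open>i\<close>, which has not been raised.\<close>

lemma weight_less_if_not_packs: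
  assumes leaf: "leaf_in E (\<lambda>v. u v + unit j v) j i"
    and "packs E t (\<lambda>v. u v + unit j v)" "\<not> packs E t u"
  shows "u j < u i" and "adjacent E j i"
proof -
  obtain es where es: "length es = t" "set es \<subseteq> E" "incidences es \<le> (\<lambda>v. u v + unit j v)"
    using assms(2) by (auto simp: packs_def)
  have "\<not> incidences es \<le> u" using assms(3) es by (auto simp: packs_def)
  then obtain v where "incidences es v > u v" by (auto simp: le_fun_def not_le)
  then have j: "incidences es j > u j"
    using le_funD[OF es(3), of v] by (cases "v = j") auto
  moreover have "incidences es j \<le> incidences es i" by (rule incidences_leaf_le[OF leaf es(2,3)])
  moreover have "incidences es i \<le> u i"
    using le_funD[OF es(3), of i] leaf by (auto simp: leaf_in_def)
  ultimately show "u j < u i" by linarith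
  from j obtain e where "e \<in> set es" "fst e = j \<or> snd e = j"
    using incidences_pos_iff[of es j] by auto
  then show "adjacent E j i"
    using leaf_in_edge[OF leaf _ es(2,3)] es(2) unfolding adjacent_def by (metis prod.collapse subsetD)
qed

text \<open>
  The set \<open>T\<close> carries a tree rooted at \<open>z\<close>, and each \<open>j \<noteq> z\<close> in \<open>T\<close> has a pendant vertex \<open>w j\<close>.
  The weight \<open>u\<close> is a socle exponent of the \<open>t\<close>-th ideal power. Peeling off a leaf \<open>j\<close> of \<open>T\<close>
  removes at least one edge from the packings.
\<close>

lemma socle_power_ge:
  assumes "finite T" "z \<in> T"
    and whisker: "\<And>j. j \<in> T - {z} \<Longrightarrow> w j \<notin> T \<and> (\<forall>a. adjacent E (w j) a \<longleftrightarrow> a = j)"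
    and loopfree: "\<And>j. j \<in> T - {z} \<Longrightarrow> \<not> adjacent E j j"
    and peel: "\<And>S. S \<subseteq> T \<Longrightarrow> z \<in> S \<Longrightarrow> S \<noteq> {z} \<Longrightarrow>
      \<exists>j\<in>S - {z}. \<exists>i. \<forall>a\<in>S. adjacent E j a \<longrightarrow> a = i"
    and "\<And>v. u v > 0 \<Longrightarrow> v \<in> T \<union> w ` (T - {z})"
    and "\<not> packs E t u"
    and "\<And>v. v \<in> T \<union> w ` (T - {z}) \<Longrightarrow> packs E t (\<lambda>x. u x + unit v x)"
  shows "card T \<le> t"
proof -
  have "card S \<le> t" if "S \<subseteq> T" "z \<in> S"
    and "\<And>v. u v > 0 \<Longrightarrow> v \<in> S \<union> w ` (S - {z})" "\<not> packs E t u"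
    and "\<And>v. v \<in> S \<union> w ` (S - {z}) \<Longrightarrow> packs E t (\<lambda>x. u x + unit v x)" for S u t
    using that
  proof (induction "card S" arbitrary: S u t rule: less_induct)
    case less
    have finS: "finite S" using less.prems(1) assms(1) finite_subset by blast
    show ?case
    proof (cases "S = {z}")
      case True
      \<comment> \<open>The empty packing always exists, so \<open>t\<close> is at least 1.\<close>
      then show ?thesis using less.prems(4) by (cases t) auto
    next
      case False
      then obtain j i' where j: "j \<in> S - {z}" and i': "\<forall>a\<in>S. adjacent E j a \<longrightarrow> a = i'"
        using peel[OF less.prems(1,2)] by blast
      define i where "i = (if i' = j then z else i')"
      have jT: "j \<in> T - {z}" using j less.prems(1) by blast
      have i: "a = i" if "a \<in> S" "adjacent E j a" for a
        using i' that loopfree[OF jT] by (auto simp: i_def)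
      have ij: "i \<noteq> j" using j by (auto simp: i_def)
      have wj: "w j \<notin> S" "adjacent E (w j) a \<longleftrightarrow> a = j" for a
        using whisker[OF jT] less.prems(1) by auto
      have wne: "w j \<noteq> j" using wj(1) j by auto
      have leaf_w: "leaf_in E x (w j) j" for x using wj(2) wne by (auto simp: leaf_in_def)
      have b: "u (w j) < u j"
        using weight_less_if_not_packs(1)[OF leaf_w less.prems(5) less.prems(4)] j by blast
      \<comment> \<open>Two rounds of removal: \<open>b\<close> copies of the pendant edge empty
        \<open>w j\<close>, which makes \<open>j\<close> a leaf with neighbour \<open>i\<close>, and
        then \<open>a = u1 j\<close> copies of \<open>{i, j}\<close> empty \<open>j\<close>. Each
        round lowers \<open>t\<close> by the number of copies and keeps the socle
        conditions.\<close>
      define b where "b = u (w j)"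
      define u1 where "u1 v = u v - (b * unit j v + b * unit (w j) v)" for v
      have u1w: "u1 (w j) = 0" and u1j: "u1 j > 0" and u1o: "v \<noteq> j \<Longrightarrow> v \<noteq> w j \<Longrightarrow> u1 v = u v" for v
        using b wne by (auto simp: u1_def b_def)
      have p1: "packs E (t - b) (\<lambda>x. u1 x + unit v x)" if "v \<in> S \<union> w ` (S - {z})" for v
      proof -
        have "packs E (t - b) (\<lambda>x. (u x + unit v x) - (b * unit j x + b * unit (w j) x))"
          using b by (intro packs_remove_leaf_edges leaf_w less.prems(5) that) (auto simp: b_def)
        moreover have "(\<lambda>x. (u x + unit v x) - (b * unit j x + b * unit (w j) x)) = (\<lambda>x. u1 x + unit v x)"
          using b wne by (auto simp: fun_eq_iff u1_def b_def)
        ultimately show ?thesis by simp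
      qed
      have n1: "\<not> packs E (t - b) u1"
      proof
        assume "packs E (t - b) u1"
        then have "packs E (t - b + b) u"
          unfolding u1_def using b wj(2) wne
          by (intro packs_add_edges[of E j "w j"]) (auto simp: adjacent_commute b_def)
        then show False using less.prems(4) packs_le[of E "t - b + b" u t] by simp
      qed
      have leaf_j: "leaf_in E (\<lambda>x. u1 x + unit v x) j i" if v: "v \<in> S \<union> w ` (S - {z})" "v \<noteq> w j" for v
        unfolding leaf_in_def
      proof (intro conjI allI impI)
        fix a assume a: "adjacent E j a" "u1 a + unit v a > 0"
        have "a \<noteq> w j" using a(2) u1w v(2) by auto
        have "a \<in> S \<union> w ` (S - {z})"
        proof (cases "a = v")
          case False
          then have "u1 a > 0" using a(2) by simp
          then have "u a > 0" by (simp add: u1_def)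
          then show ?thesis by (rule less.prems(3))
        qed (use v in simp)
        moreover have "a \<notin> w ` (S - {z})"
        proof
          assume "a \<in> w ` (S - {z})"
          then obtain k where k: "k \<in> S - {z}" "a = w k" by blast
          then have "adjacent E (w k) j" using a(1) by (simp add: adjacent_commute)
          then have "j = k" using whisker[of k] k(1) less.prems(1) by blast
          then show False using k(2) \<open>a \<noteq> w j\<close> by simp
        qed
        ultimately show "a = i" using i a(1) by blast
      qed (use ij in simp)
      have jV: "j \<in> S \<union> w ` (S - {z})" using j by blast
      have a: "u1 j < u1 i" and adj: "adjacent E j i"
        using weight_less_if_not_packs[OF leaf_j[OF jV wne[symmetric]] p1[OF jV] n1] by blast+
      define a where "a = u1 j"
      define u2 where "u2 v = u1 v - (a * unit i v + a * unit j v)" for v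
      have "card (S - {j}) \<le> t - b - a"
      proof (rule less.hyps)
        show "card (S - {j}) < card S" using finS j by (intro card_Diff1_less) auto
        show "S - {j} \<subseteq> T" "z \<in> S - {j}" using less.prems(1,2) j by auto
      next
        fix v assume v: "u2 v > 0"
        then have "u1 v > 0" by (simp add: u2_def)
        moreover from this have "u v > 0" by (simp add: u1_def)
        moreover have "v \<noteq> j" using v ij by (auto simp: u2_def a_def)
        moreover have "v \<noteq> w j" using u1w \<open>u1 v > 0\<close> by auto
        ultimately show "v \<in> (S - {j}) \<union> w ` (S - {j} - {z})" using less.prems(3)[of v] by auto
      next
        show "\<not> packs E (t - b - a) u2"
        proof
          assume "packs E (t - b - a) u2"
          then have "packs E (t - b - a + a) u1"
            unfolding u2_def using a ij adj
            by (intro packs_add_edges[of E i j]) (auto simp: adjacent_commute a_def)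
          then show False using n1 packs_le[of E "t - b - a + a" u1 "t - b"] by simp
        qed
      next
        fix v assume v: "v \<in> (S - {j}) \<union> w ` (S - {j} - {z})"
        have vS: "v \<in> S \<union> w ` (S - {z})" using v by auto
        have vw: "v \<noteq> w j"
        proof
          assume "v = w j"
          then obtain k where k: "k \<in> S - {j} - {z}" "w j = w k" using v wj(1) by auto
          have "adjacent E (w k) k" using whisker[of k] k(1) less.prems(1) by blast
          then show False using wj(2)[of k] k by simp
        qed
        have vj: "v \<noteq> j"
        proof
          assume "v = j"
          then obtain k where "k \<in> S - {j} - {z}" "j = w k" using v by auto
          then show False using whisker[of k] less.prems(1) jT by blast
        qed
        have "packs E (t - b - a) (\<lambda>x. (u1 x + unit v x) - (a * unit i x + a * unit j x))"
          using a by (intro packs_remove_leaf_edges leaf_j vS vw p1) (auto simp: a_def)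
        moreover have "(\<lambda>x. (u1 x + unit v x) - (a * unit i x + a * unit j x)) = (\<lambda>x. u2 x + unit v x)"
          using a ij vj by (auto simp: fun_eq_iff u2_def a_def)
        ultimately show "packs E (t - b - a) (\<lambda>x. u2 x + unit v x)" by simp
      qed
      \<comment> \<open>The root remains, so \<open>t - b - a\<close> is positive and the
        subtraction on naturals has not been cut off.\<close>
      moreover have "card (S - {j}) > 0" unfolding card_gt_0_iff using finS less.prems(2) j by auto
      moreover have "card S = Suc (card (S - {j}))" using finS j by (intro card.remove) auto
      moreover have "a > 0" using u1j by (simp add: a_def)
      ultimately show ?thesis by linarith
    qed
  qed
  from this[of T u t] assms show ?thesis by blast
qed

section \<open>Matched bipartite graphs\<close>

text \<open>\<open>E\<close> holds each edge once, oriented from \<open>A\<close> to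
  \<open>B\<close>. \<open>linked\<close> is connectedness after contraction of the matching edges,
  and \<open>well_covered\<close> is the form of well-coveredness on which \<open>packs_iff\<close>
  rests.\<close>

locale matched_bipartite =
  fixes A B :: "nat set" and E :: "(nat \<times> nat) set" and \<mu> :: "nat \<Rightarrow> nat" and n :: nat
  assumes finite_A: "finite A" and A_nonempty: "A \<noteq> {}"
    and disjoint: "A \<inter> B = {}" and vertices: "A \<union> B = {1..n}"
    and edges: "E \<subseteq> A \<times> B"
    and matching: "bij_betw \<mu> A B" and matching_edge: "a \<in> A \<Longrightarrow> (a, \<mu> a) \<in> E"
    and linked: "X \<subseteq> A \<Longrightarrow> X \<noteq> {} \<Longrightarrow> X \<noteq> A \<Longrightarrow>
      \<exists>i\<in>X. \<exists>j\<in>A - X. (i, \<mu> j) \<in> E \<or> (j, \<mu> i) \<in> E"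
    and well_covered: "C \<subseteq> A \<union> B \<Longrightarrow> covers E C \<Longrightarrow>
      \<exists>D\<subseteq>C. covers E D \<and> (\<forall>a\<in>A. a \<in> D \<longleftrightarrow> \<mu> a \<notin> D)"
begin

lemma finite_B: "finite B"
  using finite_A matching bij_betw_finite by blast

lemma \<mu>_in_B [simp]: "a \<in> A \<Longrightarrow> \<mu> a \<in> B"
  using matching by (auto simp: bij_betw_def)

lemma \<mu>_notin_A [simp]: "a \<in> A \<Longrightarrow> \<mu> a \<notin> A"
  using disjoint \<mu>_in_B by blast

lemma \<mu>_eq_iff [simp]: "a \<in> A \<Longrightarrow> b \<in> A \<Longrightarrow> \<mu> a = \<mu> b \<longleftrightarrow> a = b"
  using matching by (auto simp: bij_betw_def inj_on_def)

lemma B_eq: "B = \<mu> ` A"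
  using matching by (simp add: bij_betw_def)

section \<open>Transversal covers and up-closed sets\<close>

definition transversal_covers :: "nat set set" where
  "transversal_covers = {C. C \<subseteq> A \<union> B \<and> covers E C \<and> (\<forall>a\<in>A. a \<in> C \<longleftrightarrow> \<mu> a \<notin> C)}"

lemma finite_transversal_cover: "C \<in> transversal_covers \<Longrightarrow> finite C"
  unfolding transversal_covers_def using finite_subset[of C "A \<union> B"] finite_A finite_B by simp

text \<open>Every cover contains a transversal one of no larger weight, so Koenig's condition has to
  be tested on these only. In ideal terms, the power is the intersection of the \<open>t\<close>-th
  powers of the minimal primes.\<close>

lemma packs_iff: "packs E t u \<longleftrightarrow> (\<forall>C\<in>transversal_covers. t \<le> sum u C)"
proof
  assume "packs E t u"
  then show "\<forall>C\<in>transversal_covers. t \<le> sum u C"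
    using cover_weight_ge[of E t u] finite_transversal_cover by (simp add: transversal_covers_def)
next
  assume *: "\<forall>C\<in>transversal_covers. t \<le> sum u C"
  show "packs E t u"
  proof (rule packs_if_covers_ge[OF finite_A finite_B disjoint edges])
    fix C assume C: "C \<subseteq> A \<union> B" "covers E C"
    then obtain D where D: "D \<subseteq> C" "covers E D" "\<forall>a\<in>A. a \<in> D \<longleftrightarrow> \<mu> a \<notin> D"
      using well_covered by blast
    then have "D \<in> transversal_covers" using C(1) by (auto simp: transversal_covers_def)
    then have "t \<le> sum u D" using * by blast
    also have "\<dots> \<le> sum u C"
      using D(1) finite_subset[OF C(1)] finite_A finite_B by (intro sum_mono2) auto
    finally show "t \<le> sum u C" .
  qed
qed

text \<open>\<open>E\<close> defines a relation on \<open>A\<close>: \<open>i\<close> is below \<open>j\<close> if it is adjacent to \<open>\<mu> j\<close>. Transversal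
  covers correspond to the subsets of \<open>A\<close> that are closed upwards.\<close>

definition upset :: "nat set \<Rightarrow> bool" where
  "upset S \<longleftrightarrow> S \<subseteq> A \<and> (\<forall>i\<in>S. \<forall>j\<in>A. (i, \<mu> j) \<in> E \<longrightarrow> j \<in> S)"

lemma transversal_cover_upset:
  assumes "C \<in> transversal_covers"
  shows "\<exists>S. upset S \<and> C = (A - S) \<union> \<mu> ` S"
proof (intro exI[of _ "A - C"] conjI)
  have C: "C \<subseteq> A \<union> B" "covers E C" "\<And>a. a \<in> A \<Longrightarrow> a \<in> C \<longleftrightarrow> \<mu> a \<notin> C"
    using assms by (auto simp: transversal_covers_def)
  show "upset (A - C)"
    unfolding upset_def
  proof (intro conjI ballI impI)
    fix i j assume "i \<in> A - C" "j \<in> A" "(i, \<mu> j) \<in> E"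
    then show "j \<in> A - C" using C(2,3) by (auto simp: covers_def)
  qed blast
  show "C = (A - (A - C)) \<union> \<mu> ` (A - C)"
  proof (intro equalityI subsetI)
    fix x assume x: "x \<in> C"
    show "x \<in> (A - (A - C)) \<union> \<mu> ` (A - C)"
    proof (cases "x \<in> A")
      case False
      then obtain a where "a \<in> A" "x = \<mu> a" using x C(1) B_eq by auto
      then show ?thesis using x C(3) by auto
    qed (use x in auto)
  qed (use C(3) in auto)
qed

lemma transversal_cover_A: "A \<in> transversal_covers"
  using edges by (auto simp: transversal_covers_def covers_def)

lemma transversal_cover_B: "B \<in> transversal_covers"
  using edges disjoint by (auto simp: transversal_covers_def covers_def)

text \<open>
  A separating weight on \<open>X = A\<close> encodes the exponent with its negative part on \<open>A\<close> and its
  positive part on \<open>B\<close>; \<open>c\<close> bounds the degree on either side.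
\<close>

definition separating :: "nat set \<Rightarrow> (nat \<Rightarrow> int) \<Rightarrow> nat \<Rightarrow> bool" where
  "separating X \<gamma> c \<longleftrightarrow> X \<subseteq> A \<and> (\<forall>i. i \<notin> X \<longrightarrow> \<gamma> i = 0) \<and> sum \<gamma> A = 0 \<and>
    (\<Sum>i\<in>A. max (\<gamma> i) 0) \<le> int c \<and>
    (\<forall>S. upset S \<longrightarrow> S \<inter> X \<noteq> {} \<longrightarrow> \<not> X \<subseteq> S \<longrightarrow> sum \<gamma> S \<ge> 1)"

text \<open>A unit is moved from \<open>q\<close> up to \<open>p\<close>, along an edge that joins a
  new element \<open>v\<close> to \<open>X\<close>. No up-closed set loses by it, and one that
  separates \<open>v\<close> from all of \<open>X\<close> gains 1.\<close>

lemma separating_extend: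
  assumes g: "separating X \<gamma> c" and X: "X \<noteq> {}" "X \<noteq> A"
  shows "\<exists>v\<in>A - X. \<exists>\<gamma>'. separating (insert v X) \<gamma>' (Suc c)"
proof -
  have XA: "X \<subseteq> A" using g by (simp add: separating_def)
  obtain x v where xv: "x \<in> X" "v \<in> A - X" "(x, \<mu> v) \<in> E \<or> (v, \<mu> x) \<in> E"
    using linked[OF XA X] by blast
  define p q where "p = (if (x, \<mu> v) \<in> E then v else x)" and "q = (if (x, \<mu> v) \<in> E then x else v)"
  have pq: "p \<in> A" "q \<in> A" "p \<noteq> q" "(q, \<mu> p) \<in> E" "{p, q} = {x, v}"
    using xv XA by (auto simp: p_def q_def split: if_splits)
  define \<delta> :: "nat \<Rightarrow> int" where "\<delta> i = of_bool (i = p) - of_bool (i = q)" for i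
  have sum_\<delta>: "sum \<delta> S = of_bool (p \<in> S) - of_bool (q \<in> S)" if "finite S" for S
    using that by (simp add: \<delta>_def sum_subtractf of_bool_def)
  have S_le: "of_bool (q \<in> S) \<le> (of_bool (p \<in> S) :: int)" if "upset S" for S
    using that pq by (auto simp: upset_def)
  have "separating (insert v X) (\<lambda>i. \<gamma> i + \<delta> i) (Suc c)"
    unfolding separating_def
  proof (intro conjI allI impI)
    show "insert v X \<subseteq> A" using xv XA by blast
    show "\<gamma> i + \<delta> i = 0" if "i \<notin> insert v X" for i
      using that g xv pq(5) by (auto simp: separating_def \<delta>_def)
    show "(\<Sum>i\<in>A. \<gamma> i + \<delta> i) = 0"
      using g pq sum_\<delta>[OF finite_A] by (simp add: separating_def sum.distrib)
    have "(\<Sum>i\<in>A. max (\<gamma> i + \<delta> i) 0) \<le> (\<Sum>i\<in>A. max (\<gamma> i) 0 + of_bool (i = p))"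
      by (rule sum_mono) (auto simp: \<delta>_def)
    also have "\<dots> = (\<Sum>i\<in>A. max (\<gamma> i) 0) + 1"
      using pq(1) finite_A by (simp add: sum.distrib of_bool_def)
    also have "\<dots> \<le> int (Suc c)" using g by (simp add: separating_def)
    finally show "(\<Sum>i\<in>A. max (\<gamma> i + \<delta> i) 0) \<le> int (Suc c)" .
  next
    fix S assume S: "upset S" "S \<inter> insert v X \<noteq> {}" "\<not> insert v X \<subseteq> S"
    have finS: "finite S" using S(1) finite_A finite_subset by (auto simp: upset_def)
    have eq: "(\<Sum>i\<in>S. \<gamma> i + \<delta> i) = sum \<gamma> S + (of_bool (p \<in> S) - of_bool (q \<in> S))"
      by (simp add: sum.distrib sum_\<delta>[OF finS])
    consider "S \<inter> X \<noteq> {}" "\<not> X \<subseteq> S" | "S \<inter> X = {}" | "X \<subseteq> S" by blast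
    then show "(\<Sum>i\<in>S. \<gamma> i + \<delta> i) \<ge> 1"
    proof cases
      case 1
      then have "sum \<gamma> S \<ge> 1" using g S(1) by (auto simp: separating_def)
      then show ?thesis using eq S_le[OF S(1)] by linarith
    next
      case 2
      then have "sum \<gamma> S = 0" using g by (intro sum.neutral) (auto simp: separating_def)
      moreover have "v \<in> S" "x \<notin> S" using 2 S(2) xv by auto
      then have "p \<in> S" "q \<notin> S" using S(1) pq by (auto simp: upset_def doubleton_eq_iff)
      ultimately show ?thesis using eq by simp
    next
      case 3
      have "sum \<gamma> S = sum \<gamma> A"
      proof (rule sum.mono_neutral_left)
        show "S \<subseteq> A" using S(1) by (simp add: upset_def)
        show "\<forall>i\<in>A - S. \<gamma> i = 0" using 3 g by (auto simp: separating_def)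
      qed (rule finite_A)
      then have "sum \<gamma> S = 0" using g by (simp add: separating_def)
      moreover have "x \<in> S" "v \<notin> S" using 3 S(3) xv by auto
      then have "p \<in> S" "q \<notin> S" using S(1) pq by (auto simp: upset_def doubleton_eq_iff)
      ultimately show ?thesis using eq by simp
    qed
  qed
  then show ?thesis using xv(2) by blast
qed

lemma separating_A:
  assumes "separating X \<gamma> c" "X \<noteq> {}"
  shows "\<exists>\<gamma>'. separating A \<gamma>' (c + (card A - card X))"
  using assms
proof (induction "card A - card X" arbitrary: X \<gamma> c)
  case 0
  then have "X \<subseteq> A" by (simp add: separating_def)
  then have "X = A" using 0 card_subset_eq[OF finite_A, of X] card_mono[OF finite_A, of X] by simp
  then show ?case using 0 by auto
next
  case (Suc k)
  then have XA: "X \<subseteq> A" "X \<noteq> A" by (auto simp: separating_def)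
  obtain v \<gamma>' where v: "v \<in> A - X" "separating (insert v X) \<gamma>' (Suc c)"
    using separating_extend[OF Suc.prems XA(2)] by blast
  have "card (insert v X) = Suc (card X)"
    using v finite_subset[OF XA(1) finite_A] by simp
  then have "Suc c + (card A - card (insert v X)) = c + (card A - card X)" "k = card A - card (insert v X)"
    using Suc.hyps(2) by simp_all
  then show ?case using Suc.hyps(1)[of "insert v X" \<gamma>' "Suc c"] v(2) by (metis insert_not_empty)
qed

lemma separating_singleton: "a \<in> A \<Longrightarrow> separating {a} (\<lambda>_. 0) 0"
  by (auto simp: separating_def)

text \<open>No up-closed set separates the two elements, so degree 0 does where a tree edge would
  cost 1.\<close>

lemma separating_equivalent:
  assumes "i \<in> A" "j \<in> A" "(i, \<mu> j) \<in> E" "(j, \<mu> i) \<in> E"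
  shows "separating {i, j} (\<lambda>_. 0) 0"
  using assms by (auto simp: separating_def upset_def)

text \<open>An up-closed set that splits the chain contains its top \<open>k\<close> and misses its
  bottom \<open>i\<close>. So three elements cost 1, where a tree would cost 2.\<close>

lemma separating_chain:
  assumes "i \<in> A" "j \<in> A" "k \<in> A" "i \<noteq> j" "j \<noteq> k" "i \<noteq> k" "(i, \<mu> j) \<in> E" "(j, \<mu> k) \<in> E"
  shows "separating {i, j, k} (\<lambda>v. of_bool (v = k) - of_bool (v = i)) 1"
  unfolding separating_def
proof (intro conjI allI impI)
  have sum: "(\<Sum>v\<in>S. of_bool (v = k) - of_bool (v = i) :: int) = of_bool (k \<in> S) - of_bool (i \<in> S)"
    if "finite S" for S
    using that by (simp add: sum_subtractf of_bool_def)
  show "(\<Sum>v\<in>A. of_bool (v = k) - of_bool (v = i) :: int) = 0"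
    using sum[OF finite_A] assms by simp
  have "(\<Sum>v\<in>A. max (of_bool (v = k) - of_bool (v = i) :: int) 0) \<le> (\<Sum>v\<in>A. of_bool (v = k))"
    by (rule sum_mono) auto
  also have "\<dots> = 1" using finite_A assms(3) by (simp add: of_bool_def)
  finally show "(\<Sum>v\<in>A. max (of_bool (v = k) - of_bool (v = i) :: int) 0) \<le> int 1" by simp
  fix S assume S: "upset S" "S \<inter> {i, j, k} \<noteq> {}" "\<not> {i, j, k} \<subseteq> S"
  have "k \<in> S" "i \<notin> S" using S assms by (auto simp: upset_def)
  moreover have "finite S" using S(1) finite_A finite_subset by (auto simp: upset_def)
  ultimately show "1 \<le> (\<Sum>v\<in>S. of_bool (v = k) - of_bool (v = i) :: int)" using sum by simp
qed (use assms in auto)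

text \<open>The \<open>itself\<close> argument fixes the coefficient field, which the result type
  does not show.\<close>

definition depth_of_power :: "'k::field itself \<Rightarrow> nat \<Rightarrow> enat" where
  "depth_of_power _ t = depth (mpoly_ring n) (irrelevant_ideal n)
    (mon_quotient n (packing_exponents E t) :: ('k mpoly, 'k mpoly set) module)"

lemma sum_sides:
  fixes u :: "nat \<Rightarrow> nat"
  assumes "S \<subseteq> A"
  shows "sum u ((A - S) \<union> \<mu> ` S) = sum u (A - S) + (\<Sum>i\<in>S. u (\<mu> i))"
proof -
  have "finite S" using assms finite_A finite_subset by blast
  moreover have "inj_on \<mu> S"
    using matching assms by (auto simp: bij_betw_def intro: inj_on_subset)
  moreover have "(A - S) \<inter> \<mu> ` S = {}" using assms by auto
  ultimately show ?thesis using finite_A by (simp add: sum.union_disjoint sum.reindex)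
qed

lemma depth_of_power_le_1:
  assumes "separating A \<gamma> c" "t \<ge> Suc c"
  shows "depth_of_power TYPE('k::field) t \<le> 1"
proof -
  obtain a0 where a0: "a0 \<in> A" using A_nonempty by blast
  define s where "s = (\<Sum>i\<in>A. nat (\<gamma> i))"
  have int_nat: "int (nat x) = max x 0" for x by auto
  have sum_pos: "int s = (\<Sum>i\<in>A. max (\<gamma> i) 0)" by (simp add: s_def int_nat del: int_nat_eq)
  have "sum \<gamma> A = (\<Sum>i\<in>A. max (\<gamma> i) 0) - (\<Sum>i\<in>A. max (- \<gamma> i) 0)"
    unfolding sum_subtractf[symmetric] by (rule sum.cong) auto
  then have sum_neg: "int s = (\<Sum>i\<in>A. max (- \<gamma> i) 0)"
    using assms(1) sum_pos by (simp add: separating_def)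
  have sc: "s \<le> c" using assms(1) sum_pos by (simp add: separating_def)
  \<comment> \<open>The exponent must have degree \<open>t - 1\<close> on either side. The weight
    provides \<open>s\<close> of it, and \<open>k\<close> copies of the matching edge at
    \<open>a0\<close>, which every transversal cover meets once, provide the rest.\<close>
  define k where "k = t - Suc s"
  have t: "t = Suc s + k" using assms(2) sc by (simp add: k_def)
  define u0 where "u0 v = (if v \<in> A then nat (- \<gamma> v) else nat (\<gamma> (inv_into A \<mu> v)))" for v
  define u where "u v = (if v \<in> A \<union> B then u0 v + k * of_bool (v = a0 \<or> v = \<mu> a0) else 0)" for v
  have finu: "finite {v. u v \<noteq> 0}"
    by (rule finite_subset[of _ "A \<union> B"]) (auto simp: u_def finite_A finite_B)
  define e where "e = Poly_Mapping.Abs_poly_mapping u"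
  have e: "lookup e = u" using finu by (simp add: e_def)
  have inv: "inv_into A \<mu> (\<mu> i) = i" if "i \<in> A" for i
    using that matching by (intro inv_into_f_f) (auto simp: bij_betw_def)
  \<comment> \<open>The cover of an up-closed set has weight \<open>t - 1 + sum \<gamma> S\<close>.
    Only \<open>A\<close> (for \<open>S = {}\<close>) and \<open>B\<close> (for
    \<open>S = A\<close>) fall short of \<open>t\<close>, both by 1, and one more variable from each
    side mends them.\<close>
  have weight: "int (sum u C) = int s + k + sum \<gamma> S" if S: "upset S" "C = (A - S) \<union> \<mu> ` S" for S C
  proof -
    have SA: "S \<subseteq> A" "finite S" using S(1) finite_A finite_subset by (auto simp: upset_def)
    have uA: "u i = nat (- \<gamma> i) + k * of_bool (i = a0)" if "i \<in> A" for i
      using that a0 by (auto simp: u_def u0_def)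
    have uB: "u (\<mu> i) = nat (\<gamma> i) + k * of_bool (i = a0)" if "i \<in> A" for i
      using that a0 \<mu>_notin_A[of i] \<mu>_in_B[of i] by (auto simp: u_def u0_def inv)
    have "sum u C = sum u (A - S) + (\<Sum>i\<in>S. u (\<mu> i))" unfolding S(2) by (rule sum_sides[OF SA(1)])
    also have "sum u (A - S) = (\<Sum>i\<in>A - S. nat (- \<gamma> i) + k * of_bool (i = a0))"
      by (rule sum.cong) (auto simp: uA)
    also have "(\<Sum>i\<in>S. u (\<mu> i)) = (\<Sum>i\<in>S. nat (\<gamma> i) + k * of_bool (i = a0))"
      using SA by (intro sum.cong) (auto simp: uB)
    finally have "sum u C = (\<Sum>i\<in>A - S. nat (- \<gamma> i)) + (\<Sum>i\<in>S. nat (\<gamma> i))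
        + ((\<Sum>i\<in>A - S. k * of_bool (i = a0)) + (\<Sum>i\<in>S. k * of_bool (i = a0)))"
      by (simp add: sum.distrib)
    also have "(\<Sum>i\<in>A - S. k * of_bool (i = a0)) + (\<Sum>i\<in>S. k * of_bool (i = a0)) = k"
      using sum.subset_diff[OF SA(1) finite_A, of "\<lambda>i. k * of_bool (i = a0)"] finite_A a0
      by (simp add: of_bool_def if_distrib cong: if_cong)
    finally have "int (sum u C) = (\<Sum>i\<in>A - S. max (- \<gamma> i) 0) + (\<Sum>i\<in>S. max (\<gamma> i) 0) + k"
      by (simp add: int_nat del: int_nat_eq)
    also have "(\<Sum>i\<in>A - S. max (- \<gamma> i) 0) = int s - (\<Sum>i\<in>S. max (- \<gamma> i) 0)"
      unfolding sum_neg using sum.subset_diff[OF SA(1) finite_A, of "\<lambda>i. max (- \<gamma> i) 0"] by simp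
    also have "int s - (\<Sum>i\<in>S. max (- \<gamma> i) 0) + (\<Sum>i\<in>S. max (\<gamma> i) 0) = int s + sum \<gamma> S"
    proof -
      have "sum \<gamma> S = (\<Sum>i\<in>S. max (\<gamma> i) 0) - (\<Sum>i\<in>S. max (- \<gamma> i) 0)"
        unfolding sum_subtractf[symmetric] by (rule sum.cong) auto
      then show ?thesis by simp
    qed
    finally show ?thesis by simp
  qed
  have "int (sum u A) = int (s + k)"
    using weight[of "{}" A] by (simp add: upset_def del: of_nat_sum)
  then have wA: "sum u A = s + k" by linarith
  have "int (sum u B) = int (s + k)"
    using weight[of A B] assms(1) by (simp add: upset_def B_eq separating_def del: of_nat_sum)
  then have wB: "sum u B = s + k" by linarith
  have add: "sum (lookup (single a 1 + d)) C = of_bool (a \<in> C) + sum (lookup d) C"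
    if "C \<in> transversal_covers" for a d C
    using that by (intro sum_lookup_single_add finite_transversal_cover)
  show ?thesis
    unfolding depth_of_power_def
  proof (rule depth_le_1[OF up_closed_packing_exponents vertices])
    fix a b assume a: "a \<in> A" and b: "b \<in> B"
    have "t \<le> sum (lookup (single a 1 + (single b 1 + e))) C" if C: "C \<in> transversal_covers" for C
    proof -
      obtain S where S: "upset S" "C = (A - S) \<union> \<mu> ` S" using transversal_cover_upset[OF C] by blast
      have "sum (lookup (single a 1 + (single b 1 + e))) C = of_bool (a \<in> C) + of_bool (b \<in> C) + sum u C"
        by (simp only: add[OF C] e add.assoc)
      moreover consider "S = {}" | "S = A" | "S \<noteq> {}" "\<not> A \<subseteq> S" "S \<inter> A \<noteq> {}"
        using S(1) by (auto simp: upset_def)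
      then have "t \<le> of_bool (a \<in> C) + of_bool (b \<in> C) + sum u C"
      proof cases
        case 1
        then show ?thesis using S(2) a wA t by simp
      next
        case 2
        then show ?thesis using S(2) b wB t by (simp add: B_eq[symmetric])
      next
        case 3
        then have "sum \<gamma> S \<ge> 1" using assms(1) S(1) by (auto simp: separating_def)
        then have "int t \<le> int (sum u C)" using weight[OF S] t by simp
        then show ?thesis by linarith
      qed
      ultimately show ?thesis by simp
    qed
    then show "single a 1 + (single b 1 + e) \<in> packing_exponents E t"
      by (simp add: packing_exponents_def packs_iff)
  next
    show "a0 \<in> A" by fact
    show "\<mu> a0 \<in> B" using a0 by simp
    have "sum (lookup (single a0 1 + e)) B < t"
      unfolding add[OF transversal_cover_B] e wB t using a0 disjoint by auto
    then show "single a0 1 + e \<notin> packing_exponents E t"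
      unfolding packing_exponents_def mem_Collect_eq packs_iff using transversal_cover_B not_le by blast
    have "sum (lookup (single (\<mu> a0) 1 + e)) A < t"
      unfolding add[OF transversal_cover_A] e wA t using a0 by simp
    then show "single (\<mu> a0) 1 + e \<notin> packing_exponents E t"
      unfolding packing_exponents_def mem_Collect_eq packs_iff using transversal_cover_A not_le by blast
    show "e \<in> exponents n"
      unfolding exponents_def mem_Collect_eq vertices[symmetric]
    proof
      fix v assume "v \<in> keys e"
      then have "u v \<noteq> 0" by (simp add: in_keys_iff e)
      then show "v \<in> A \<union> B" by (metis u_def)
    qed
  qed
qed

lemma zero_notin_packing_exponents: "t > 0 \<Longrightarrow> 0 \<notin> packing_exponents E t"
  unfolding packing_exponents_def mem_Collect_eq packs_iff using transversal_cover_A by fastforce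

lemma matching_binomial:
  assumes "a \<in> A" "{x, y} = {a, \<mu> a}"
  shows "var x - var y \<in> (irrelevant_ideal n :: 'k::field mpoly set)"
    and "nonzerodivisor_mod n (mon_ideal n (packing_exponents E t) :: 'k mpoly set) (var x - var y)"
proof -
  have "x \<in> A \<union> B" "y \<in> A \<union> B" using assms by (auto simp: doubleton_eq_iff)
  then have "x \<in> {1..n}" "y \<in> {1..n}" by (simp_all only: vertices)
  then have "var x \<in> (irrelevant_ideal n :: 'k mpoly set)" "var y \<in> (irrelevant_ideal n :: 'k mpoly set)"
    by (auto simp: irrelevant_ideal_eq mon_ideal_def var_def)
  then show "var x - var y \<in> (irrelevant_ideal n :: 'k mpoly set)"
    unfolding irrelevant_ideal_eq by (rule mon_ideal_diff)
  show "nonzerodivisor_mod n (mon_ideal n (packing_exponents E t) :: 'k mpoly set) (var x - var y)"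
  proof (rule binomial_nonzerodivisor)
    show "e \<in> packing_exponents E t \<longleftrightarrow> (\<forall>C\<in>transversal_covers. t \<le> sum (lookup e) C)" for e
      by (simp add: packing_exponents_def packs_iff)
    show "finite C \<and> (x \<in> C \<longleftrightarrow> y \<notin> C)" if "C \<in> transversal_covers" for C
      using that assms finite_transversal_cover[OF that] by (auto simp: transversal_covers_def doubleton_eq_iff)
  qed
qed

lemma depth_of_power_ge_1:
  assumes "t > 0"
  shows "1 \<le> depth_of_power TYPE('k::field) t"
proof -
  obtain a where a: "a \<in> A" using A_nonempty by blast
  note ab = matching_binomial[OF a refl, where 'k = 'k]
  have "regular_sequence (mpoly_ring n) (mon_quotient n (packing_exponents E t)) [var a - var (\<mu> a) :: 'k mpoly]"
    by (rule regular_sequence_mon_quotientI(1)[OF up_closed_packing_exponents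
          zero_notin_packing_exponents[OF assms] ab])
  from depth_ge[OF this] ab(1) show ?thesis by (simp add: depth_of_power_def one_enat_def)
qed

end

section \<open>Cycles and leaves\<close>

lemma pcas_fst_snd: "pcas u p v \<Longrightarrow> map fst p @ [v] = u # map snd p"
  by (induction p arbitrary: u) auto

lemma closed_pcas:
  assumes "pcas u p u"
  shows "mset (map fst p) = mset (map snd p)" and "set (map fst p) = set (map snd p)"
    and "distinct (map snd p) \<Longrightarrow> distinct (map fst p)"
proof -
  have "mset (map fst p @ [u]) = mset (u # map snd p)" using pcas_fst_snd[OF assms] by (rule arg_cong)
  then show *: "mset (map fst p) = mset (map snd p)" by simp
  show "set (map fst p) = set (map snd p)" by (metis "*" set_mset_mset)
  show "distinct (map snd p) \<Longrightarrow> distinct (map fst p)" by (metis "*" mset_eq_imp_distinct_iff)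
qed

text \<open>A cycle visits each of its vertices once as a tail and once as a head.\<close>

lemma closed_pcas_double_sum:
  fixes \<tau> :: "'a \<Rightarrow> int"
  assumes "pcas u p u" "distinct (map snd p)"
  shows "(\<Sum>e\<leftarrow>p. \<tau> (fst e) + \<tau> (snd e)) = 2 * sum \<tau> (set (map snd p))"
proof -
  have "(\<Sum>e\<leftarrow>p. \<tau> (fst e) + \<tau> (snd e)) = sum_list (map \<tau> (map fst p)) + sum_list (map \<tau> (map snd p))"
    by (induction p) auto
  also have "sum_list (map \<tau> (map fst p)) = sum_list (map \<tau> (map snd p))"
    using closed_pcas(1)[OF assms(1)] by (metis mset_map sum_mset_sum_list)
  also have "sum_list (map \<tau> (map snd p)) = sum \<tau> (set (map snd p))"
    using assms(2) by (rule sum_list_distinct_conv_sum_set)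
  finally show ?thesis by simp
qed

lemma pcas_constant:
  assumes "pcas u p v" "\<And>e. e \<in> set p \<Longrightarrow> \<rho> (fst e) = \<rho> (snd e)" "x \<in> set (map snd p)"
  shows "\<rho> x = \<rho> u"
  using assms
proof (induction p arbitrary: u)
  case (Cons e p)
  have "\<rho> (snd e) = \<rho> u" using Cons.prems(1) Cons.prems(2)[of e] by simp
  moreover have "\<rho> x = \<rho> (snd e)" if "x \<in> set (map snd p)"
    by (rule Cons.IH[OF _ _ that]) (use Cons.prems(1,2) in auto)
  ultimately show ?case using Cons.prems(3) by auto
qed simp

text \<open>If the arcs into and out of \<open>v\<close> had the same other end \<open>w\<close>,
  each would be the cyclic successor of the other, which forces length at most 2.\<close>

lemma cycle_two_neighbours:
  assumes p: "pcas u p u" "distinct (map snd p)" "length p \<ge> 3" and v: "v \<in> set (map snd p)"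
  shows "\<exists>w'. w' \<noteq> w \<and> ((v, w') \<in> set p \<or> (w', v) \<in> set p)"
proof (rule ccontr)
  assume no: "\<not> ?thesis"
  let ?q = "length p"
  have "(w, v) \<in> set p" using no v by force
  then obtain b where b: "b < ?q" "p ! b = (w, v)" by (metis in_set_conv_nth)
  have "v \<in> set (map fst p)" using closed_pcas(2)[OF p(1)] v by simp
  then have "(v, w) \<in> set p" using no by force
  then obtain a where a: "a < ?q" "p ! a = (v, w)" by (metis in_set_conv_nth)
  have next_fst: "fst (p ! (if Suc k = ?q then 0 else Suc k)) = snd (p ! k)" if "k < ?q" for k
  proof -
    have eq: "(map fst p @ [u]) ! Suc k = (u # map snd p) ! Suc k" "(map fst p @ [u]) ! 0 = (u # map snd p) ! 0"
      by (simp_all only: pcas_fst_snd[OF p(1)])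
    have "p \<noteq> []" using that by auto
    then show ?thesis using eq that by (auto simp: nth_append)
  qed
  have inj: "k = l" if "k < ?q" "l < ?q" "fst (p ! k) = fst (p ! l)" for k l
    using closed_pcas(3)[OF p(1,2)] that by (metis distinct_conv_nth length_map nth_map)
  have "(if Suc a = ?q then 0 else Suc a) = b"
    using next_fst[OF a(1)] a b p(3) by (intro inj) auto
  moreover have "(if Suc b = ?q then 0 else Suc b) = a"
    using next_fst[OF b(1)] a b p(3) by (intro inj) auto
  ultimately show False using p(3) by (auto split: if_splits)
qed

lemma pcas_zip:
  "ys \<noteq> [] \<Longrightarrow> pcas (hd ys) (zip ys (tl ys @ [w])) w"
proof (induction ys)
  case (Cons y ys)
  then show ?case by (cases ys) auto
qed simp

lemma successively_imp_zip:
  assumes "successively R ys" "ys \<noteq> []" "R (last ys) w" "e \<in> set (zip ys (tl ys @ [w]))"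
  shows "R (fst e) (snd e)"
  using assms
proof (induction ys)
  case (Cons y ys)
  then show ?case by (cases ys) auto
qed simp

text \<open>A leaf is found at an end of a longest path: a second neighbour on the path would close a cycle.\<close>

lemma exists_peelable:
  assumes S: "finite S" "x \<in> S" "S \<noteq> {x}" and R: "\<And>a. \<not> R a a" "\<And>a b. R a b \<Longrightarrow> R b a"
    and acyclic: "\<And>u p. pcas u p u \<Longrightarrow> distinct (map snd p) \<Longrightarrow> length p \<ge> 3 \<Longrightarrow>
      set (map snd p) \<subseteq> S \<Longrightarrow> \<exists>e\<in>set p. \<not> R (fst e) (snd e)"
  shows "\<exists>j\<in>S - {x}. \<exists>i. \<forall>a\<in>S. R j a \<longrightarrow> a = i"
proof -
  define P where "P ys \<longleftrightarrow> distinct ys \<and> set ys \<subseteq> S \<and> successively R ys \<and> length ys \<ge> 2" for ys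
  show ?thesis
  proof (cases "\<exists>ys. P ys")
    case False
    obtain j where j: "j \<in> S - {x}" using S(2,3) by blast
    have "\<not> R j a" if "a \<in> S" for a
    proof
      assume "R j a"
      then have "P [j, a]" using that j R(1) by (auto simp: P_def)
      then show False using False by blast
    qed
    then show ?thesis using j by blast
  next
    case True
    have bounded: "length ys \<le> card S" if "P ys" for ys
      using that S(1) by (metis P_def card_mono distinct_card)
    obtain zs where zs: "P zs" "\<And>ys. P ys \<Longrightarrow> length ys \<le> length zs"
    proof -
      obtain ys0 where "P ys0" using True by blast
      then have "\<exists>x. P x \<and> (\<forall>y. P y \<longrightarrow> length y \<le> length x)"
        using ex_has_greatest_nat[of P ys0 length "Suc (card S)"] bounded by (simp add: less_Suc_eq_le)
      then show ?thesis using that by blast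
    qed
    \<comment> \<open>Either end of a longest path would serve, and at most one of them is
      \<open>x\<close>.\<close>
    obtain ys where ys: "P ys" "\<And>xs. P xs \<Longrightarrow> length xs \<le> length ys" "hd ys \<noteq> x"
    proof (cases "hd zs = x")
      case True
      have "successively R (rev zs)"
        using zs(1) R(2) by (auto simp: P_def successively_rev elim!: successively_mono)
      then have "P (rev zs)" using zs(1) by (simp add: P_def)
      moreover have "hd (rev zs) \<noteq> x"
      proof -
        obtain a b cs where abc: "zs = a # b # cs"
          using zs(1) by (cases zs; cases "tl zs") (auto simp: P_def)
        have "last zs \<in> set (b # cs)" unfolding abc using last_in_set[of "b # cs"] by simp
        moreover have "x \<notin> set (b # cs)" using zs(1) True by (auto simp: P_def abc)
        ultimately show ?thesis unfolding hd_rev by metis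
      qed
      ultimately show ?thesis using that[of "rev zs"] zs(2) by auto
    qed (use that zs in blast)
    obtain j i cs where jcs: "ys = j # i # cs"
      using ys(1) by (cases ys; cases "tl ys") (auto simp: P_def)
    have "a = i" if a: "a \<in> S" "R j a" for a
    proof (rule ccontr)
      assume "a \<noteq> i"
      have "a \<in> set ys"
      proof (rule ccontr)
        assume "a \<notin> set ys"
        then have "P (a # ys)" using ys(1) a R(2) by (auto simp: P_def jcs)
        then show False using ys(2)[of "a # ys"] by simp
      qed
      moreover have "a \<noteq> j" using a(2) R(1) by blast
      ultimately have "a \<in> set cs" using \<open>a \<noteq> i\<close> by (simp add: jcs)
      then obtain us vs where cs: "cs = us @ a # vs" by (auto simp: in_set_conv_decomp)
      define ws where "ws = j # i # us @ [a]"
      have yws: "ys = ws @ vs" by (simp add: ws_def jcs cs)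
      have ws: "distinct ws" "set ws \<subseteq> S" "successively R ws" "length ws \<ge> 3"
        using ys(1) unfolding P_def yws successively_append_iff by (simp_all add: ws_def)
      define p where "p = zip ws (tl ws @ [j])"
      have snd: "map snd p = tl ws @ [j]" by (simp add: p_def ws_def)
      have "pcas j p j" using pcas_zip[of ws j] by (simp add: p_def ws_def)
      moreover have "distinct (map snd p)" "set (map snd p) \<subseteq> S" using ws unfolding snd by (auto simp: ws_def)
      moreover have "length p \<ge> 3" using ws(4) by (simp add: p_def ws_def)
      ultimately obtain e where e: "e \<in> set p" "\<not> R (fst e) (snd e)" using acyclic by blast
      have "R (last ws) j" using a(2) R(2) by (simp add: ws_def)
      then show False using successively_imp_zip[OF ws(3), of j e] e by (simp add: p_def ws_def)
    qed
    moreover have "j \<in> S - {x}" using ys(1,3) by (simp add: P_def jcs)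
    ultimately show ?thesis by blast
  qed
qed

context matched_bipartite
begin

lemma adjacent_A_iff: "a \<in> A \<Longrightarrow> adjacent E a b \<longleftrightarrow> (a, b) \<in> E"
  using edges disjoint by (auto simp: adjacent_def)

lemma adjacent_B_iff: "b \<in> B \<Longrightarrow> adjacent E b a \<longleftrightarrow> (a, b) \<in> E"
  using edges disjoint by (auto simp: adjacent_def)

lemma adjacent_cases:
  assumes "adjacent E v w"
  obtains i j where "i \<in> A" "j \<in> A" "(i, \<mu> j) \<in> E" "{v, w} = {i, \<mu> j}"
proof -
  have "(v, w) \<in> E \<or> (w, v) \<in> E" using assms by (simp add: adjacent_def)
  then show ?thesis
  proof
    assume vw: "(v, w) \<in> E"
    then obtain j where "j \<in> A" "w = \<mu> j" "v \<in> A" using edges B_eq by auto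
    then show ?thesis using vw that by blast
  next
    assume wv: "(w, v) \<in> E"
    then obtain j where "j \<in> A" "v = \<mu> j" "w \<in> A" using edges B_eq by auto
    then show ?thesis using wv that by blast
  qed
qed

text \<open>Excludes chains \<open>k\<close>, \<open>i\<close>, \<open>j\<close> and, with
  \<open>j = k\<close>, equivalent elements. Every element is then minimal or maximal, so every
  matching edge has a leaf.\<close>

definition flat :: bool where
  "flat \<longleftrightarrow> (\<forall>i\<in>A. \<forall>j\<in>A - {i}. \<forall>k\<in>A - {i}. \<not> ((k, \<mu> i) \<in> E \<and> (i, \<mu> j) \<in> E))"

definition has_cycle :: bool where
  "has_cycle \<longleftrightarrow> (\<exists>u p. pcas u p u \<and> distinct (map snd p) \<and> length p \<ge> 3 \<and>
    (\<forall>e\<in>set p. adjacent E (fst e) (snd e)))"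

text \<open>A spanning tree on \<open>X\<close> would need degree \<open>card X - 1\<close>. The
  bound \<open>c + 2 \<le> card X\<close> is thus the saving of one edge, and
  \<open>separating_A\<close> carries it over to all of \<open>A\<close>.\<close>

lemma not_flat_separating:
  assumes "\<not> flat"
  shows "\<exists>X \<gamma> c. separating X \<gamma> c \<and> X \<noteq> {} \<and> c + 2 \<le> card X"
proof -
  obtain i j k where ijk: "i \<in> A" "j \<in> A" "k \<in> A" "j \<noteq> i" "k \<noteq> i" "(k, \<mu> i) \<in> E" "(i, \<mu> j) \<in> E"
    using assms by (auto simp: flat_def)
  show ?thesis
  proof (cases "j = k")
    case True
    then have "separating {i, j} (\<lambda>_. 0) 0" using ijk by (intro separating_equivalent) auto
    moreover have "card {i, j} = 2" using ijk by simp
    ultimately show ?thesis by (metis insert_not_empty add_0 order_refl)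
  next
    case False
    then have "separating {k, i, j} (\<lambda>v. of_bool (v = j) - of_bool (v = k)) 1"
      using ijk by (intro separating_chain) auto
    moreover have "card {k, i, j} = 3" using ijk False by simp
    ultimately show ?thesis by (intro exI conjI) (assumption, auto)
  qed
qed

lemma sum_vertices:
  fixes F :: "nat \<Rightarrow> int"
  assumes "W \<subseteq> A \<union> B"
  shows "sum F W = (\<Sum>i\<in>A. of_bool (i \<in> W) * F i + of_bool (\<mu> i \<in> W) * F (\<mu> i))"
proof -
  have "sum F W = (\<Sum>v\<in>A \<union> B. of_bool (v \<in> W) * F v)"
    using assms finite_A finite_B by (intro sum.mono_neutral_cong_left) auto
  also have "\<dots> = (\<Sum>i\<in>A. of_bool (i \<in> W) * F i) + (\<Sum>v\<in>B. of_bool (v \<in> W) * F v)"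
    using finite_A finite_B disjoint by (rule sum.union_disjoint)
  also have "(\<Sum>v\<in>B. of_bool (v \<in> W) * F v) = (\<Sum>i\<in>A. of_bool (\<mu> i \<in> W) * F (\<mu> i))"
    using matching by (rule sum.reindex_bij_betw[symmetric])
  finally show ?thesis by (simp add: sum.distrib)
qed

text \<open>The weight is 1 where the cycle passes \<open>\<mu> i\<close> and -1 where it passes
  \<open>i\<close>. Its sum over \<open>S\<close> is half the sum of
  \<open>of_bool (j \<in> S) - of_bool (i \<in> S)\<close> over the cycle edges
  \<open>{i, \<mu> j}\<close>; for up-closed \<open>S\<close> no summand is negative, and one is
  positive if \<open>S\<close> splits \<open>X\<close>. By flatness the \<open>2 * c\<close>
  vertices of the cycle belong to different elements of \<open>A\<close>, and
  \<open>c \<ge> 2\<close> gives the saving.\<close>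

lemma flat_cycle_separating:
  assumes flat has_cycle
  shows "\<exists>X \<gamma> c. separating X \<gamma> c \<and> X \<noteq> {} \<and> c + 2 \<le> card X"
proof -
  obtain u p where p: "pcas u p u" "distinct (map snd p)" "length p \<ge> 3"
    and adj: "\<And>e. e \<in> set p \<Longrightarrow> adjacent E (fst e) (snd e)"
    using assms(2) unfolding has_cycle_def by blast
  define W where "W = set (map snd p)"
  have W: "W \<subseteq> A \<union> B"
  proof
    fix v assume "v \<in> W"
    then obtain e where "e \<in> set p" "v = snd e" by (auto simp: W_def)
    then show "v \<in> A \<union> B" using adj[of e] edges by (auto simp: adjacent_def)
  qed
  have Wp: "fst e \<in> W" "snd e \<in> W" if "e \<in> set p" for e
    using that closed_pcas(2)[OF p(1)] by (auto simp: W_def)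
  have two: "\<exists>w'. w' \<noteq> w \<and> adjacent E v w'" if "v \<in> W" for v w
    using cycle_two_neighbours[OF p, of v w] that adj unfolding W_def[symmetric]
    by (metis adjacent_commute fst_conv snd_conv)
  \<comment> \<open>Each vertex of the cycle has a neighbour other than its matching partner, so
    \<open>i\<close> and \<open>\<mu> i\<close> together would produce elements above and below
    \<open>i\<close>.\<close>
  have excl: "\<not> (i \<in> W \<and> \<mu> i \<in> W)" if i: "i \<in> A" for i
  proof
    assume iW: "i \<in> W \<and> \<mu> i \<in> W"
    obtain w where w: "w \<noteq> \<mu> i" "(i, w) \<in> E" using two[of i "\<mu> i"] iW adjacent_A_iff[OF i] by blast
    then obtain j where j: "j \<in> A" "w = \<mu> j" using edges B_eq by auto
    obtain k where k: "k \<noteq> i" "(k, \<mu> i) \<in> E"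
      using two[of "\<mu> i" i] iW adjacent_B_iff[OF \<mu>_in_B[OF i]] by blast
    have "k \<in> A" using k edges by auto
    then show False using assms(1) i j k w unfolding flat_def by blast
  qed
  define \<gamma> :: "nat \<Rightarrow> int" where
    "\<gamma> i = (if i \<in> A then of_bool (\<mu> i \<in> W) - of_bool (i \<in> W) else 0)" for i
  define X where "X = {i\<in>A. i \<in> W \<or> \<mu> i \<in> W}"
  \<comment> \<open>Spreads the weight over the vertices: the total over \<open>W\<close> is
    \<open>sum \<gamma> S\<close>, while the two ends of an edge \<open>{i, \<mu> j}\<close>
    contribute \<open>of_bool (j \<in> S) - of_bool (i \<in> S)\<close>. Vertices can thus be
    counted through arcs.\<close>
  define \<tau> :: "nat set \<Rightarrow> nat \<Rightarrow> int" where
    "\<tau> S v = (if v \<in> A then - of_bool (v \<in> S) else of_bool (v \<in> \<mu> ` S))" for S v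
  have \<tau>\<mu>: "\<tau> S (\<mu> i) = of_bool (i \<in> S)" if "i \<in> A" "S \<subseteq> A" for S i
    using that by (auto simp: \<tau>_def)
  have sum_\<tau>: "sum (\<tau> S) W = sum \<gamma> S" if S: "S \<subseteq> A" for S
  proof -
    have "sum (\<tau> S) W = (\<Sum>i\<in>A. of_bool (i \<in> W) * \<tau> S i + of_bool (\<mu> i \<in> W) * \<tau> S (\<mu> i))"
      by (rule sum_vertices[OF W])
    also have "\<dots> = (\<Sum>i\<in>A. if i \<in> S then \<gamma> i else 0)"
      using S by (intro sum.cong) (auto simp: \<tau>\<mu> \<tau>_def \<gamma>_def)
    also have "\<dots> = sum \<gamma> (A \<inter> S)" by (rule sum.inter_restrict[OF finite_A, symmetric])
    finally show ?thesis using S by (simp add: Int_absorb1)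
  qed
  have arcs: "(\<Sum>e\<leftarrow>p. \<tau> S (fst e) + \<tau> S (snd e)) = 2 * sum \<gamma> S" if "S \<subseteq> A" for S
    using closed_pcas_double_sum[OF p(1,2)] sum_\<tau>[OF that] by (simp add: W_def)
  have arc: "\<tau> S (fst e) + \<tau> S (snd e) = of_bool (j \<in> S) - of_bool (i \<in> S)"
    if "i \<in> A" "j \<in> A" "{fst e, snd e} = {i, \<mu> j}" "S \<subseteq> A" for S e i j
    using that by (auto simp: \<tau>\<mu> doubleton_eq_iff) (auto simp: \<tau>_def)
  have sum_A: "sum \<gamma> A = 0"
  proof -
    have "\<tau> A (fst e) + \<tau> A (snd e) = 0" if e: "e \<in> set p" for e
    proof -
      obtain i j where "i \<in> A" "j \<in> A" "{fst e, snd e} = {i, \<mu> j}"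
        using adjacent_cases[OF adj[OF e]] by metis
      then show ?thesis using arc[of i j e A] by simp
    qed
    then have "(\<Sum>e\<leftarrow>p. \<tau> A (fst e) + \<tau> A (snd e)) = (\<Sum>e\<leftarrow>p. 0)"
      by (intro arg_cong[where f = sum_list] map_cong) auto
    then show ?thesis using arcs[of A] by simp
  qed
  define c where "c = (\<Sum>i\<in>A. of_bool (\<mu> i \<in> W) :: nat)"
  define a where "a = (\<Sum>i\<in>A. of_bool (i \<in> W) :: nat)"
  have "int c - int a = sum \<gamma> A" by (simp add: c_def a_def \<gamma>_def sum_subtractf)
  then have ac: "a = c" using sum_A by simp
  have "int (card W) = sum (\<lambda>_. 1) W" by simp
  also have "\<dots> = int (a + c)" unfolding sum_vertices[OF W] by (simp add: a_def c_def sum.distrib)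
  finally have "card W = a + c" by linarith
  moreover have "card W = length p" using p(2) distinct_card by (fastforce simp: W_def)
  ultimately have c2: "c \<ge> 2" using p(3) ac by linarith
  have "A \<inter> {i. i \<in> X} = X" by (auto simp: X_def)
  then have "card X = (\<Sum>i\<in>A. of_bool (i \<in> X))"
    using finite_A by (simp add: of_bool_def sum.If_cases)
  also have "\<dots> = (\<Sum>i\<in>A. of_bool (i \<in> W) + of_bool (\<mu> i \<in> W))"
    using excl by (intro sum.cong) (auto simp: X_def)
  also have "\<dots> = a + c" by (simp add: a_def c_def sum.distrib)
  finally have cardX: "card X = a + c" .
  have "separating X \<gamma> c"
    unfolding separating_def
  proof (intro conjI allI impI)
    show "X \<subseteq> A" by (auto simp: X_def)
    show "\<gamma> i = 0" if "i \<notin> X" for i using that by (auto simp: X_def \<gamma>_def)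
    show "sum \<gamma> A = 0" by (rule sum_A)
    have "(\<Sum>i\<in>A. max (\<gamma> i) 0) \<le> (\<Sum>i\<in>A. of_bool (\<mu> i \<in> W))" by (rule sum_mono) (auto simp: \<gamma>_def)
    then show "(\<Sum>i\<in>A. max (\<gamma> i) 0) \<le> int c" by (simp add: c_def)
    fix S assume S: "upset S" "S \<inter> X \<noteq> {}" "\<not> X \<subseteq> S"
    have SA: "S \<subseteq> A" using S(1) by (simp add: upset_def)
    have nonneg: "\<tau> S (fst e) + \<tau> S (snd e) \<ge> 0" if e: "e \<in> set p" for e
    proof -
      obtain i j where ij: "i \<in> A" "j \<in> A" "(i, \<mu> j) \<in> E" "{fst e, snd e} = {i, \<mu> j}"
        using adjacent_cases[OF adj[OF e]] by metis
      then have "i \<in> S \<longrightarrow> j \<in> S" using S(1) by (auto simp: upset_def)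
      then show ?thesis using arc[OF ij(1,2,4) SA] by auto
    qed
    have "\<exists>e\<in>set p. \<tau> S (fst e) + \<tau> S (snd e) \<noteq> 0"
    proof (rule ccontr)
      assume zero: "\<not> ?thesis"
      \<comment> \<open>Tells whether the matching edge of a vertex belongs to \<open>S\<close>. If
        no arc gained, this would be constant along the cycle, and \<open>S\<close> could not split
        \<open>X\<close>.\<close>
      define \<rho> where "\<rho> v \<longleftrightarrow> v \<in> S \<union> \<mu> ` S" for v
      have \<rho>\<mu>: "\<rho> (\<mu> i) \<longleftrightarrow> i \<in> S" "\<rho> i \<longleftrightarrow> i \<in> S" if "i \<in> A" for i
        using that SA \<mu>_notin_A by (auto simp: \<rho>_def)
      have arc_const: "\<rho> (fst e) = \<rho> (snd e)" if e: "e \<in> set p" for e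
      proof -
        obtain i j where ij: "i \<in> A" "j \<in> A" "(i, \<mu> j) \<in> E" "{fst e, snd e} = {i, \<mu> j}"
          using adjacent_cases[OF adj[OF e]] by metis
        then have "i \<in> S \<longleftrightarrow> j \<in> S" using arc[OF ij(1,2,4) SA] zero e by (auto split: if_splits)
        then show ?thesis using ij(4) \<rho>\<mu>(1)[OF ij(2)] \<rho>\<mu>(2)[OF ij(1)] by (auto simp: doubleton_eq_iff)
      qed
      have const: "\<rho> v = \<rho> u" if "v \<in> W" for v
        by (rule pcas_constant[OF p(1) arc_const]) (use that in \<open>simp_all add: W_def\<close>)
      have "i \<in> S \<longleftrightarrow> \<rho> u" if "i \<in> X" for i
      proof -
        have "i \<in> A" "i \<in> W \<or> \<mu> i \<in> W" using that by (auto simp: X_def)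
        then show ?thesis using const \<rho>\<mu> by blast
      qed
      then show False using S(2,3) by blast
    qed
    moreover have "x \<ge> 0" if "x \<in> set (map (\<lambda>e. \<tau> S (fst e) + \<tau> S (snd e)) p)" for x
      using that nonneg by auto
    ultimately have "(\<Sum>e\<leftarrow>p. \<tau> S (fst e) + \<tau> S (snd e)) \<noteq> 0"
      by (subst sum_list_nonneg_eq_0_iff) auto
    moreover have "(\<Sum>e\<leftarrow>p. \<tau> S (fst e) + \<tau> S (snd e)) \<ge> 0"
      using nonneg by (intro sum_list_nonneg) auto
    ultimately show "1 \<le> sum \<gamma> S" using arcs[OF SA] by linarith
  qed
  moreover have "X \<noteq> {}" using cardX c2 by auto
  ultimately show ?thesis using cardX ac c2 by (intro exI conjI) (assumption+, linarith)
qed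

lemma depth_of_power_le_1_if_not_flat_tree:
  assumes "\<not> (flat \<and> \<not> has_cycle)"
  shows "card A \<ge> 2" and "t \<ge> card A - 1 \<Longrightarrow> depth_of_power TYPE('k::field) t \<le> 1"
proof -
  obtain X \<gamma> c where X: "separating X \<gamma> c" "X \<noteq> {}" "c + 2 \<le> card X"
    using assms not_flat_separating flat_cycle_separating by blast
  have "card X \<le> card A" using X(1) finite_A by (intro card_mono) (auto simp: separating_def)
  then show "card A \<ge> 2" using X(3) by linarith
  assume "t \<ge> card A - 1"
  then have "t \<ge> Suc (c + (card A - card X))" using X(3) \<open>card X \<le> card A\<close> by linarith
  then show "depth_of_power TYPE('k::field) t \<le> 1"
    using separating_A[OF X(1,2)] depth_of_power_le_1 by blast
qed

lemma depth_of_power_le_1_general: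
  assumes "t \<ge> card A"
  shows "depth_of_power TYPE('k::field) t \<le> 1"
proof -
  obtain a where a: "a \<in> A" using A_nonempty by blast
  then have "card A > 0" using finite_A card_gt_0_iff by blast
  then show ?thesis
    using separating_A[OF separating_singleton[OF a]] depth_of_power_le_1 assms by fastforce
qed

section \<open>Leaves and matching edges\<close>

definition graph_leaves :: "nat set" where
  "graph_leaves = {v \<in> A \<union> B. \<exists>!w. adjacent E v w}"

lemma leaf_iff:
  assumes "i \<in> A"
  shows "i \<in> graph_leaves \<longleftrightarrow> \<not> (\<exists>j\<in>A - {i}. (i, \<mu> j) \<in> E)"
    and "\<mu> i \<in> graph_leaves \<longleftrightarrow> \<not> (\<exists>k\<in>A - {i}. (k, \<mu> i) \<in> E)"
proof -
  have E: "(i, w) \<in> E \<longleftrightarrow> (\<exists>j\<in>A. w = \<mu> j \<and> (i, \<mu> j) \<in> E)" for w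
    using edges B_eq by auto
  have "i \<in> graph_leaves \<longleftrightarrow> (\<exists>!w. (i, w) \<in> E)"
    using assms by (simp add: graph_leaves_def Ex1_def adjacent_A_iff)
  also have "\<dots> \<longleftrightarrow> \<not> (\<exists>j\<in>A - {i}. (i, \<mu> j) \<in> E)"
  proof
    assume "\<exists>!w. (i, w) \<in> E"
    then have "\<mu> j = \<mu> i" if "(i, \<mu> j) \<in> E" for j
      using that matching_edge[OF assms] by blast
    then show "\<not> (\<exists>j\<in>A - {i}. (i, \<mu> j) \<in> E)" using assms \<mu>_eq_iff by blast
  next
    assume "\<not> (\<exists>j\<in>A - {i}. (i, \<mu> j) \<in> E)"
    then have "w = \<mu> i" if "(i, w) \<in> E" for w using that E by blast
    then show "\<exists>!w. (i, w) \<in> E" using matching_edge[OF assms] by blast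
  qed
  finally show "i \<in> graph_leaves \<longleftrightarrow> \<not> (\<exists>j\<in>A - {i}. (i, \<mu> j) \<in> E)" .
  have "\<mu> i \<in> graph_leaves \<longleftrightarrow> (\<exists>!w. (w, \<mu> i) \<in> E)"
    using assms by (simp add: graph_leaves_def Ex1_def adjacent_B_iff)
  also have "\<dots> \<longleftrightarrow> \<not> (\<exists>k\<in>A - {i}. (k, \<mu> i) \<in> E)"
    using edges matching_edge[OF assms] by blast
  finally show "\<mu> i \<in> graph_leaves \<longleftrightarrow> \<not> (\<exists>k\<in>A - {i}. (k, \<mu> i) \<in> E)" .
qed

text \<open>A matching edge with two leaves would be a connected component by itself, against
  \<open>linked\<close>.\<close>

lemma not_both_leaves:
  assumes "i \<in> A" "card A \<ge> 2"
  shows "\<not> (i \<in> graph_leaves \<and> \<mu> i \<in> graph_leaves)"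
proof -
  have "{i} \<noteq> A" using assms(2) by auto
  then show ?thesis using linked[of "{i}"] assms(1) leaf_iff[OF assms(1)] by auto
qed

definition pair_index :: "nat \<Rightarrow> nat" where
  "pair_index v = (if v \<in> A then v else inv_into A \<mu> v)"

lemma pair_index_simps [simp]:
  "i \<in> A \<Longrightarrow> pair_index i = i" "i \<in> A \<Longrightarrow> pair_index (\<mu> i) = i"
  using matching by (auto simp: pair_index_def bij_betw_def)

lemma vertex_cases:
  assumes "v \<in> A \<union> B"
  obtains "v \<in> A" | i where "i \<in> A" "v = \<mu> i"
  using assms B_eq by blast

text \<open>No matching edge has two leaves, so counting leaves is counting the matching edges that
  contain one.\<close>

lemma card_leaves_iff:
  assumes "card A \<ge> 2"
  shows "card graph_leaves = card A \<longleftrightarrow> (\<forall>i\<in>A. i \<in> graph_leaves \<or> \<mu> i \<in> graph_leaves)"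
proof -
  have LV: "graph_leaves \<subseteq> A \<union> B" by (auto simp: graph_leaves_def)
  have inj: "inj_on pair_index graph_leaves"
  proof (rule inj_onI)
    fix v w assume vw: "v \<in> graph_leaves" "w \<in> graph_leaves" "pair_index v = pair_index w"
    then have "v \<in> A \<union> B" "w \<in> A \<union> B" using LV by auto
    then show "v = w"
      using vw not_both_leaves[OF _ assms] by (elim vertex_cases) auto
  qed
  have sub: "pair_index ` graph_leaves \<subseteq> A"
    using LV by (auto elim!: vertex_cases[OF subsetD[OF LV]])
  have "card graph_leaves = card A \<longleftrightarrow> pair_index ` graph_leaves = A"
    using card_image[OF inj] card_subset_eq[OF finite_A sub] by auto
  also have "\<dots> \<longleftrightarrow> (\<forall>i\<in>A. i \<in> graph_leaves \<or> \<mu> i \<in> graph_leaves)"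
  proof
    assume eq: "pair_index ` graph_leaves = A"
    show "\<forall>i\<in>A. i \<in> graph_leaves \<or> \<mu> i \<in> graph_leaves"
    proof
      fix i assume "i \<in> A"
      then have "i \<in> pair_index ` graph_leaves" by (simp only: eq)
      then obtain v where v: "v \<in> graph_leaves" "pair_index v = i" by blast
      from subsetD[OF LV v(1)] show "i \<in> graph_leaves \<or> \<mu> i \<in> graph_leaves"
        by (cases rule: vertex_cases) (use v in auto)
    qed
  next
    assume *: "\<forall>i\<in>A. i \<in> graph_leaves \<or> \<mu> i \<in> graph_leaves"
    have "A \<subseteq> pair_index ` graph_leaves"
    proof
      fix i assume "i \<in> A"
      then show "i \<in> pair_index ` graph_leaves" using * pair_index_simps[of i] by (metis imageI)
    qed
    then show "pair_index ` graph_leaves = A" using sub by blast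
  qed
  finally show ?thesis .
qed

lemma flat_card_leaves:
  assumes flat "card A \<ge> 2"
  shows "card graph_leaves = card A"
  using assms leaf_iff unfolding card_leaves_iff[OF assms(2)] flat_def by blast

end

section \<open>Depth of powers for trees\<close>

context matched_bipartite
begin

text \<open>The merged vertex \<open>x\<close> is the root of the tree of non-leaves to which the peeling argument is applied.\<close>

lemma depth_of_power_ge_2:
  assumes acyclic: "\<not> has_cycle" and leaves: "card graph_leaves = card A"
    and A2: "card A \<ge> 2" and t: "0 < t" "t < card A"
  shows "2 \<le> depth_of_power TYPE('k::field) t"
proof -
  let ?L = graph_leaves
  define partner where "partner v = (if v \<in> A then \<mu> v else pair_index v)" for v
  have partner: "partner i = \<mu> i" "partner (\<mu> i) = i" if "i \<in> A" for i
    using that by (simp_all add: partner_def)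
  have one: "i \<in> ?L \<longleftrightarrow> \<mu> i \<notin> ?L" if "i \<in> A" for i
    using that leaves not_both_leaves[OF that A2] unfolding card_leaves_iff[OF A2] by blast
  have partner_AB: "partner v \<in> A \<union> B" "partner (partner v) = v" "adjacent E v (partner v)"
    "v \<in> ?L \<longleftrightarrow> partner v \<notin> ?L" if v: "v \<in> A \<union> B" for v
  proof -
    from v have "partner v \<in> A \<union> B \<and> partner (partner v) = v \<and> adjacent E v (partner v)
        \<and> (v \<in> ?L \<longleftrightarrow> partner v \<notin> ?L)"
    proof (cases rule: vertex_cases)
      case 1
      then show ?thesis using matching_edge[of v] one[of v] by (simp add: partner adjacent_def)
    next
      case (2 i)
      then show ?thesis using matching_edge[of i] one[of i] by (simp add: partner adjacent_def)
    qed
    then show "partner v \<in> A \<union> B" "partner (partner v) = v" "adjacent E v (partner v)"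
      "v \<in> ?L \<longleftrightarrow> partner v \<notin> ?L" by blast+
  qed
  have LV: "?L \<subseteq> A \<union> B" by (auto simp: graph_leaves_def)
  have leaf: "adjacent E v w \<longleftrightarrow> w = partner v" if "v \<in> ?L" for v w
    using that partner_AB(3)[of v] unfolding graph_leaves_def by blast
  have adj_irrefl: "\<not> adjacent E v v" for v
    using edges disjoint by (auto simp: adjacent_def)
  obtain a0 where a0: "a0 \<in> A" using A_nonempty by blast
  \<comment> \<open>The end that is not a leaf is kept and its leaf \<open>y\<close> is merged into
    it. The non-leaves stay in place, and only the root \<open>x\<close> trades its pendant vertex
    for a loop.\<close>
  define x where "x = (if a0 \<in> ?L then \<mu> a0 else a0)"
  define y where "y = partner x"
  have xy_eq: "{x, y} = {a0, \<mu> a0}" using a0 by (auto simp: x_def y_def partner)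
  have xV: "x \<in> A \<union> B" using a0 by (simp add: x_def)
  have xL: "x \<notin> ?L" using one[OF a0] by (simp add: x_def)
  have yV: "y \<in> A \<union> B" and yx: "partner y = x" and yL: "y \<in> ?L"
    using partner_AB[OF xV] xL by (simp_all add: y_def)
  have xy: "x \<noteq> y" using xL yL by blast
  define T where "T = (A \<union> B) - ?L"
  have card_T: "card T = card A"
  proof -
    have "card (A \<union> B) = card A + card B" using finite_A finite_B disjoint by (rule card_Un_disjoint)
    moreover have "card B = card A" using matching by (simp add: bij_betw_same_card)
    moreover have "card T = card (A \<union> B) - card ?L"
      unfolding T_def using LV finite_A finite_B by (intro card_Diff_subset) (auto intro: finite_subset)
    ultimately show ?thesis using leaves by simp
  qed
  define r where "r v = (if v = y then x else v)" for v
  let ?E' = "map_prod r r ` E"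
  have adj': "adjacent ?E' a b \<longleftrightarrow> (\<exists>a' b'. r a' = a \<and> r b' = b \<and> adjacent E a' b')" for a b
    by (fastforce simp: adjacent_def)
  have r_eq: "r a' = a \<longleftrightarrow> a' = a" if "a \<noteq> x" "a \<noteq> y" for a a'
    using that by (auto simp: r_def)
  have nbr: "\<exists>b'. r b' = b \<and> adjacent E a b'" if "adjacent ?E' a b" "a \<noteq> x" "a \<noteq> y" for a b
    using that by (auto simp: adj' r_eq)
  have socle: "packs ?E' t u"
    if u: "\<And>v. u v > 0 \<Longrightarrow> v \<in> (A \<union> B) - {y}"
      and all: "\<And>v. v \<in> (A \<union> B) - {y} \<Longrightarrow> packs ?E' t (\<lambda>w. u w + unit v w)" for u
  proof (rule ccontr)
    assume not: "\<not> packs ?E' t u"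
    have V: "T \<union> partner ` (T - {x}) = (A \<union> B) - {y}"
    proof (intro equalityI subsetI)
      fix v assume "v \<in> T \<union> partner ` (T - {x})"
      then show "v \<in> (A \<union> B) - {y}"
      proof
        assume "v \<in> T" then show ?thesis using yL by (auto simp: T_def)
      next
        assume "v \<in> partner ` (T - {x})"
        then obtain j where j: "j \<in> A \<union> B" "j \<noteq> x" "v = partner j" by (auto simp: T_def)
        then show ?thesis using partner_AB(1,2)[OF j(1)] yx by auto
      qed
    next
      fix v assume v: "v \<in> (A \<union> B) - {y}"
      then have vV: "v \<in> A \<union> B" by blast
      show "v \<in> T \<union> partner ` (T - {x})"
      proof (cases "v \<in> ?L")
        case True
        have "partner v \<noteq> x" using partner_AB(2)[OF vV] v y_def by auto
        then have "partner v \<in> T - {x}" using True partner_AB(1,4)[OF vV] by (auto simp: T_def)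
        then show ?thesis using partner_AB(2)[OF vV] by force
      qed (use vV in \<open>auto simp: T_def\<close>)
    qed
    have "card T \<le> t"
    proof (rule socle_power_ge[where z = x and w = partner and E = ?E' and u = u])
      show "finite T" using finite_A finite_B by (simp add: T_def)
      show "x \<in> T" using xV xL by (simp add: T_def)
    next
      fix j assume j: "j \<in> T - {x}"
      then have jV: "j \<in> A \<union> B" and jL: "j \<notin> ?L" and jy: "j \<noteq> y" using yL by (auto simp: T_def)
      have pL: "partner j \<in> ?L" using partner_AB(4)[OF jV] jL by blast
      have px: "partner j \<noteq> x" and py: "partner j \<noteq> y"
        using pL xL partner_AB(2)[OF jV] yx j by auto
      have "adjacent ?E' (partner j) a \<longleftrightarrow> a = j" for a
      proof
        assume "adjacent ?E' (partner j) a"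
        then obtain b' where b': "r b' = a" "adjacent E (partner j) b'" using nbr px py by blast
        then have "b' = j" using leaf[OF pL] partner_AB(2)[OF jV] by simp
        then show "a = j" using b'(1) jy by (simp add: r_def)
      next
        assume "a = j"
        moreover have "adjacent E (partner j) j" using partner_AB(3)[OF jV] by (simp add: adjacent_commute)
        moreover have "r (partner j) = partner j" "r j = j" using py jy by (simp_all add: r_def)
        ultimately show "adjacent ?E' (partner j) a" using adj' by blast
      qed
      then show "partner j \<notin> T \<and> (\<forall>a. adjacent ?E' (partner j) a \<longleftrightarrow> a = j)"
        using pL by (simp add: T_def)
      show "\<not> adjacent ?E' j j"
      proof
        assume "adjacent ?E' j j"
        then obtain b' where "r b' = j" "adjacent E j b'" using nbr[of j j] j jy by blast
        then show False using r_eq[of j b'] j jy adj_irrefl by simp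
      qed
    next
      fix S assume S: "S \<subseteq> T" "x \<in> S" "S \<noteq> {x}"
      \<comment> \<open>The vertex to peel is found in \<open>E\<close>, where acyclicity is known.
        Its neighbours within \<open>S\<close> are the same after merging, because the leaf
        \<open>y\<close> is adjacent to \<open>x\<close> only.\<close>
      have "\<exists>j\<in>S - {x}. \<exists>i. \<forall>a\<in>S. adjacent E j a \<longrightarrow> a = i"
      proof (rule exists_peelable)
        show "finite S" using S(1) finite_A finite_B by (auto simp: T_def intro: finite_subset)
        show "adjacent E b a" if "adjacent E a b" for a b using that by (simp add: adjacent_commute)
        show "\<exists>e\<in>set p. \<not> adjacent E (fst e) (snd e)"
          if "pcas u p u" "distinct (map snd p)" "3 \<le> length p" for u p
          using that acyclic unfolding has_cycle_def by blast
      qed (use S adj_irrefl in auto)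
      then obtain j i where ji: "j \<in> S - {x}" "\<And>a. a \<in> S \<Longrightarrow> adjacent E j a \<Longrightarrow> a = i" by blast
      have jy: "j \<noteq> y" using ji(1) S(1) yL by (auto simp: T_def)
      have "a = i" if a: "a \<in> S" "adjacent ?E' j a" for a
      proof -
        obtain b' where b': "r b' = a" "adjacent E j b'" using nbr[OF a(2)] ji(1) jy by blast
        have "b' \<noteq> y"
        proof
          assume "b' = y"
          then have "adjacent E y j" using b'(2) by (simp add: adjacent_commute)
          then show False using leaf[OF yL] yx ji(1) by simp
        qed
        then have "b' = a" using b'(1) by (simp add: r_def)
        then show ?thesis using ji(2) a(1) b'(2) by blast
      qed
      then show "\<exists>j\<in>S - {x}. \<exists>i. \<forall>a\<in>S. adjacent ?E' j a \<longrightarrow> a = i" using ji(1) by blast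
    next
      show "v \<in> T \<union> partner ` (T - {x})" if "u v > 0" for v unfolding V by (rule u[OF that])
      show "packs ?E' t (\<lambda>w. u w + unit v w)" if "v \<in> T \<union> partner ` (T - {x})" for v
        using that unfolding V by (rule all)
      show "\<not> packs ?E' t u" by (rule not)
    qed
    then show False using card_T t(2) by simp
  qed
  have xn: "x \<in> {1..n}" and yn: "y \<in> {1..n}" using xV yV by (simp_all only: vertices)
  have V_eq: "(A \<union> B) - {y} = {1..n} - {y}" by (simp only: vertices)
  note merge_iff = merge_packing_exponents[OF xy xn yn, folded r_def, where E = E and t = t]
  have "nonzerodivisor_mod2 n (mon_ideal n (packing_exponents E t) :: 'k mpoly set) (var x - var y)
      (\<Sum>v\<in>{1..n} - {y}. var v)"
  proof (rule sum_vars_nonzerodivisor_mod_binomial[OF xy xn yn up_closed_packing_exponents])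
    fix e assume e: "keys e \<subseteq> {1..n} - {y}"
      and all: "\<And>v. v \<in> {1..n} - {y} \<Longrightarrow> single v 1 + e \<in> merge x y ` (packing_exponents E t \<inter> exponents n)"
    have "packs ?E' t (lookup e)"
    proof (rule socle)
      show "v \<in> (A \<union> B) - {y}" if "lookup e v > 0" for v
      proof -
        have "v \<in> keys e" using that by (simp add: in_keys_iff)
        then show ?thesis using e unfolding V_eq by blast
      qed
      show "packs ?E' t (\<lambda>w. lookup e w + unit v w)" if v: "v \<in> (A \<union> B) - {y}" for v
      proof -
        have v': "v \<in> {1..n} - {y}" using v unfolding V_eq .
        have "keys (single v 1 + e) \<subseteq> {1..n} - {y}"
          using keys_add[of "single v 1" e] e v' by auto
        then have "packs ?E' t (lookup (single v 1 + e))" using all[OF v'] merge_iff by blast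
        moreover have "lookup (single v 1 + e) = (\<lambda>w. lookup e w + unit v w)"
          by (auto simp: fun_eq_iff lookup_add lookup_single when_def)
        ultimately show ?thesis by simp
      qed
    qed
    then show "e \<in> merge x y ` (packing_exponents E t \<inter> exponents n)" using merge_iff[OF e] by blast
  qed
  moreover have "(\<Sum>v\<in>{1..n} - {y}. var v) \<in> (irrelevant_ideal n :: 'k mpoly set)"
  proof -
    have "keys (\<Sum>v\<in>{1..n} - {y}. var v :: 'k mpoly) \<subseteq> exponents n \<inter> {e. e \<noteq> 0}"
      by (rule keys_sum_subset) (auto simp: var_def)
    then show ?thesis unfolding irrelevant_ideal_eq mon_ideal_def by simp
  qed
  moreover note ab = matching_binomial[OF a0 xy_eq, where 'k = 'k]
  ultimately have "regular_sequence (mpoly_ring n) (mon_quotient n (packing_exponents E t))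
      [var x - var y :: 'k mpoly, \<Sum>v\<in>{1..n} - {y}. var v]"
    by (intro regular_sequence_mon_quotientI(2)[OF up_closed_packing_exponents
          zero_notin_packing_exponents[OF t(1)] ab])
  from depth_ge[OF this, of "irrelevant_ideal n"] ab(1)
    \<open>(\<Sum>v\<in>{1..n} - {y}. var v) \<in> (irrelevant_ideal n :: 'k mpoly set)\<close>
  show ?thesis by (simp add: depth_of_power_def numeral_eq_enat eval_nat_numeral)
qed

end

text \<open>An arc and its reverse have the same incidences, so one orientation of the graph can
  stand for its symmetric arc set.\<close>

lemma packs_symmetric_closure:
  assumes "E \<subseteq> F" "\<And>a b. (a, b) \<in> F \<Longrightarrow> adjacent E a b"
  shows "packs F t u \<longleftrightarrow> packs E t u"
proof
  show "packs F t u" if "packs E t u" using that assms(1) by (auto simp: packs_def)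
  show "packs E t u" if "packs F t u" using that
  proof (induction t arbitrary: u)
    case (Suc t)
    then obtain a b u' where ab: "(a, b) \<in> F" "packs F t u'" "\<And>v. u' v + unit a v + unit b v \<le> u v"
      unfolding packs_Suc_iff by blast
    have "packs E t u'" by (rule Suc.IH[OF ab(2)])
    moreover have "(a, b) \<in> E \<or> (b, a) \<in> E" using assms(2)[OF ab(1)] by (simp add: adjacent_def)
    moreover have "u' v + unit b v + unit a v \<le> u v" for v using ab(3)[of v] by linarith
    ultimately show ?case using ab(3) packs_add_edge by metis
  qed simp
qed

lemma connected_cut:
  assumes "pair_graph G" "connected (with_proj G)" "X \<subseteq> pverts G" "X \<noteq> {}" "X \<noteq> pverts G"
  shows "\<exists>a\<in>X. \<exists>b\<in>pverts G - X. (a, b) \<in> parcs G"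
proof (rule ccontr)
  assume no: "\<not> ?thesis"
  interpret pair_graph G by (rule assms(1))
  have wf: "wf_digraph (with_proj G)" by unfold_locales
  have "symmetric (with_proj G)" by (rule pair_sym_arcs)
  then have sc: "strongly_connected (with_proj G)"
    using assms(2) wf_digraph.symmetric_connected_imp_strongly_connected[OF wf] by blast
  obtain u v where uv: "u \<in> X" "v \<in> pverts G" "v \<notin> X" using assms(3-5) by blast
  have "reachable (with_proj G) u v"
    using sc uv assms(3) by (auto simp: strongly_connected_def)
  then have "v \<in> X"
  proof (induction rule: reachable_induct)
    case base
    show ?case by (rule uv(1))
  next
    case (step x y)
    then show ?case using no in_arcsD2 by auto
  qed
  then show False using uv(3) by blast
qed

lemma distinct_if_incidences_le_1:
  assumes "\<And>v. incidences es v \<le> 1"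
  shows "distinct (map fst es)" and "distinct (map snd es)"
proof -
  have "distinct (map fst es) \<and> distinct (map snd es)" using assms
  proof (induction es)
    case (Cons e es)
    have le: "incidences es v \<le> 1" for v using Cons.prems[of v] by simp
    have "incidences es (fst e) = 0" "incidences es (snd e) = 0"
      using Cons.prems[of "fst e"] Cons.prems[of "snd e"] by (simp_all split: if_splits)
    then have "fst e \<notin> fst ` set es" "snd e \<notin> snd ` set es"
      using incidences_pos_iff[of es] by (metis gr_implies_not0 imageE)+
    then show ?case using Cons.IH[OF le] by simp
  qed simp
  then show "distinct (map fst es)" "distinct (map snd es)" by simp_all
qed

lemma vertex_cover_contains_minimal:
  assumes "finite (pverts G)" "vertex_cover G C"
  shows "\<exists>D\<subseteq>C. minimal_vertex_cover G D"
proof -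
  have "finite C" using assms finite_subset by (auto simp: vertex_cover_def)
  then show ?thesis using assms(2)
  proof (induction C rule: finite_psubset_induct)
    case (psubset C)
    show ?case
    proof (cases "minimal_vertex_cover G C")
      case False
      then obtain D where "D \<subset> C" "vertex_cover G D"
        using psubset.prems by (auto simp: minimal_vertex_cover_def)
      then show ?thesis using psubset.IH by (meson order_trans psubset_imp_subset)
    qed blast
  qed
qed

section \<open>Well-covered bipartite graphs\<close>

text \<open>No vertex is isolated, so neither side can be shrunk, and \<open>A\<close> and
  \<open>B\<close> are minimal covers of equal size. Every cover has at least \<open>card A\<close>
  vertices, and Koenig's theorem for the constant weight 1 yields a perfect matching.\<close>

lemma matched_bipartite_if_well_covered:
  assumes n: "n \<ge> 2" and G: "pair_graph G" and V: "pverts G = {1..n}"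
    and conn: "connected (with_proj G)" and bip: "bipartite G" and wc: "well_covered G"
  obtains A B \<mu> where "matched_bipartite A B (parcs G \<inter> A \<times> B) \<mu> n"
    and "\<And>a b. adjacent (parcs G \<inter> A \<times> B) a b \<longleftrightarrow> (a, b) \<in> parcs G" and "2 * card A = n"
proof -
  interpret pair_graph G by (rule G)
  obtain A B where AB: "A \<union> B = pverts G" "A \<inter> B = {}" "parcs G \<subseteq> A \<times> B \<union> B \<times> A"
    using bip by (auto simp: bipartite_def)
  have fin: "finite A" "finite B" using AB(1) V by (metis finite_Un finite_atLeastAtMost)+
  define E where "E = parcs G \<inter> A \<times> B"
  have edges: "E \<subseteq> A \<times> B" by (auto simp: E_def)
  have adj: "adjacent E a b \<longleftrightarrow> (a, b) \<in> parcs G" for a b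
    using AB(3) arcs_symmetric[of a b] arcs_symmetric[of b a] by (auto simp: adjacent_def E_def)
  have nbr: "\<exists>b. (v, b) \<in> parcs G" if "v \<in> pverts G" for v
  proof -
    have "{v} \<noteq> pverts G"
    proof
      assume "{v} = pverts G"
      then have "card (pverts G) = 1" by (metis card_1_singleton_iff One_nat_def)
      moreover have "card (pverts G) = n" by (simp add: V)
      ultimately show False using n by linarith
    qed
    then show ?thesis using connected_cut[OF G conn, of "{v}"] that by blast
  qed
  have cover_iff: "vertex_cover G C \<longleftrightarrow> C \<subseteq> A \<union> B \<and> covers E C" for C
  proof
    show "C \<subseteq> A \<union> B \<and> covers E C" if "vertex_cover G C"
      using that AB(1) by (auto simp: vertex_cover_def covers_def E_def)
    show "vertex_cover G C" if C: "C \<subseteq> A \<union> B \<and> covers E C"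
      unfolding vertex_cover_def
    proof (intro conjI ballI, unfold split_paired_all case_prod_conv)
      show "C \<subseteq> pverts G" using C AB(1) by simp
      fix u v assume "(u, v) \<in> parcs G"
      then have "adjacent E u v" by (simp add: adj)
      then show "u \<in> C \<or> v \<in> C" using C by (auto simp: adjacent_def covers_def)
    qed
  qed
  have A_min: "minimal_vertex_cover G A"
    unfolding minimal_vertex_cover_def
  proof (intro conjI allI impI notI)
    show "vertex_cover G A" using edges by (auto simp: cover_iff covers_def)
    fix D assume D: "D \<subset> A" "vertex_cover G D"
    then obtain a where a: "a \<in> A" "a \<notin> D" by blast
    then obtain b where "(a, b) \<in> parcs G" using nbr AB(1) by blast
    moreover from this have "b \<in> B" using AB(2,3) a(1) by blast
    ultimately have "b \<in> D" using a D(2) by (auto simp: vertex_cover_def)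
    then show False using \<open>b \<in> B\<close> D(1) AB(2) by blast
  qed
  have B_min: "minimal_vertex_cover G B"
    unfolding minimal_vertex_cover_def
  proof (intro conjI allI impI notI)
    show "vertex_cover G B" using edges by (auto simp: cover_iff covers_def)
    fix D assume D: "D \<subset> B" "vertex_cover G D"
    then obtain b where b: "b \<in> B" "b \<notin> D" by blast
    then obtain a where "(b, a) \<in> parcs G" using nbr AB(1) by blast
    moreover from this have "a \<in> A" using AB(2,3) b(1) by blast
    ultimately have "a \<in> D" using b D(2) by (auto simp: vertex_cover_def)
    then show False using \<open>a \<in> A\<close> D(1) AB(2) by blast
  qed
  have card_min: "card D = card A" if "minimal_vertex_cover G D" for D
    using wc A_min that unfolding well_covered_def by blast
  have cardB: "card B = card A" by (rule card_min[OF B_min])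
  have minimal: "\<exists>D\<subseteq>C. minimal_vertex_cover G D" if "C \<subseteq> A \<union> B" "covers E C" for C
    using vertex_cover_contains_minimal[OF pair_finite_verts, of C] that by (simp add: cover_iff)
  have "packs E (card A) (\<lambda>_. 1)"
  proof (rule packs_if_covers_ge[OF fin AB(2) edges])
    fix C assume C: "C \<subseteq> A \<union> B" "covers E C"
    then obtain D where D: "D \<subseteq> C" "minimal_vertex_cover G D" using minimal by blast
    have "finite C" using C(1) fin finite_subset by blast
    then show "card A \<le> (\<Sum>v\<in>C. 1)" using card_min[OF D(2)] card_mono[OF _ D(1)] by simp
  qed
  then obtain es where es: "length es = card A" "set es \<subseteq> E" "incidences es \<le> (\<lambda>_. 1)"
    by (auto simp: packs_def)
  have dist: "distinct (map fst es)" "distinct (map snd es)"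
    using distinct_if_incidences_le_1[of es] es(3) by (simp_all add: le_fun_def)
  have fst_A: "fst ` set es = A"
  proof (rule card_subset_eq[OF fin(1)])
    show "fst ` set es \<subseteq> A" using es(2) edges by auto
    show "card (fst ` set es) = card A" using distinct_card[OF dist(1)] es(1) by simp
  qed
  have snd_B: "snd ` set es = B"
  proof (rule card_subset_eq[OF fin(2)])
    show "snd ` set es \<subseteq> B" using es(2) edges by auto
    show "card (snd ` set es) = card B" using distinct_card[OF dist(2)] es(1) cardB by simp
  qed
  define \<mu> where "\<mu> a = the (map_of es a)" for a
  have \<mu>: "\<mu> (fst e) = snd e" if "e \<in> set es" for e
    using map_of_is_SomeI[OF dist(1), of "fst e" "snd e"] that by (simp add: \<mu>_def)
  have \<mu>_image: "\<mu> ` A = B"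
  proof -
    have "\<mu> ` fst ` set es = snd ` set es" using \<mu> by (simp add: image_image)
    then show ?thesis by (simp only: fst_A snd_B)
  qed
  have \<mu>_inj: "inj_on \<mu> A" by (rule eq_card_imp_inj_on[OF fin(1)]) (simp add: \<mu>_image cardB)
  have \<mu>_edge: "(a, \<mu> a) \<in> E" if a: "a \<in> A" for a
  proof -
    obtain e where "e \<in> set es" "a = fst e" using a fst_A by blast
    then show ?thesis using \<mu> es(2) by auto
  qed
  have A_ne: "A \<noteq> {}"
  proof
    assume "A = {}"
    then have "A \<union> B = {}" using cardB fin(2) by simp
    moreover have "1 \<in> A \<union> B" unfolding AB(1) V using n by simp
    ultimately show False by blast
  qed
  have "matched_bipartite A B E \<mu> n"
  proof
    show "finite A" "A \<noteq> {}" "A \<inter> B = {}" "A \<union> B = {1..n}" "E \<subseteq> A \<times> B"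
      using fin A_ne AB edges V by simp_all
    show "bij_betw \<mu> A B" using \<mu>_inj \<mu>_image by (simp add: bij_betw_def)
    show "(a, \<mu> a) \<in> E" if "a \<in> A" for a by (rule \<mu>_edge[OF that])
  next
    fix X assume X: "X \<subseteq> A" "X \<noteq> {}" "X \<noteq> A"
    \<comment> \<open>A union of matching edges, so an arc that leaves it joins two different
      ones.\<close>
    let ?Y = "X \<union> \<mu> ` X"
    have "?Y \<subseteq> pverts G" "?Y \<noteq> {}" using X \<mu>_image AB(1) by auto
    moreover have "?Y \<noteq> pverts G"
    proof -
      obtain a where "a \<in> A" "a \<notin> X" using X(1,3) by blast
      moreover from this have "a \<notin> \<mu> ` X" using X(1) \<mu>_image AB(2) by blast
      ultimately show ?thesis using AB(1) by blast
    qed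
    ultimately have "\<exists>p\<in>?Y. \<exists>q\<in>pverts G - ?Y. (p, q) \<in> parcs G"
      by (intro connected_cut[OF G conn])
    then obtain p q where pq: "p \<in> ?Y" "q \<in> pverts G - ?Y" "(p, q) \<in> parcs G" by blast
    from pq(1) show "\<exists>i\<in>X. \<exists>j\<in>A - X. (i, \<mu> j) \<in> E \<or> (j, \<mu> i) \<in> E"
    proof
      assume p: "p \<in> X"
      then have "q \<in> B" using pq(3) AB(2,3) X(1) by blast
      then obtain j where "j \<in> A" "q = \<mu> j" using \<mu>_image by blast
      moreover have "(p, q) \<in> E" using pq(3) p X(1) \<open>q \<in> B\<close> by (auto simp: E_def)
      ultimately show ?thesis using p pq(2) by blast
    next
      assume "p \<in> \<mu> ` X"
      then obtain i where i: "i \<in> X" "p = \<mu> i" by blast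
      then have "p \<in> B" using X(1) \<mu>_image by blast
      then have "q \<in> A" using pq(3) AB(2,3) by blast
      then have "(q, p) \<in> E" using arcs_symmetric[OF pq(3)] \<open>p \<in> B\<close> by (simp add: E_def)
      then show ?thesis using i \<open>q \<in> A\<close> pq(2) by blast
    qed
  next
    fix C assume "C \<subseteq> A \<union> B" "covers E C"
    then obtain D where D: "D \<subseteq> C" "minimal_vertex_cover G D" using minimal by blast
    then have cD: "D \<subseteq> A \<union> B" "covers E D" using cover_iff by (auto simp: minimal_vertex_cover_def)
    have "a \<in> D \<longleftrightarrow> \<mu> a \<notin> D" if a: "a \<in> A" for a
    proof -
      \<comment> \<open>\<open>g\<close> picks from each matching edge an end in \<open>D\<close>.
        It is injective and \<open>D\<close> has only \<open>card A\<close> elements, so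
        \<open>D\<close> is its image and contains no second end.\<close>
      define g where "g i = (if i \<in> D then i else \<mu> i)" for i
      have \<mu>A: "\<mu> i \<notin> A" if "i \<in> A" for i using that \<mu>_image AB(2) by blast
      have gD: "g ` A \<subseteq> D"
        using cD(2) \<mu>_edge by (fastforce simp: g_def covers_def)
      have "inj_on g A"
      proof (rule inj_onI)
        fix i j assume ij: "i \<in> A" "j \<in> A" "g i = g j"
        show "i = j"
          using ij \<mu>A[OF ij(1)] \<mu>A[OF ij(2)] inj_onD[OF \<mu>_inj _ ij(1,2)]
          by (auto simp: g_def split: if_splits)
      qed
      then have "g ` A = D"
        using gD card_min[OF D(2)] cD(1) fin card_image[of g A]
        by (intro card_subset_eq) (auto intro: finite_subset)
      then have no: "\<not> (a \<in> D \<and> \<mu> a \<in> D)"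
        using a \<mu>A \<mu>_inj unfolding g_def inj_on_def by (smt (verit) imageE)
      have "(a, \<mu> a) \<in> E" by (rule \<mu>_edge[OF a])
      then show ?thesis using no cD(2) by (auto simp: covers_def)
    qed
    then show "\<exists>D\<subseteq>C. covers E D \<and> (\<forall>a\<in>A. a \<in> D \<longleftrightarrow> \<mu> a \<notin> D)" using D(1) cD(2) by blast
  qed
  moreover have "2 * card A = n"
    using card_Un_disjoint[OF fin AB(2)] AB(1) V cardB by simp
  ultimately show thesis using that adj unfolding E_def by blast
qed

lemma pawalk_verts_eq: "pcas u p v \<Longrightarrow> pawalk_verts u p = u # map snd p"
  by (induction p arbitrary: u) auto

lemma (in matched_bipartite) has_cycle_iff:
  assumes "\<And>a b. adjacent E a b \<longleftrightarrow> (a, b) \<in> parcs G" and "pverts G = A \<union> B"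
  shows "has_cycle \<longleftrightarrow> (\<exists>p. pre_digraph.cycle (with_proj G) p \<and> length p \<ge> 3)"
proof
  assume has_cycle
  then obtain u p where p: "pcas u p u" "distinct (map snd p)" "length p \<ge> 3"
    "\<And>e. e \<in> set p \<Longrightarrow> adjacent E (fst e) (snd e)" unfolding has_cycle_def by blast
  obtain e q where eq: "p = e # q" using p(3) by (cases p) auto
  then have "u \<in> A \<union> B" using p(1) p(4)[of e] edges by (auto simp: adjacent_def)
  moreover have "set p \<subseteq> parcs G" using p(4) assms(1) by auto
  moreover have "distinct (tl (pawalk_verts u p))" using p(2) by (simp add: pawalk_verts_eq[OF p(1)])
  moreover have "p \<noteq> []" using p(3) by auto
  ultimately have "pre_digraph.cycle (with_proj G) p"
    using p(1) unfolding pre_digraph.cycle_def pre_digraph.awalk_def cas_with_proj_eq awalk_verts_with_proj_eq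
    by (intro exI[of _ u]) (simp add: assms(2))
  then show "\<exists>p. pre_digraph.cycle (with_proj G) p \<and> length p \<ge> 3" using p(3) by blast
next
  assume "\<exists>p. pre_digraph.cycle (with_proj G) p \<and> length p \<ge> 3"
  then obtain u p where p: "pcas u p u" "set p \<subseteq> parcs G" "distinct (tl (pawalk_verts u p))" "length p \<ge> 3"
    unfolding pre_digraph.cycle_def pre_digraph.awalk_def cas_with_proj_eq awalk_verts_with_proj_eq
      with_proj_simps by blast
  then have "distinct (map snd p)" by (simp add: pawalk_verts_eq[OF p(1)])
  moreover have "adjacent E (fst e) (snd e)" if "e \<in> set p" for e using that p(2) assms(1) by auto
  ultimately show has_cycle unfolding has_cycle_def using p(1,4) by blast
qed

lemma (in matched_bipartite) graph_leaves_eq: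
  assumes "\<And>a b. adjacent E a b \<longleftrightarrow> (a, b) \<in> parcs G" and "pverts G = A \<union> B"
  shows "leaves G = graph_leaves"
proof -
  have "out_degree (with_proj G) v = 1 \<longleftrightarrow> (\<exists>!w. adjacent E v w)" for v
  proof -
    have "out_arcs (with_proj G) v = Pair v ` {w. (v, w) \<in> parcs G}" by (auto simp: out_arcs_def)
    then have "out_degree (with_proj G) v = card {w. (v, w) \<in> parcs G}"
      by (simp add: out_degree_def card_image inj_on_def)
    also have "\<dots> = 1 \<longleftrightarrow> (\<exists>w. {w. (v, w) \<in> parcs G} = {w})"
      by (simp add: card_1_singleton_iff)
    also have "\<dots> \<longleftrightarrow> (\<exists>!w. (v, w) \<in> parcs G)"
      by (simp add: set_eq_iff) metis
    finally show ?thesis by (simp add: assms(1))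
  qed
  then show ?thesis by (simp add: leaves_def graph_leaves_def assms(2))
qed

theorem theorem4p10:
  fixes n :: nat
    and G :: "nat pair_pre_digraph"
    and I :: "('k::field) mpoly set"
  assumes "n \<ge> 2"
    and "pair_graph G"
    and "pverts G = {1..n}"
    and "connected (with_proj G)"
    and "bipartite G"
    and "well_covered G"
    and "I = edge_ideal n G"
  shows "real (dstab n I) \<le> real n / 2 \<and>
    (real (dstab n I) = real n / 2 \<longleftrightarrow>
      undirected_tree G \<and> (real (card (leaves G)) = real n / 2 \<or> n = 2))"
proof -
  obtain A B \<mu> where loc: "matched_bipartite A B (parcs G \<inter> A \<times> B) \<mu> n"
    and adj: "\<And>a b. adjacent (parcs G \<inter> A \<times> B) a b \<longleftrightarrow> (a, b) \<in> parcs G" and n2: "2 * card A = n"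
    using matched_bipartite_if_well_covered[OF assms(1-6)] by blast
  interpret matched_bipartite A B "parcs G \<inter> A \<times> B" \<mu> n by (rule loc)
  interpret pair_graph G by (rule assms(2))
  have V: "pverts G = A \<union> B" using assms(3) vertices by simp
  have parcs: "parcs G \<subseteq> {1..n} \<times> {1..n}"
    using in_arcsD1 in_arcsD2 unfolding assms(3)[symmetric] by auto
  define D where "D = depth_of_power TYPE('k)"
  have "packing_exponents (parcs G) t = packing_exponents (parcs G \<inter> A \<times> B) t" for t
    unfolding packing_exponents_def
    using packs_symmetric_closure[of "parcs G \<inter> A \<times> B" "parcs G"] adj by blast
  then have D: "depth_quotient_power n I t = D t" for t
    by (simp add: depth_quotient_power_def assms(7) edge_ideal_power[OF parcs] D_def depth_of_power_def)
  have D_ge: "D t \<ge> 1" if "t > 0" for t unfolding D_def by (rule depth_of_power_ge_1[OF that])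
  define P where "P s \<longleftrightarrow> s \<ge> 1 \<and> (\<forall>t\<ge>s. D t = D s)" for s
  have dstab: "dstab n I = (LEAST s. P s)" by (simp add: dstab_def D P_def)
  have P: "P s" if "s \<ge> 1" "\<And>t. t \<ge> s \<Longrightarrow> D t \<le> 1" for s
  proof -
    have "D t = 1" if "t \<ge> s" for t
      using \<open>s \<ge> 1\<close> \<open>t \<ge> s\<close> \<open>\<And>t. t \<ge> s \<Longrightarrow> D t \<le> 1\<close>[OF that] D_ge[of t] by (intro antisym) auto
    then show ?thesis using that(1) by (simp add: P_def)
  qed
  have m1: "card A \<ge> 1" using n2 assms(1) by linarith
  have D_le: "D t \<le> 1" if "t \<ge> card A" for t
    unfolding D_def by (rule depth_of_power_le_1_general[OF that])
  have PA: "P (card A)" using P m1 D_le by blast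
  have le: "dstab n I \<le> card A" unfolding dstab using PA by (rule Least_le)
  have PL: "P (dstab n I)" unfolding dstab using PA by (rule LeastI)
  have tree_iff: "undirected_tree G \<longleftrightarrow> \<not> has_cycle"
    using assms(4) has_cycle_iff[OF adj V] by (simp add: undirected_tree_def)
  \<comment> \<open>The case \<open>card A = 1\<close> is the single edge, which has two
    leaves.\<close>
  have eq_iff: "dstab n I = card A \<longleftrightarrow>
      undirected_tree G \<and> (card (leaves G) = card A \<or> card A = 1)"
  proof
    assume eq: "dstab n I = card A"
    have "flat \<and> \<not> has_cycle"
    proof (rule ccontr)
      assume no: "\<not> (flat \<and> \<not> has_cycle)"
      have m2: "card A \<ge> 2" by (rule depth_of_power_le_1_if_not_flat_tree(1)[OF no])
      have "P (card A - 1)"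
        using m2 depth_of_power_le_1_if_not_flat_tree(2)[OF no] by (intro P) (auto simp: D_def)
      then have "dstab n I \<le> card A - 1" unfolding dstab by (rule Least_le)
      then show False using eq m2 by linarith
    qed
    then show "undirected_tree G \<and> (card (leaves G) = card A \<or> card A = 1)"
      using flat_card_leaves m1 tree_iff graph_leaves_eq[OF adj V] by (cases "card A = 1") auto
  next
    assume tree: "undirected_tree G \<and> (card (leaves G) = card A \<or> card A = 1)"
    show "dstab n I = card A"
    proof (rule ccontr)
      assume "dstab n I \<noteq> card A"
      then have less: "dstab n I < card A" using le by linarith
      have pos: "dstab n I > 0" using PL by (simp add: P_def)
      have "card A \<ge> 2" using less pos by linarith
      \<comment> \<open>Stability would give this index the same depth as \<open>card A\<close>,
        where the depth is at most 1.\<close>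
      then have "2 \<le> D (dstab n I)"
        unfolding D_def using tree tree_iff graph_leaves_eq[OF adj V] less pos
        by (intro depth_of_power_ge_2) auto
      also have "\<dots> = D (card A)" using PL less unfolding P_def by (metis less_imp_le)
      also have "\<dots> \<le> 1" by (rule D_le) simp
      finally show False by simp
    qed
  qed
  have "real n / 2 = real (card A)" using n2 by linarith
  moreover have "card A = 1 \<longleftrightarrow> n = 2" using n2 by linarith
  ultimately show ?thesis using le eq_iff by simp
qed

end
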